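(* Let $G(x)=\prod_{j,k=1}^\infty \big(1-x^{jk(j+k)/2}\big)^{-1}$ for $|x|<1$ and $h(t)=\log G(e^{-t})$ for $t>0$. Let $\omega(s)$ be the meromorphic continuation to $\mathbb{C}$ of $\sum_{j,k=1}^\infty (jk(j+k))^{-s}$ (which is holomorphic at $s=0$), and set $$\mu_1=\frac{2^{2/3}}{3}\Gamma\!\left(\tfrac13\right)^2\zeta\!\left(\tfrac53\right),\qquad \mu_2=\sqrt{2\pi}\,\zeta\!\left(\tfrac12\right)\zeta\!\left(\tfrac32\right).$$ Then as $t\searrow0$, $$h(t)=\mu_1t^{-2/3}+\mu_2t^{-1/2}-\tfrac13\log t+\omega'(0)+\tfrac13\log2+O(t^{1/2}),$$ $$h'(t)=-\tfrac23\mu_1t^{-5/3}-\tfrac12\mu_2t^{-3/2}-\tfrac13t^{-1}+O(t^{-1/2}),$$ $$h''(t)=\tfrac{10}{9}\mu_1t^{-8/3}+\tfrac34\mu_2t^{-5/2}+\tfrac13t^{-2}+O(t^{-3/2}).$$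
   Context: $\Gamma$ is the Euler gamma function, $\zeta$ the Riemann zeta function. *)

theory Defs
  imports "HOL-Complex_Analysis.Complex_Analysis" "HOL-Library.Landau_Symbols"
begin

text \<open>
  The predicate \<open>nicely_meromorphic_on\<close> fixes the values at singular points: removable
  singularities are filled in and poles get the junk value 0. This makes a continuation unique as a
  total function, see below.
\<close>

definition is_meromorphic_continuation ::
    "(complex \<Rightarrow> complex) \<Rightarrow> (complex \<Rightarrow> complex) \<Rightarrow> complex set \<Rightarrow> bool" where
  "is_meromorphic_continuation F f A \<longleftrightarrow>
     F nicely_meromorphic_on UNIV \<and> (\<forall>s\<in>A. F s = f s)"

lemma is_meromorphic_continuation_unique:
  assumes F: "is_meromorphic_continuation F f A" and H: "is_meromorphic_continuation H f A"
    and A: "open A" "A \<noteq> {}"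
  shows "F = H"
proof -
  define D where "D = (\<lambda>z. F z - H z)"
  have nF: "F nicely_meromorphic_on UNIV" and nH: "H nicely_meromorphic_on UNIV"
    using F H by (auto simp: is_meromorphic_continuation_def)
  have mD: "D meromorphic_on UNIV"
    using nF nH unfolding D_def nicely_meromorphic_on_def by (auto intro!: meromorphic_intros)
  have nD: "remove_sings D nicely_meromorphic_on UNIV"
    by (rule remove_sings_nicely_meromorphic[OF mD])
  obtain a where a: "a \<in> A" using A by auto
  have "\<forall>\<^sub>F z in nhds a. z \<in> A"
    using a A(1) by (simp add: eventually_nhds_in_open)
  hence "\<forall>\<^sub>F z in at a. z \<in> A"
    by (rule eventually_nhds_conv_at[THEN iffD1, THEN conjunct1])
  hence ev0: "\<forall>\<^sub>F z in at a. D z = 0"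
    by eventually_elim (use F H in \<open>auto simp: is_meromorphic_continuation_def D_def\<close>)
  have iso: "isolated_singularity_at D z" for z
    using mD by (meson UNIV_I meromorphic_on_isolated_singularity meromorphic_on_subset subset_UNIV)
  have "\<forall>\<^sub>F z in at a. remove_sings D z = 0"
    using ev0 eventually_remove_sings_eq_at[OF iso[of a]] by eventually_elim auto
  hence "\<exists>\<^sub>F z in at a. remove_sings D z = 0"
    by (intro eventually_frequently) auto
  hence RD: "remove_sings D z = 0" for z
    using frequently_eq_meromorphic_imp_constant[OF _ nD open_UNIV connected_UNIV UNIV_I] by blast
  have ev: "\<forall>\<^sub>F w in at z. F w = H w" for z
    using eventually_remove_sings_eq_at[OF iso[of z]]
    by eventually_elim (use RD in \<open>auto simp: D_def\<close>)
  show "F = H"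
  proof
    fix z
    have p: "is_pole F z \<longleftrightarrow> is_pole H z"
      by (rule is_pole_cong[OF ev refl])
    show "F z = H z"
    proof (cases "is_pole F z")
      case True
      have "\<not> F \<midarrow>z\<rightarrow> c" "\<not> H \<midarrow>z\<rightarrow> c" for c
        using True p unfolding is_pole_def
        by (metis at_neq_bot not_tendsto_and_filterlim_at_infinity)+
      thus ?thesis
        using nF nH unfolding nicely_meromorphic_on_def by (metis UNIV_I)
    next
      case False
      hence "F \<midarrow>z\<rightarrow> F z" and h: "H \<midarrow>z\<rightarrow> H z"
        using nF nH p unfolding nicely_meromorphic_on_def by auto
      moreover have "F \<midarrow>z\<rightarrow> H z"
        using h ev[of z] by (metis (mono_tags, lifting) tendsto_cong)
      ultimately show ?thesis
        using LIM_unique by blast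
    qed
  qed
qed

text \<open>The Riemann zeta function (with the junk value 0 at its pole).\<close>

definition zeta :: "complex \<Rightarrow> complex" where
  "zeta = (THE Z. is_meromorphic_continuation Z
                    (\<lambda>s. \<Sum>n. of_nat (Suc n) powr (-s)) {s. Re s > 1})"

text \<open>The half-plane below is exactly the domain of absolute convergence of the double series.\<close>

definition omega_series :: "complex \<Rightarrow> complex" where
  "omega_series s = (\<Sum>\<^sub>\<infinity>(j, k)\<in>{1..} \<times> {1..}. of_nat (j * k * (j + k)) powr (-s))"

definition is_omega :: "(complex \<Rightarrow> complex) \<Rightarrow> bool" where
  "is_omega \<omega> \<longleftrightarrow> is_meromorphic_continuation \<omega> omega_series {s. Re s > 2 / 3}"

text \<open>The exponent is an integer, as \<open>j * k * (j + k)\<close> is always even; so \<open>div\<close> is exact.\<close>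

definition G :: "'a \<Rightarrow> 'a :: real_normed_field" where
  "G x = (\<Prod>j. \<Prod>k. inverse (1 - x ^ (Suc j * Suc k * (Suc j + Suc k) div 2)))"

definition h :: "real \<Rightarrow> real" where
  "h t = ln (G (exp (- t)))"

definition mu1 :: complex where
  "mu1 = of_real (2 powr (2 / 3) / 3 * Gamma (1 / 3) ^ 2) * zeta (5 / 3)"

definition mu2 :: complex where
  "mu2 = of_real (sqrt (2 * pi)) * zeta (1 / 2) * zeta (3 / 2)"

end

(*
  Put S(u) = sum over j, k >= 1 of psi(u j k (j + k)) with psi(x) = x^2 e^x / (e^x - 1)^2. Then
  t^2 h''(t) = S(t/2), and everything follows from the expansion
    S(u) = A u^(-2/3) + B u^(-1/2) + 1/3 + O(u^(1/2)),
  since integrating twice yields h' and h up to an additive constant c.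

  By symmetry it suffices to sum over k > j. For fixed j, the trapezoidal rule with end correction
  replaces the sum over k by an integral from k = j on: the boundary values cancel against the
  diagonal j = k, and the end corrections contribute 1/12. After k = j v the remaining sum over j is
  T(a) = sum_j j psi(a j^3), taken at a = u v (v + 1) and integrated over v >= 1. The same rule gives
  T(a) = K a^(-2/3) - 1/12 + O(a^(3/5)), and the substitution y^2 = v (v + 1) turns the integral into
  the three main terms. The coefficients are a Beta integral and, by analytic continuation of the
  Mellin transform of T, which is zeta(3s - 1) times that of psi, the value zeta(1/2).

  For the constant, omega(s) 2^s is the quotient of the Mellin transforms of h and of
  -log(1 - e^(-x)). The expansions at t = 0 continue both transforms to Re s > -1/2, with double poles
  at 0 whose Laurent coefficients give omega'(0) = c - (log 2)/3. Since all identities between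
  continuations follow from a real segment, no growth estimates on vertical lines are needed.
*)

theory Submission
  imports Defs "HOL-Real_Asymp.Real_Asymp"
begin

section \<open>The kernel\<close>

text \<open>The second derivative is expanded first because -log (1 - e^(-x)) has a logarithmic
  singularity at 0, whereas psi is smooth there, so that trapezoidal rules may start at 0.
  Integrating back loses nothing: the constant of the first integration is absorbed by the error
  t^(-1/2), and the second integral of the error converges at 0. The obstacle is the region near the
  axes, where u j k (j + k) stays small although one variable is large. A row started at k = 0 would
  have the boundary value psi(0) = 1 for every j, and these end terms could not be summed over j;
  started at k = j they are functions of u j^3 and can. The axis region, with j bounded and k of
  order u^(-1/2), then corresponds to arguments a of order 1 in T(a), and it produces the term
  u^(-1/2) as an integral of the remainder T(a) - K a^(-2/3) at a = u y^2. That integral is a Mellin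
  transform outside the half-plane where the Dirichlet series converges, hence zeta(1/2).\<close>

definition expm1_quot :: "complex \<Rightarrow> complex" where
  "expm1_quot z = (if z = 0 then 1 else (exp z - 1) / z)"

lemma expm1_quot_holomorphic: "expm1_quot holomorphic_on UNIV"
proof -
  have "(\<lambda>z. if z = 0 then deriv exp 0 else (exp z - exp 0) / (z - 0)) holomorphic_on (UNIV::complex set)"
    by (rule pole_lemma) (auto intro: holomorphic_intros)
  moreover have "(\<lambda>z::complex. if z = 0 then deriv exp 0 else (exp z - exp 0) / (z - 0)) = expm1_quot"
    by (auto simp: expm1_quot_def fun_eq_iff intro!: DERIV_imp_deriv derivative_eq_intros)
  ultimately show ?thesis by simp
qed

text \<open>The zeros are the nonzero multiples of 2 pi i. The bound 2 is a convenient number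
  between 1, the radius of the discs in \<open>bose_decay\<close>, and 2 pi.\<close>

lemma expm1_quot_nonzero:
  assumes "\<bar>Im z\<bar> < 2" shows "expm1_quot z \<noteq> 0"
proof
  assume "expm1_quot z = 0"
  then have z: "z \<noteq> 0" "exp z = 1" by (auto simp: expm1_quot_def split: if_splits)
  then obtain n :: int where n: "Re z = 0" "Im z = of_int (2 * n) * pi"
    by (auto simp: exp_eq_1)
  have "n = 0"
  proof (rule ccontr)
    assume "n \<noteq> 0"
    then have "\<bar>real_of_int n\<bar> \<ge> 1" by linarith
    then have "\<bar>Im z\<bar> \<ge> 2 * pi" using n pi_gt_zero by (simp add: abs_mult)
    then show False using assms pi_gt3 by simp
  qed
  then show False using n z by (simp add: complex_eq_iff)
qed

text \<open>This is z^2 e^z / (e^z - 1)^2 with the removable singularity at 0 filled in, the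
  function psi of the overview.\<close>

definition bose_kernel :: "complex \<Rightarrow> complex" where
  "bose_kernel z = exp z / (expm1_quot z)\<^sup>2"

definition bose_strip :: "complex set" where "bose_strip = {z. \<bar>Im z\<bar> < 2}"

lemma open_bose_strip: "open bose_strip"
  unfolding bose_strip_def by (intro open_Collect_less continuous_intros)

lemma bose_kernel_holomorphic: "bose_kernel holomorphic_on bose_strip"
  unfolding bose_kernel_def using expm1_quot_nonzero
  by (intro holomorphic_intros holomorphic_on_subset[OF expm1_quot_holomorphic]) (auto simp: bose_strip_def)

text \<open>The derivatives are taken over the complex numbers: holomorphy provides all of them at
  once, and Cauchy's inequality transfers the decay of the kernel to each of them without an
  explicit formula.\<close>

definition bose :: "nat \<Rightarrow> real \<Rightarrow> real" where
  "bose n x = Re ((deriv ^^ n) bose_kernel (of_real x))"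

lemma bose_deriv: "(bose n has_real_derivative bose (Suc n) x) (at x)"
proof -
  have "(deriv ^^ n) bose_kernel holomorphic_on bose_strip"
    by (rule holomorphic_higher_deriv[OF bose_kernel_holomorphic open_bose_strip])
  moreover have "complex_of_real x \<in> bose_strip" by (simp add: bose_strip_def)
  ultimately have "((deriv ^^ n) bose_kernel has_field_derivative (deriv ^^ Suc n) bose_kernel x) (at (of_real x))"
    using holomorphic_derivI open_bose_strip by fastforce
  then have "(((deriv ^^ n) bose_kernel \<circ> of_real) has_vector_derivative (deriv ^^ Suc n) bose_kernel x) (at x)"
    using field_vector_diff_chain_at[OF has_vector_derivative_of_real[OF DERIV_ident]]
    by (metis mult.left_neutral of_real_1)
  then have "((\<lambda>x. Re (((deriv ^^ n) bose_kernel \<circ> of_real) x)) has_vector_derivative Re ((deriv ^^ Suc n) bose_kernel x)) (at x)"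
    by (simp add: has_vector_derivative_def bounded_linear.has_derivative[OF bounded_linear_Re, of _ "\<lambda>h. h *\<^sub>R _", simplified] )
      (drule bounded_linear.has_derivative[OF bounded_linear_Re], simp add: mult.commute)
  then show ?thesis
    by (simp add: bose_def[abs_def] has_real_derivative_iff_has_vector_derivative o_def)
qed

lemma bose_0: "x \<noteq> 0 \<Longrightarrow> bose 0 x = x\<^sup>2 * exp x / (exp x - 1)\<^sup>2" "bose 0 0 = 1"
proof -
  assume "x \<noteq> 0"
  then have "bose_kernel (of_real x) = of_real (x\<^sup>2 * exp x / (exp x - 1)\<^sup>2)"
    by (simp add: bose_kernel_def expm1_quot_def exp_of_real power_divide)
  then show "bose 0 x = x\<^sup>2 * exp x / (exp x - 1)\<^sup>2"
    by (simp add: bose_def del: of_real_mult of_real_divide of_real_power)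
qed (simp add: bose_def bose_kernel_def expm1_quot_def)

lemma bose_nonneg: "bose 0 x \<ge> 0"
  by (cases "x = 0") (auto simp: bose_0)

text \<open>The half-strip contains all closed discs of radius 1 about points x \<ge> 0, as Cauchy's
  inequality requires. The true decay is e^(-Re z) times a quadratic polynomial in Re z; half of the
  exponent pays for the polynomial. Up to Re z = 2 compactness suffices.\<close>

lemma bose_kernel_bound:
  obtains B where "\<And>z. Re z \<ge> -1 \<Longrightarrow> \<bar>Im z\<bar> \<le> 1 \<Longrightarrow> norm (bose_kernel z) \<le> B * exp (- Re z / 2)"
proof -
  define S where "S = cbox (Complex (-1) (-1)) (Complex 2 1)"
  have "S \<subseteq> bose_strip" by (auto simp: S_def bose_strip_def in_cbox_complex_iff)
  then have "compact (bose_kernel ` S)"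
    using bose_kernel_holomorphic holomorphic_on_imp_continuous_on holomorphic_on_subset
    by (intro compact_continuous_image) (auto simp: S_def)
  then obtain B1 where B1: "\<And>z. z \<in> S \<Longrightarrow> norm (bose_kernel z) \<le> B1" "B1 > 0"
    using compact_imp_bounded bounded_pos by (metis image_eqI)
  have "eventually (\<lambda>x::real. 4 * (x + 1)\<^sup>2 * exp (-x/2) \<le> 1) at_top" by real_asymp
  then obtain X where X: "\<And>x. x \<ge> X \<Longrightarrow> 4 * (x + 1)\<^sup>2 * exp (-x/2) \<le> (1::real)"
    by (auto simp: eventually_at_top_linorder)
  define B2 where "B2 = 4 * (\<bar>X\<bar> + 1)\<^sup>2 + 1"
  have B2: "4 * (x + 1)\<^sup>2 * exp (-x/2) \<le> B2" if "x \<ge> 0" for x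
  proof (cases "x \<ge> X")
    case True
    have "0 \<le> 4 * (\<bar>X\<bar> + 1)\<^sup>2" by simp
    then show ?thesis using X[OF True] unfolding B2_def by linarith
  next
    case False
    then have "(x+1)\<^sup>2 \<le> (\<bar>X\<bar> + 1)\<^sup>2" using that by (intro power_mono) auto
    moreover have "4 * (x + 1)\<^sup>2 * exp (-x/2) \<le> 4 * (x + 1)\<^sup>2 * 1"
      using that by (intro mult_left_mono) auto
    ultimately show ?thesis by (simp add: B2_def)
  qed
  have *: "norm (bose_kernel z) \<le> (B1 * exp 1 + B2) * exp (- Re z / 2)" if z: "Re z \<ge> -1" "\<bar>Im z\<bar> \<le> 1" for z
  proof (cases "Re z \<le> 2")
    case True
    then have "z \<in> S" using z by (auto simp: S_def in_cbox_complex_iff)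
    then have "norm (bose_kernel z) \<le> B1 * 1" using B1 by simp
    also have "\<dots> \<le> B1 * (exp 1 * exp (- Re z / 2))"
      using B1(2) True by (intro mult_left_mono) (auto simp flip: exp_add)
    also have "\<dots> \<le> (B1 * exp 1 + B2) * exp (- Re z / 2)"
      by (simp add: B2_def algebra_simps)
    finally show ?thesis .
  next
    case False
    define x where "x = Re z"
    have x: "x > 2" using False x_def by simp
    then have z0: "z \<noteq> 0" using x_def by auto
    have "exp x \<ge> 2" using exp_ge_add_one_self[of x] x by linarith
    then have "exp x / 2 \<le> norm (exp z) - norm (1::complex)" by (simp add: x_def)
    also have "\<dots> \<le> norm (exp z - 1)" by (rule norm_triangle_ineq2)
    finally have e: "exp x / 2 \<le> norm (exp z - 1)" .
    have "norm z \<le> x + 1" using cmod_le[of z] z x by (simp add: x_def)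
    then have nz: "norm z ^ 2 \<le> (x+1)^2" by (intro power_mono) auto
    have "norm (bose_kernel z) = exp x * norm z ^ 2 / norm (exp z - 1) ^ 2"
      using z0 by (simp add: bose_kernel_def expm1_quot_def norm_divide norm_power norm_mult power_divide x_def)
    also have "\<dots> \<le> exp x * (x+1)^2 / (exp x / 2) ^ 2"
      by (rule frac_le[OF _ mult_left_mono[OF nz] _ power_mono[OF e]]) auto
    also have "\<dots> = 4 * (x + 1)\<^sup>2 * (1 / exp x)"
      by (simp add: power2_eq_square)
    also have "1 / exp x = exp (-x/2) * exp (-x/2)"
      by (simp add: exp_minus inverse_eq_divide flip: exp_add)
    also have "4 * (x + 1)\<^sup>2 * (exp (-x/2) * exp (-x/2)) = (4 * (x + 1)\<^sup>2 * exp (-x/2)) * exp (-x/2)"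
      by (simp only: mult.assoc)
    also have "\<dots> \<le> B2 * exp (-x/2)"
      using B2[of x] x by (intro mult_right_mono) auto
    also have "\<dots> \<le> (B1 * exp 1 + B2) * exp (- Re z / 2)"
      using B1(2) by (simp add: x_def algebra_simps)
    finally show ?thesis .
  qed
  show ?thesis by (rule that[OF *])
qed

lemma bose_decay: "\<exists>C. \<forall>x\<ge>0. \<bar>bose n x\<bar> \<le> C * exp (- x / 2)"
proof -
  obtain B where B: "\<And>z. Re z \<ge> -1 \<Longrightarrow> \<bar>Im z\<bar> \<le> 1 \<Longrightarrow> norm (bose_kernel z) \<le> B * exp (- Re z / 2)"
    using bose_kernel_bound by blast
  have "norm (bose_kernel 0) \<le> B" using B[of 0] by simp
  then have B0: "B \<ge> 0" by (rule order_trans[OF norm_ge_zero])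
  have "\<bar>bose n x\<bar> \<le> (fact n * B * exp (1/2)) * exp (- x / 2)" if "x \<ge> 0" for x
  proof -
    have sub: "cball (complex_of_real x) 1 \<subseteq> bose_strip"
    proof
      fix z assume "z \<in> cball (complex_of_real x) 1"
      then show "z \<in> bose_strip" using abs_Im_le_cmod[of "complex_of_real x - z"]
        by (auto simp: bose_strip_def dist_norm)
    qed
    have hol: "bose_kernel holomorphic_on ball (of_real x) 1"
      using bose_kernel_holomorphic sub by (meson ball_subset_cball holomorphic_on_subset subset_trans)
    have cont: "continuous_on (cball (of_real x) 1) bose_kernel"
      using bose_kernel_holomorphic sub by (meson holomorphic_on_imp_continuous_on holomorphic_on_subset)
    have "norm ((deriv ^^ n) bose_kernel (of_real x)) \<le> fact n * (B * (exp (1/2) * exp (- x / 2))) / 1 ^ n"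
    proof (rule Cauchy_inequality[OF hol cont])
      fix z assume z: "cmod (of_real x - z) = 1"
      have r: "\<bar>x - Re z\<bar> \<le> 1" using abs_Re_le_cmod[of "of_real x - z"] z by simp
      have i: "\<bar>Im z\<bar> \<le> 1" using abs_Im_le_cmod[of "of_real x - z"] z by simp
      have "norm (bose_kernel z) \<le> B * exp (- Re z / 2)" using r i that by (intro B) auto
      also have "\<dots> \<le> B * (exp (1/2) * exp (- x / 2))"
        using r B0 by (intro mult_left_mono) (auto simp flip: exp_add)
      finally show "norm (bose_kernel z) \<le> B * (exp (1/2) * exp (- x / 2))" .
    qed simp
    moreover have "\<bar>bose n x\<bar> \<le> norm ((deriv ^^ n) bose_kernel (of_real x))"
      unfolding bose_def by (rule abs_Re_le_cmod)
    ultimately show ?thesis by (simp add: mult_ac)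
  qed
  then show ?thesis by blast
qed

text \<open>The expansion of the double sum uses only these properties of psi: \<open>f n\<close> is
  the n-th derivative of \<open>f 0\<close>, the constant in the decay may depend on n, and
  nonnegativity permits rearranging the double series.\<close>

locale decaying =
  fixes f :: "nat \<Rightarrow> real \<Rightarrow> real"
  assumes f_deriv: "(f n has_real_derivative f (Suc n) x) (at x)"
    and f_decay: "\<exists>C. \<forall>x\<ge>0. \<bar>f n x\<bar> \<le> C * exp (- x / 2)"
    and f_nonneg: "f 0 x \<ge> 0"

interpretation bose: decaying bose
  by unfold_locales (rule bose_deriv bose_decay bose_nonneg)+

lemma exp_decay_powr_bound:
  fixes p c :: real
  assumes p: "p \<ge> 0" and c: "c > 0"
  obtains B where "B > 0" "\<And>x. x \<ge> 0 \<Longrightarrow> x powr p * exp (- (c * x)) \<le> B"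
proof -
  have "eventually (\<lambda>x::real. x powr p * exp (- (c * x)) \<le> 1) at_top" using c by real_asymp
  then obtain X where X: "\<And>x. x \<ge> X \<Longrightarrow> x powr p * exp (- (c * x)) \<le> 1"
    by (auto simp: eventually_at_top_linorder)
  have "x powr p * exp (- (c * x)) \<le> \<bar>X\<bar> powr p + 1" if "x \<ge> 0" for x
  proof (cases "x \<ge> X")
    case True
    then show ?thesis using X[OF True] by (simp add: add_increasing)
  next
    case False
    have "x powr p * exp (- (c * x)) \<le> \<bar>X\<bar> powr p * 1"
      using False that p c by (intro mult_mono powr_mono2) auto
    then show ?thesis by simp
  qed
  then show ?thesis by (intro that[of "\<bar>X\<bar> powr p + 1"]) (auto simp: add_nonneg_pos)
qed

context decaying begin

lemma f_powr_bound:
  assumes "p \<ge> 0"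
  obtains B where "B > 0" "\<And>x. x \<ge> 0 \<Longrightarrow> x powr p * \<bar>f n x\<bar> \<le> B"
proof -
  obtain C where C: "\<And>x. x \<ge> 0 \<Longrightarrow> \<bar>f n x\<bar> \<le> C * exp (- x / 2)" using f_decay by blast
  have C0: "C \<ge> 0" using C[of 0] by simp
  obtain B where B: "B > 0" "\<And>x. x \<ge> 0 \<Longrightarrow> x powr p * exp (- (1/2 * x)) \<le> B"
    using exp_decay_powr_bound[OF assms, of "1/2"] by auto
  have "x powr p * \<bar>f n x\<bar> \<le> B * C + 1" if "x \<ge> 0" for x
  proof -
    have "x powr p * \<bar>f n x\<bar> \<le> x powr p * (C * exp (- x / 2))"
      using C that by (intro mult_left_mono) auto
    also have "\<dots> = (x powr p * exp (- (1/2 * x))) * C" by simp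
    also have "\<dots> \<le> B * C" using B that C0 by (intro mult_right_mono) auto
    finally show ?thesis by simp
  qed
  moreover have "B * C + 1 > 0" using B C0 by (simp add: add_nonneg_pos)
  ultimately show ?thesis using that by blast
qed

lemma f_continuous: "continuous_on A (f n)"
  using f_deriv DERIV_continuous_on has_field_derivative_at_within by blast

lemma f_measurable [measurable]: "f n \<in> borel_measurable borel"
  using f_continuous by (rule borel_measurable_continuous_onI)

end

section \<open>Trapezoidal rules\<close>

text \<open>Euler-Maclaurin on one interval. With t = x - a the polynomial p is t^2 (1 - t)^2 / 24,
  that is (B_4(t) - B_4(0)) / 24 for the fourth Bernoulli polynomial. Four integrations by parts are
  packed into \<Phi>: p and p1 vanish at both ends, p2 is 1/12 at both ends, and p3 is -1/2 and
  1/2.\<close>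

lemma corrected_trapezoid:
  fixes g :: "nat \<Rightarrow> real \<Rightarrow> real"
  assumes D: "\<And>i x. i < 4 \<Longrightarrow> a \<le> x \<Longrightarrow> (g i has_real_derivative g (Suc i) x) (at x)"
    and B: "\<And>x. a \<le> x \<Longrightarrow> x \<le> a + 1 \<Longrightarrow> \<bar>g 4 x\<bar> \<le> B"
  shows "\<bar>integral {a..a+1} (g 0) - (g 0 a + g 0 (a + 1)) / 2 + (g 1 (a + 1) - g 1 a) / 12\<bar> \<le> B"
proof -
  define p where "p = (\<lambda>x::real. ((x-a)^2 - 2*(x-a)^3 + (x-a)^4) / 24)"
  define p1 where "p1 = (\<lambda>x::real. (2*(x-a) - 6*(x-a)^2 + 4*(x-a)^3) / 24)"
  define p2 where "p2 = (\<lambda>x::real. (2 - 12*(x-a) + 12*(x-a)^2) / 24)"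
  define p3 where "p3 = (\<lambda>x::real. (-12 + 24*(x-a)) / 24)"
  define \<Phi> where "\<Phi> = (\<lambda>x. p x * g 3 x - p1 x * g 2 x + p2 x * g 1 x - p3 x * g 0 x)"
  have d: "(g 0 has_real_derivative g 1 x) (at x)" "(g 1 has_real_derivative g 2 x) (at x)"
       "(g 2 has_real_derivative g 3 x) (at x)" "(g 3 has_real_derivative g 4 x) (at x)" if "a \<le> x" for x
    using D[of 0 x] D[of 1 x] D[of 2 x] D[of 3 x] that by (simp_all add: eval_nat_numeral)
  have "(\<Phi> has_real_derivative p x * g 4 x - g 0 x) (at x)" if "a \<le> x" for x
    unfolding \<Phi>_def p_def p1_def p2_def p3_def
    by (rule derivative_eq_intros d that refl | simp)+ (simp add: field_simps power2_eq_square power3_eq_cube)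
  then have I1: "((\<lambda>x. p x * g 4 x - g 0 x) has_integral \<Phi> (a+1) - \<Phi> a) {a..a+1}"
    by (intro fundamental_theorem_of_calculus)
       (auto simp flip: has_real_derivative_iff_has_vector_derivative intro: has_field_derivative_at_within)
  have "continuous_on {a..a+1} (g 0)"
    using d(1) by (intro DERIV_continuous_on[of _ _ "g 1"]) (auto intro: has_field_derivative_at_within)
  then have I2: "(g 0 has_integral integral {a..a+1} (g 0)) {a..a+1}"
    by (intro integrable_integral integrable_continuous_real)
  have I3: "((\<lambda>x. p x * g 4 x) has_integral (\<Phi> (a+1) - \<Phi> a + integral {a..a+1} (g 0))) {a..a+1}"
    using has_integral_add[OF I1 I2] by simp
  have pb: "\<bar>p x\<bar> \<le> 1" if "x \<in> {a..a+1}" for x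
  proof -
    have "p x = ((x-a) * (1-(x-a)))^2 / 24"
      by (simp add: p_def power2_eq_square power3_eq_cube power4_eq_xxxx algebra_simps)
    moreover have "((x-a) * (1-(x-a)))^2 \<le> 1"
      using that by (intro power_le_one mult_nonneg_nonneg mult_le_one) auto
    ultimately show ?thesis using zero_le_power2[of "(x-a) * (1-(x-a))"] by linarith
  qed
  have B0: "B \<ge> 0" using B[of a] by simp
  have "norm (\<Phi> (a+1) - \<Phi> a + integral {a..a+1} (g 0)) \<le> B * measure lborel {a..a+1}"
  proof (rule has_integral_bound_real[OF B0 finite.emptyI I3])
    fix x assume x: "x \<in> {a..a+1} - {}"
    then have "norm (p x * g 4 x) \<le> 1 * B"
      unfolding real_norm_def abs_mult using pb B by (intro mult_mono) auto
    then show "norm (p x * g 4 x) \<le> B" by simp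
  qed
  moreover have "\<Phi> (a+1) - \<Phi> a = (g 1 (a+1) - g 1 a) / 12 - (g 0 a + g 0 (a+1)) / 2"
    by (simp add: \<Phi>_def p_def p1_def p2_def p3_def field_simps)
  moreover have "B * measure lborel {a..a+1} = B" by simp
  ultimately show ?thesis unfolding real_norm_def by linarith
qed

text \<open>The same argument with two integrations by parts and the kernel t (1 - t) / 2, which
  vanishes at both ends.\<close>

lemma trapezoid:
  fixes g :: "nat \<Rightarrow> real \<Rightarrow> real"
  assumes D: "\<And>i x. i < 2 \<Longrightarrow> a \<le> x \<Longrightarrow> (g i has_real_derivative g (Suc i) x) (at x)"
    and B: "\<And>x. a \<le> x \<Longrightarrow> x \<le> a + 1 \<Longrightarrow> \<bar>g 2 x\<bar> \<le> B"
  shows "\<bar>integral {a..a+1} (g 0) - (g 0 a + g 0 (a + 1)) / 2\<bar> \<le> B"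
proof -
  define p where "p = (\<lambda>x::real. (x-a) * (1-(x-a)) / 2)"
  define p1 where "p1 = (\<lambda>x::real. (1 - 2*(x-a)) / 2)"
  define \<Phi> where "\<Phi> = (\<lambda>x. p x * g 1 x - p1 x * g 0 x)"
  have d: "(g 0 has_real_derivative g 1 x) (at x)" "(g 1 has_real_derivative g 2 x) (at x)" if "a \<le> x" for x
    using D[of 0 x] D[of 1 x] that by (simp_all add: eval_nat_numeral)
  have "(\<Phi> has_real_derivative p x * g 2 x + g 0 x) (at x)" if "a \<le> x" for x
    unfolding \<Phi>_def p_def p1_def
    by (rule derivative_eq_intros d that refl | simp)+
  then have I1: "((\<lambda>x. p x * g 2 x + g 0 x) has_integral \<Phi> (a+1) - \<Phi> a) {a..a+1}"
    by (intro fundamental_theorem_of_calculus)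
       (auto simp flip: has_real_derivative_iff_has_vector_derivative intro: has_field_derivative_at_within)
  have "continuous_on {a..a+1} (g 0)"
    using d(1) by (intro DERIV_continuous_on[of _ _ "g 1"]) (auto intro: has_field_derivative_at_within)
  then have I2: "(g 0 has_integral integral {a..a+1} (g 0)) {a..a+1}"
    by (intro integrable_integral integrable_continuous_real)
  have I3: "((\<lambda>x. p x * g 2 x) has_integral (\<Phi> (a+1) - \<Phi> a - integral {a..a+1} (g 0))) {a..a+1}"
    using has_integral_diff[OF I1 I2] by simp
  have pb: "\<bar>p x\<bar> \<le> 1" if "x \<in> {a..a+1}" for x
  proof -
    have "(x-a) * (1-(x-a)) \<le> 1" "0 \<le> (x-a) * (1-(x-a))"
      using that by (intro mult_le_one mult_nonneg_nonneg; auto)+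
    then show ?thesis by (simp add: p_def)
  qed
  have B0: "B \<ge> 0" using B[of a] by simp
  have "norm (\<Phi> (a+1) - \<Phi> a - integral {a..a+1} (g 0)) \<le> B * measure lborel {a..a+1}"
  proof (rule has_integral_bound_real[OF B0 finite.emptyI I3])
    fix x assume x: "x \<in> {a..a+1} - {}"
    then have "norm (p x * g 2 x) \<le> 1 * B"
      unfolding real_norm_def abs_mult using pb B by (intro mult_mono) auto
    then show "norm (p x * g 2 x) \<le> B" by simp
  qed
  moreover have "\<Phi> (a+1) - \<Phi> a = (g 0 a + g 0 (a+1)) / 2"
    by (simp add: \<Phi>_def p_def p1_def field_simps)
  moreover have "B * measure lborel {a..a+1} = B" by simp
  ultimately show ?thesis unfolding real_norm_def by linarith
qed

text \<open>The choices \<open>g' = deriv g\<close> and \<open>g' = 0\<close> give the corrected and the plain trapezoidal rule.\<close>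

lemma sums_from_unit_intervals:
  fixes g g' :: "real \<Rightarrow> real"
  assumes cont: "continuous_on {a..} g"
    and E: "\<And>k. \<bar>integral {a + real k..a + real k + 1} g - (g (a + real k) + g (a + real k + 1)) / 2
                 + (g' (a + real k + 1) - g' (a + real k)) / 12\<bar> \<le> B k"
    and B: "summable B"
    and I: "(\<lambda>N. integral {a..a + real N} g) \<longlonglongrightarrow> I"
    and g: "(\<lambda>N. g (a + real N)) \<longlonglongrightarrow> 0" and g': "(\<lambda>N. g' (a + real N)) \<longlonglongrightarrow> 0"
  shows "\<exists>S. (\<lambda>k. g (a + real (Suc k))) sums S \<and> \<bar>S - (I - g a / 2 - g' a / 12)\<bar> \<le> suminf B"
proof -
  define \<delta> where "\<delta> = (\<lambda>k. integral {a + real k..a + real k + 1} g - (g (a + real k) + g (a + real k + 1)) / 2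
                 + (g' (a + real k + 1) - g' (a + real k)) / 12)"
  have sd: "summable \<delta>" "\<bar>suminf \<delta>\<bar> \<le> suminf B"
    using E B by (auto simp: \<delta>_def intro!: summable_comparison_test'[OF B] suminf_le order_trans[OF summable_rabs]
        summable_rabs_comparison_test)
  \<comment> \<open>Interior points receive the weight 1/2 twice, and the differences of g'
    telescope. The sum begins at a + 1, so the boundary value g a enters with coefficient
    -1/2.\<close>
  have partial: "(\<Sum>k<N. g (a + real (Suc k))) = integral {a..a + real N} g - g a / 2 + g (a + real N) / 2
      + (g' (a + real N) - g' a) / 12 - (\<Sum>k<N. \<delta> k)" for N
  proof (induction N)
    case (Suc N)
    have "g integrable_on {a..a + real (Suc N)}"
      using cont by (intro integrable_continuous_real continuous_on_subset[OF cont]) auto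
    then have "integral {a..a + real N} g + integral {a + real N..a + real (Suc N)} g = integral {a..a + real (Suc N)} g"
      by (intro Henstock_Kurzweil_Integration.integral_combine) auto
    then show ?case using Suc by (simp add: \<delta>_def field_simps)
  qed simp
  have "(\<lambda>N. integral {a..a + real N} g - g a / 2 + g (a + real N) / 2
      + (g' (a + real N) - g' a) / 12 - (\<Sum>k<N. \<delta> k)) \<longlonglongrightarrow> I - g a / 2 + 0 / 2 + (0 - g' a) / 12 - suminf \<delta>"
    by (intro tendsto_intros I g g' summable_LIMSEQ sd) auto
  then have "(\<lambda>k. g (a + real (Suc k))) sums (I - g a / 2 + 0 / 2 + (0 - g' a) / 12 - suminf \<delta>)"
    unfolding sums_def partial[symmetric] .
  then show ?thesis using sd(2) by (intro exI conjI) (assumption, simp)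
qed

lemma corrected_trapezoid_sums:
  fixes g :: "nat \<Rightarrow> real \<Rightarrow> real"
  assumes D: "\<And>i x. i < 4 \<Longrightarrow> a \<le> x \<Longrightarrow> (g i has_real_derivative g (Suc i) x) (at x)"
    and E: "\<And>k x. a + real k \<le> x \<Longrightarrow> x \<le> a + real k + 1 \<Longrightarrow> \<bar>g 4 x\<bar> \<le> B k"
    and B: "summable B"
    and I: "(\<lambda>N. integral {a..a + real N} (g 0)) \<longlonglongrightarrow> I"
    and g: "(\<lambda>N. g 0 (a + real N)) \<longlonglongrightarrow> 0" "(\<lambda>N. g 1 (a + real N)) \<longlonglongrightarrow> 0"
  shows "\<exists>S. (\<lambda>k. g 0 (a + real (Suc k))) sums S \<and> \<bar>S - (I - g 0 a / 2 - g 1 a / 12)\<bar> \<le> suminf B"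
proof (rule sums_from_unit_intervals[OF _ _ B I g])
  show "continuous_on {a..} (g 0)"
    using D[of 0] by (intro DERIV_continuous_on[of _ _ "g 1"]) (auto intro: has_field_derivative_at_within)
qed (intro corrected_trapezoid D E; auto)

lemma trapezoid_sums:
  fixes g :: "nat \<Rightarrow> real \<Rightarrow> real"
  assumes D: "\<And>i x. i < 2 \<Longrightarrow> a \<le> x \<Longrightarrow> (g i has_real_derivative g (Suc i) x) (at x)"
    and E: "\<And>k x. a + real k \<le> x \<Longrightarrow> x \<le> a + real k + 1 \<Longrightarrow> \<bar>g 2 x\<bar> \<le> B k"
    and B: "summable B"
    and I: "(\<lambda>N. integral {a..a + real N} (g 0)) \<longlonglongrightarrow> I"
    and g: "(\<lambda>N. g 0 (a + real N)) \<longlonglongrightarrow> 0"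
  shows "\<exists>S. (\<lambda>k. g 0 (a + real (Suc k))) sums S \<and> \<bar>S - (I - g 0 a / 2)\<bar> \<le> suminf B"
proof -
  have "\<exists>S. (\<lambda>k. g 0 (a + real (Suc k))) sums S \<and> \<bar>S - (I - g 0 a / 2 - (\<lambda>_. 0) a / 12)\<bar> \<le> suminf B"
  proof (rule sums_from_unit_intervals[OF _ _ B I g])
    show "continuous_on {a..} (g 0)"
      using D[of 0] by (intro DERIV_continuous_on[of _ _ "g 1"]) (auto intro: has_field_derivative_at_within)
    show "\<bar>integral {a + real k..a + real k + 1} (g 0) - (g 0 (a + real k) + g 0 (a + real k + 1)) / 2 +
          (0 - 0) / 12\<bar> \<le> B k" for k
      using trapezoid[of "a + real k" g "B k"] D E by simp
  qed simp
  then show ?thesis by simp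
qed

section \<open>Convergence and substitution for integrals over half-lines\<close>

lemma summable_Suc_powr: "p > 1 \<Longrightarrow> summable (\<lambda>k. real (Suc k) powr - p)"
  using summable_Suc_iff[of "\<lambda>k. real k powr - p"] summable_real_powr_iff[of "-p"] by simp

lemma tendsto_integral_at_top:
  fixes f :: "real \<Rightarrow> real"
  assumes "set_integrable lborel {a..} f"
  shows "(\<lambda>N. integral {a..a + real N} f) \<longlonglongrightarrow> integral {a..} f"
proof -
  have 1: "set_integrable lborel {a..b} f" for b
    using assms by (rule set_integrable_subset) auto
  have "((\<lambda>b. LINT x:{a..b}|lborel. f x) \<longlongrightarrow> (LINT x:{a..}|lborel. f x)) at_top"
    by (rule tendsto_set_lebesgue_integral_at_top) (use 1 assms in auto)
  moreover have "filterlim (\<lambda>N. a + real N) at_top sequentially" by real_asymp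
  ultimately have "(\<lambda>N. LINT x:{a..a + real N}|lborel. f x) \<longlonglongrightarrow> (LINT x:{a..}|lborel. f x)"
    by (rule filterlim_compose)
  then show ?thesis
    by (simp add: set_borel_integral_eq_integral(2)[OF 1] set_borel_integral_eq_integral(2)[OF assms])
qed

lemma set_integrable_lborel_powr_at_top:
  assumes "p > 1" "a > 0"
  shows "set_integrable lborel {a..} (\<lambda>x::real. x powr - p)"
proof -
  have "((\<lambda>y. y powr -p) has_integral -(a powr (-p+1)) / (-p+1)) {a..}"
    using assms by (intro has_integral_powr_to_inf) auto
  then have "(\<lambda>y. y powr -p) absolutely_integrable_on {a..}"
    by (intro nonnegative_absolutely_integrable_1) (auto simp: has_integral_integrable)
  then show ?thesis
    by (simp add: set_integrable_def integrable_completion)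
qed

lemma set_integrable_decay:
  fixes g :: "real \<Rightarrow> real"
  assumes [measurable]: "g \<in> borel_measurable borel"
    and "a > 0" "p > 1" and B: "\<And>x. x \<ge> a \<Longrightarrow> \<bar>g x\<bar> \<le> B * x powr - p"
  shows "set_integrable lborel {a..} g"
proof (rule set_integrable_bound)
  show "set_integrable lborel {a..} (\<lambda>x. B * x powr - p)"
    using set_integrable_lborel_powr_at_top[OF assms(3,2)] by simp
  show "set_borel_measurable lborel {a..} g"
    unfolding set_borel_measurable_def by measurable
  show "AE x in lborel. x \<in> {a..} \<longrightarrow> norm (g x) \<le> norm (B * x powr - p)"
    using B by (intro AE_I2 impI) (auto intro!: order_trans[OF _ abs_ge_self] simp: order_trans[OF _ abs_ge_self])
qed

lemma set_integrable_bounded_decay: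
  fixes g :: "real \<Rightarrow> real"
  assumes g [measurable]: "g \<in> borel_measurable borel"
    and A: "\<And>x. 0 \<le> x \<Longrightarrow> x \<le> 1 \<Longrightarrow> \<bar>g x\<bar> \<le> A"
    and B: "p > 1" "\<And>x. x \<ge> 1 \<Longrightarrow> \<bar>g x\<bar> \<le> B * x powr - p"
  shows "set_integrable lborel {0..} g"
proof -
  have "set_integrable lborel {0..1} (\<lambda>x::real. A)"
    unfolding set_integrable_def by (intro integrable_scaleR_left) auto
  then have "set_integrable lborel {0..1} g"
    by (rule set_integrable_bound) (use A in \<open>auto simp: set_borel_measurable_def intro!: order_trans[OF _ abs_ge_self]\<close>)
  moreover have "set_integrable lborel {1..} g"
    by (rule set_integrable_decay[OF g _ B]) auto
  ultimately have "set_integrable lborel ({0..1} \<union> {1..}) g"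
    by (rule set_integrable_Un) auto
  moreover have "{0..1} \<union> {1..} = {0::real..}" by auto
  ultimately show ?thesis by simp
qed

text \<open>The invariance hypothesis on S covers the open and the closed half-line at once.\<close>

lemma lborel_scale:
  fixes g :: "real \<Rightarrow> 'a :: {banach, second_countable_topology}"
  assumes c: "c > 0" and S: "\<And>x. c * x \<in> S \<longleftrightarrow> x \<in> S"
  shows set_integrable_lborel_scale: "set_integrable lborel S (\<lambda>x. g (c * x)) \<longleftrightarrow> set_integrable lborel S g"
    and set_integral_lborel_scale: "(LINT x:S|lborel. g (c * x)) = (1 / c) *\<^sub>R (LINT x:S|lborel. g x)"
proof -
  have *: "indicator S (c * x) = (indicator S x :: real)" for x using S by (auto simp: indicator_def)
  show "set_integrable lborel S (\<lambda>x. g (c * x)) \<longleftrightarrow> set_integrable lborel S g"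
    using lborel_integrable_real_affine_iff[of c "\<lambda>x. indicator S x *\<^sub>R g x" 0] c
    by (simp add: set_integrable_def *)
  show "(LINT x:S|lborel. g (c * x)) = (1 / c) *\<^sub>R (LINT x:S|lborel. g x)"
    using lborel_integral_real_affine[of c "\<lambda>x. indicator S x *\<^sub>R g x" 0] c
    by (simp add: set_lebesgue_integral_def *)
qed

lemma set_integrable_lborel_powr_at_0:
  assumes "q < 1"
  shows "set_integrable lborel {0<..1} (\<lambda>x::real. x powr - q)"
proof -
  have "((\<lambda>y. y powr -q) has_integral (1 powr (-q+1)) / (-q+1)) {0..1}"
    using assms by (intro has_integral_powr_from_0) auto
  then have "(\<lambda>y. y powr -q) absolutely_integrable_on {0..1}"
    by (intro nonnegative_absolutely_integrable_1) (auto simp: has_integral_integrable)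
  then have "set_integrable lborel {0..1} (\<lambda>x::real. x powr - q)"
    by (simp add: set_integrable_def integrable_completion)
  then show ?thesis by (rule set_integrable_subset) auto
qed

lemma set_integrable_powr_bounds:
  fixes g :: "real \<Rightarrow> 'a :: {banach, second_countable_topology}"
  assumes g [measurable]: "g \<in> borel_measurable borel"
    and A: "q < 1" "\<And>x. 0 < x \<Longrightarrow> x \<le> 1 \<Longrightarrow> norm (g x) \<le> A * x powr - q"
    and B: "p > 1" "\<And>x. x \<ge> 1 \<Longrightarrow> norm (g x) \<le> B * x powr - p"
  shows "set_integrable lborel {0<..} g"
proof -
  have "set_integrable lborel {0<..1} (\<lambda>x. A * x powr - q)"
    using set_integrable_lborel_powr_at_0[OF A(1)] by simp
  then have "set_integrable lborel {0<..1} g"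
    by (rule set_integrable_bound)
      (use A in \<open>auto simp: set_borel_measurable_def intro!: order_trans[OF A(2) abs_ge_self]\<close>)
  moreover have "set_integrable lborel {1..} (\<lambda>x. B * x powr - p)"
    using set_integrable_lborel_powr_at_top[OF B(1), of 1] by simp
  then have "set_integrable lborel {1..} g"
    by (rule set_integrable_bound)
      (use B in \<open>auto simp: set_borel_measurable_def intro!: order_trans[OF B(2) abs_ge_self]\<close>)
  ultimately have "set_integrable lborel ({0<..1} \<union> {1..}) g"
    by (rule set_integrable_Un) auto
  moreover have "{0<..1} \<union> {1..} = {0::real<..}" by auto
  ultimately show ?thesis by simp
qed

lemma set_lborel_to_absolutely_integrable:
  fixes g :: "real \<Rightarrow> 'a :: euclidean_space"
  assumes "set_integrable lborel S g"
  shows "g absolutely_integrable_on S" "(LINT x:S|lborel. g x) = integral S g"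
proof -
  have "(\<lambda>x. indicator S x *\<^sub>R g x) \<in> borel_measurable lborel"
    using assms by (auto simp: set_integrable_def)
  then show "g absolutely_integrable_on S"
    using assms by (simp add: set_integrable_def integrable_completion)
  show "(LINT x:S|lborel. g x) = integral S g"
    by (rule set_borel_integral_eq_integral(2)[OF assms])
qed

text \<open>The underlying theorem concerns Lebesgue measurable functions and the absolute value of
  the derivative. Borel measurability of the pieces brings the result back to \<open>lborel\<close>,
  and g' \<ge> 0 removes the absolute value.\<close>

lemma set_lborel_change_of_variables:
  fixes X g g' :: "real \<Rightarrow> real"
  assumes X: "set_integrable lborel (g ` S) X"
    and [measurable]: "X \<in> borel_measurable borel" "g \<in> borel_measurable borel" "g' \<in> borel_measurable borel" "S \<in> sets borel"
    and D: "\<And>x. x \<in> S \<Longrightarrow> (g has_real_derivative g' x) (at x within S)" "\<And>x. x \<in> S \<Longrightarrow> g' x \<ge> 0"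
    and inj: "inj_on g S"
  shows "set_integrable lborel S (\<lambda>x. g' x * X (g x))"
    "(LINT x:S|lborel. g' x * X (g x)) = (LINT y:g ` S|lborel. X y)"
proof -
  have S: "S \<in> sets lebesgue" by simp
  have a: "(\<lambda>x. \<bar>g' x\<bar> * X (g x)) absolutely_integrable_on S"
    and b: "integral S (\<lambda>x. \<bar>g' x\<bar> * X (g x)) = integral (g ` S) X"
    using has_absolute_integral_change_of_variables_1'[OF S D(1) inj, of X "integral (g ` S) X"]
      set_lborel_to_absolutely_integrable[OF X] by auto
  have eq: "\<bar>g' x\<bar> * X (g x) = g' x * X (g x)" if "x \<in> S" for x using D(2)[OF that] by simp
  have "(\<lambda>x. g' x * X (g x)) absolutely_integrable_on S"
    using a eq by (subst set_integrable_cong[OF refl refl eq[symmetric]]) auto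
  then show c: "set_integrable lborel S (\<lambda>x. g' x * X (g x))"
    by (simp add: set_integrable_def integrable_completion)
  have "integral S (\<lambda>x. g' x * X (g x)) = integral (g ` S) X"
    using b by (subst Henstock_Kurzweil_Integration.integral_cong[OF eq[symmetric]])
  then show "(LINT x:S|lborel. g' x * X (g x)) = (LINT y:g ` S|lborel. X y)"
    by (simp only: set_lborel_to_absolutely_integrable(2)[OF c] set_lborel_to_absolutely_integrable(2)[OF X])
qed

section \<open>Sums over rows and over cubes\<close>

context decaying begin

text \<open>Two points occur because arguments such as u x y (y + x) are estimated from below by a
  monomial such as u x y^2, and the bound is wanted in terms of that monomial.\<close>

lemma f_inverse_powr_bound:
  assumes "p \<ge> 0"
  obtains B where "B > 0" "\<And>x y. 0 < y \<Longrightarrow> y \<le> x \<Longrightarrow> \<bar>f n x\<bar> \<le> B * y powr - p"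
proof -
  obtain B where B: "B > 0" "\<And>x. x \<ge> 0 \<Longrightarrow> x powr p * \<bar>f n x\<bar> \<le> B"
    using f_powr_bound[OF assms] by blast
  have "\<bar>f n x\<bar> \<le> B * y powr - p" if "0 < y" "y \<le> x" for x y
  proof -
    have "y powr p * \<bar>f n x\<bar> \<le> x powr p * \<bar>f n x\<bar>"
      using that assms by (intro mult_right_mono powr_mono2) auto
    also have "\<dots> \<le> B" using that by (intro B) auto
    finally show ?thesis using that by (simp add: powr_minus field_simps)
  qed
  then show ?thesis using that B(1) by blast
qed

lemma row_integrable:
  assumes "u > 0" "x > 0"
  shows "set_integrable lborel {x..} (\<lambda>y. f 0 (u * x * y * (y + x)))"
proof -
  obtain B where B: "B > 0" "\<And>X Y. 0 < Y \<Longrightarrow> Y \<le> X \<Longrightarrow> \<bar>f 0 X\<bar> \<le> B * Y powr - 1"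
    using f_inverse_powr_bound[of 1 0] by auto
  show ?thesis
  proof (rule set_integrable_decay[where p = 2 and B = "B * (u * x) powr -1"])
    fix y assume "y \<ge> x"
    then have y: "y \<ge> x" "y > 0" using assms by auto
    have "u * x * y * y \<le> u * x * y * (y + x)" "0 < u * x * y * y" using assms y by (auto intro!: mult_left_mono)
    then have "\<bar>f 0 (u * x * y * (y + x))\<bar> \<le> B * (u * x * y * y) powr - 1" by (intro B)
    also have "\<dots> = B * (u * x) powr -1 * y powr -2"
      using assms y by (simp add: powr_minus powr_mult powr_numeral power2_eq_square field_simps)
    finally show "\<bar>f 0 (u * x * y * (y + x))\<bar> \<le> B * (u * x) powr -1 * y powr -2" .
  qed (use assms in auto)
qed

text \<open>The fourth derivative of \<open>y \<mapsto> f 0 (u x y (y + x))\<close> is bounded by a multiple of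
  \<open>(u x)\<^sup>2 Y\<^bsup>-3/2\<^esup>\<close> with \<open>Y = u x y\<^sup>2\<close>; this exponent is what makes the errors summable over \<open>x\<close>
  with total \<open>O(u\<^bsup>1/2\<^esup>)\<close>.\<close>

lemma row_sum:
  obtains C where "C > 0" "\<And>u x. u > 0 \<Longrightarrow> x > 0 \<Longrightarrow> \<exists>S.
     (\<lambda>k. f 0 (u * x * (x + real (Suc k)) * ((x + real (Suc k)) + x))) sums S \<and>
     \<bar>S - (integral {x..} (\<lambda>y. f 0 (u * x * y * (y + x))) - f 0 (2 * u * x ^ 3) / 2
            - 3 * u * x\<^sup>2 * f 1 (2 * u * x ^ 3) / 12)\<bar> \<le> C * u powr (1/2) * x powr (1/2) * (\<Sum>k. (x + real k) powr -3)"
proof -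
  obtain B0 where B0: "B0 > 0" "\<And>X Y. 0 < Y \<Longrightarrow> Y \<le> X \<Longrightarrow> \<bar>f 0 X\<bar> \<le> B0 * Y powr - 1"
    using f_inverse_powr_bound[of 1 0] by auto
  obtain B1 where B1: "B1 > 0" "\<And>X Y. 0 < Y \<Longrightarrow> Y \<le> X \<Longrightarrow> \<bar>f 1 X\<bar> \<le> B1 * Y powr - 1"
    using f_inverse_powr_bound[of 1 1] by auto
  obtain B2 where B2: "B2 > 0" "\<And>X Y. 0 < Y \<Longrightarrow> Y \<le> X \<Longrightarrow> \<bar>f 2 X\<bar> \<le> B2 * Y powr - (3/2)"
    using f_inverse_powr_bound[of "3/2" 2] by auto
  obtain B3 where B3: "B3 > 0" "\<And>X Y. 0 < Y \<Longrightarrow> Y \<le> X \<Longrightarrow> \<bar>f 3 X\<bar> \<le> B3 * Y powr - (5/2)"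
    using f_inverse_powr_bound[of "5/2" 3] by auto
  obtain B4 where B4: "B4 > 0" "\<And>X Y. 0 < Y \<Longrightarrow> Y \<le> X \<Longrightarrow> \<bar>f 4 X\<bar> \<le> B4 * Y powr - (7/2)"
    using f_inverse_powr_bound[of "7/2" 4] by auto
  \<comment> \<open>The coefficients 81, 6 * 18 and 3 * 4 result from q1 \<le> 3 c y and q2 = 2 c,
    where c = u x.\<close>
  define C where "C = 81 * B4 + 108 * B3 + 12 * B2"
  have C: "C > 0" using B2(1) B3(1) B4(1) by (simp add: C_def)
  have "\<exists>S. (\<lambda>k. f 0 (u * x * (x + real (Suc k)) * ((x + real (Suc k)) + x))) sums S \<and>
     \<bar>S - (integral {x..} (\<lambda>y. f 0 (u * x * y * (y + x))) - f 0 (2 * u * x ^ 3) / 2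
            - 3 * u * x\<^sup>2 * f 1 (2 * u * x ^ 3) / 12)\<bar> \<le> C * u powr (1/2) * x powr (1/2) * (\<Sum>k. (x + real k) powr -3)"
    if u: "u > 0" and x: "x > 0" for u x :: real
  proof -
    \<comment> \<open>Derivatives of f composed with a quadratic, whose third derivative vanishes.
      \<open>g\<close> is a list lookup because the trapezoidal rules expect a family indexed by
      natural numbers.\<close>
    define q where "q = (\<lambda>y. u * x * y * (y + x))"
    define q1 where "q1 = (\<lambda>y. u * x * (2 * y + x))"
    define q2 where "q2 = 2 * u * x"
    define g where "g = (\<lambda>i. [\<lambda>y. f 0 (q y), \<lambda>y. f 1 (q y) * q1 y,
       \<lambda>y. f 2 (q y) * q1 y ^ 2 + f 1 (q y) * q2,
       \<lambda>y. f 3 (q y) * q1 y ^ 3 + 3 * f 2 (q y) * q1 y * q2,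
       \<lambda>y. f 4 (q y) * q1 y ^ 4 + 6 * f 3 (q y) * q1 y ^ 2 * q2 + 3 * f 2 (q y) * q2 ^ 2] ! i)"
    have g: "g 0 = (\<lambda>y. f 0 (q y))" "g 1 = (\<lambda>y. f 1 (q y) * q1 y)"
       "g 2 = (\<lambda>y. f 2 (q y) * q1 y ^ 2 + f 1 (q y) * q2)"
       "g 3 = (\<lambda>y. f 3 (q y) * q1 y ^ 3 + 3 * f 2 (q y) * q1 y * q2)"
       "g 4 = (\<lambda>y. f 4 (q y) * q1 y ^ 4 + 6 * f 3 (q y) * q1 y ^ 2 * q2 + 3 * f 2 (q y) * q2 ^ 2)"
      by (simp_all add: g_def)
    have dq: "(q has_real_derivative q1 y) (at y)" "(q1 has_real_derivative q2) (at y)" for y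
      unfolding q_def q1_def q2_def by (auto intro!: derivative_eq_intros simp: algebra_simps)
    have df: "((\<lambda>y. f n (q y)) has_real_derivative f (Suc n) (q y) * q1 y) (at y)" for n y
      using DERIV_chain2[OF f_deriv dq(1)] by simp
    have df': "((\<lambda>y. f 0 (q y)) has_real_derivative f 1 (q y) * q1 y) (at y)"
       "((\<lambda>y. f 1 (q y)) has_real_derivative f 2 (q y) * q1 y) (at y)"
       "((\<lambda>y. f 2 (q y)) has_real_derivative f 3 (q y) * q1 y) (at y)"
       "((\<lambda>y. f 3 (q y)) has_real_derivative f 4 (q y) * q1 y) (at y)" for y
      using df[of 0] df[of 1] df[of 2] df[of 3] by (simp_all add: eval_nat_numeral)
    have D: "(g i has_real_derivative g (Suc i) y) (at y)" if "i < 4" for i y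
    proof -
      have s: "Suc 0 = 1" "Suc 1 = 2" "Suc 2 = 3" "Suc 3 = 4" by simp_all
      have "(g 0 has_real_derivative g 1 y) (at y)" unfolding g by (rule df')
      moreover have "(g 1 has_real_derivative g 2 y) (at y)" unfolding g
        by (rule derivative_eq_intros df' dq refl)+ (simp add: power2_eq_square algebra_simps)
      moreover have "(g 2 has_real_derivative g 3 y) (at y)" unfolding g
        by (rule derivative_eq_intros df' dq refl | simp)+ (simp add: power2_eq_square power3_eq_cube algebra_simps)
      moreover have "(g 3 has_real_derivative g 4 y) (at y)" unfolding g
        by (rule derivative_eq_intros df' dq refl | simp)+ (simp add: power2_eq_square power3_eq_cube power4_eq_xxxx algebra_simps)
      moreover have "i = 0 \<or> i = 1 \<or> i = 2 \<or> i = 3" using that by auto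
      ultimately show ?thesis using s by metis
    qed
    define c where "c = u * x"
    have c: "c > 0" using u x by (simp add: c_def)
    have bnd: "0 < c * y\<^sup>2 \<and> c * y\<^sup>2 \<le> q y \<and> 0 \<le> q1 y \<and> q1 y \<le> 3 * c * y" if "y \<ge> x" for y
      using that u x by (auto simp: q_def q1_def c_def power2_eq_square algebra_simps intro!: mult_left_mono add_nonneg_nonneg)
    have Y: "(c * y\<^sup>2) powr p = c powr p * y powr (2*p)" if "y \<ge> x" for y p
      using that x c by (simp add: powr_mult powr_powr flip: powr_numeral)
    have E: "\<bar>g 4 y\<bar> \<le> C * u powr (1/2) * x powr (1/2) * (x + real k) powr -3"
      if k: "x + real k \<le> y" for k y
    proof -
      have y: "y \<ge> x" "y > 0" using k x by auto
      note b = bnd[OF y(1)]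
      have pw: "q1 y ^ 4 \<le> (3 * c * y) ^ 4" "q1 y ^ 2 \<le> (3 * c * y) ^ 2" using b by (auto intro!: power_mono)
      have "\<bar>g 4 y\<bar> \<le> \<bar>f 4 (q y)\<bar> * q1 y ^ 4 + 6 * \<bar>f 3 (q y)\<bar> * q1 y ^ 2 * q2 + 3 * \<bar>f 2 (q y)\<bar> * q2 ^ 2"
        unfolding g using c b by (intro order_trans[OF abs_triangle_ineq] add_mono)
          (auto simp: abs_mult q2_def c_def power_abs u x less_imp_le)
      also have "\<dots> \<le> (B4 * (c * y\<^sup>2) powr - (7/2)) * (3 * c * y) ^ 4
          + 6 * (B3 * (c * y\<^sup>2) powr - (5/2)) * (3 * c * y) ^ 2 * q2 + 3 * (B2 * (c * y\<^sup>2) powr - (3/2)) * q2 ^ 2"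
        using b pw B2 B3 B4 c x u by (intro add_mono mult_mono mult_nonneg_nonneg B2 B3 B4 order_refl) (auto simp: q2_def)
      \<comment> \<open>With Z = c y^2 every factor q1^2 is at most 9 c Z. The decay exponents 7/2,
        5/2 and 3/2 are chosen so that all three terms become multiples of c^2 Z^(-3/2) = c^(1/2)
        y^(-3).\<close>
      also have "\<dots> = C * c powr (1/2) * y powr -3"
      proof -
        define Z where "Z = c * y\<^sup>2"
        have Z: "Z > 0" using b by (simp add: Z_def)
        have "Z powr - (7/2) * Z ^ 2 = Z powr - (3/2)" "Z powr - (5/2) * Z = Z powr - (3/2)"
          using Z powr_add[of Z "-(7/2)" 2] powr_add[of Z "-(5/2)" 1] by (simp_all add: powr_numeral)
        then have e: "Z powr - (7/2) * (3 * c * y) ^ 4 = 81 * (c\<^sup>2 * Z powr - (3/2))"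
           "Z powr - (5/2) * (3 * c * y) ^ 2 * q2 = 18 * (c\<^sup>2 * Z powr - (3/2))"
           "Z powr - (3/2) * q2 ^ 2 = 4 * (c\<^sup>2 * Z powr - (3/2))"
          by (simp_all add: Z_def q2_def c_def power2_eq_square power4_eq_xxxx algebra_simps)
        have "c\<^sup>2 * Z powr - (3/2) = c powr (2 + - (3/2)) * y powr -3"
          using c y powr_add[of c 2 "-(3/2)"] by (simp add: Z_def Y)
        then have "c\<^sup>2 * Z powr - (3/2) = c powr (1/2) * y powr -3" by simp
        then have P: "C * (c\<^sup>2 * Z powr - (3/2)) = C * c powr (1/2) * y powr -3" by simp
        have "(B4 * Z powr - (7/2)) * (3 * c * y) ^ 4 + 6 * (B3 * Z powr - (5/2)) * (3 * c * y) ^ 2 * q2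
             + 3 * (B2 * Z powr - (3/2)) * q2 ^ 2
           = B4 * (Z powr - (7/2) * (3 * c * y) ^ 4) + 6 * (B3 * (Z powr - (5/2) * (3 * c * y) ^ 2 * q2))
             + 3 * (B2 * (Z powr - (3/2) * q2 ^ 2))" by (simp only: mult.assoc)
        also have "\<dots> = C * (c\<^sup>2 * Z powr - (3/2))" unfolding e C_def by algebra
        finally show ?thesis unfolding P unfolding Z_def .
      qed
      also have "\<dots> \<le> C * c powr (1/2) * (x + real k) powr -3"
        using k x C by (intro mult_left_mono powr_mono2') auto
      finally show ?thesis using u x by (simp add: c_def powr_mult mult_ac)
    qed
    have sm': "summable (\<lambda>k. (x + real k) powr -3)"
    proof -
      have "summable (\<lambda>k. (x + real (Suc k)) powr -3)"
        using x by (intro summable_comparison_test'[OF summable_Suc_powr[of 3]]) (auto intro!: powr_mono2')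
      then show ?thesis by (subst (asm) summable_Suc_iff)
    qed
    note sm = summable_mult[OF sm', of "C * u powr (1/2) * x powr (1/2)"]
    have I: "(\<lambda>N. integral {x..x + real N} (g 0)) \<longlonglongrightarrow> integral {x..} (g 0)"
      unfolding g q_def by (intro tendsto_integral_at_top row_integrable u x)
    have L0: "(\<lambda>N. g 0 (x + real N)) \<longlonglongrightarrow> 0"
    proof (rule Lim_null_comparison)
      show "(\<lambda>N. B0 * (c * (x + real N)\<^sup>2) powr - 1) \<longlonglongrightarrow> 0" using c x by real_asymp
      show "\<forall>\<^sub>F N in sequentially. norm (g 0 (x + real N)) \<le> B0 * (c * (x + real N)\<^sup>2) powr - 1"
        using bnd B0 unfolding g by (intro always_eventually allI) (simp add: order_less_imp_le)
    qed
    have L1: "(\<lambda>N. g 1 (x + real N)) \<longlonglongrightarrow> 0"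
    proof (rule Lim_null_comparison)
      show "(\<lambda>N. B1 * (c * (x + real N)\<^sup>2) powr - 1 * (3 * c * (x + real N))) \<longlonglongrightarrow> 0" using c x by real_asymp
      show "\<forall>\<^sub>F N in sequentially. norm (g 1 (x + real N)) \<le> B1 * (c * (x + real N)\<^sup>2) powr - 1 * (3 * c * (x + real N))"
      proof (intro always_eventually allI)
        fix N
        have "\<bar>f 1 (q (x + real N))\<bar> * q1 (x + real N) \<le> (B1 * (c * (x + real N)\<^sup>2) powr - 1) * (3 * c * (x + real N))"
          using bnd[of "x + real N"] B1 by (intro mult_mono) auto
        then show "norm (g 1 (x + real N)) \<le> B1 * (c * (x + real N)\<^sup>2) powr - 1 * (3 * c * (x + real N))"
          using bnd[of "x + real N"] unfolding g by (simp add: abs_mult)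
      qed
    qed
    obtain S where S: "(\<lambda>k. g 0 (x + real (Suc k))) sums S"
      "\<bar>S - (integral {x..} (g 0) - g 0 x / 2 - g 1 x / 12)\<bar> \<le> (\<Sum>k. C * u powr (1/2) * x powr (1/2) * (x + real k) powr -3)"
      using corrected_trapezoid_sums[OF D E sm I L0 L1] by auto
    have "q x = 2 * u * x ^ 3" "q1 x = 3 * u * x\<^sup>2"
      by (simp_all add: q_def q1_def power2_eq_square power3_eq_cube)
    then have e: "g 0 x = f 0 (2 * u * x ^ 3)" "g 1 x = 3 * u * x\<^sup>2 * f 1 (2 * u * x ^ 3)"
      unfolding g by (simp_all only: mult.commute)
    show ?thesis using S unfolding suminf_mult[OF sm'] e unfolding g q_def by blast
  qed
  then show ?thesis using that C by blast
qed

end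

section \<open>Sums of one variable at cubes: the end corrections and T\<close>

context decaying begin

text \<open>The constant K in the expansion of T. By \<open>cubic_mass_eq\<close> it is a third of a
  Mellin transform.\<close>

definition cubic_mass :: real where
  "cubic_mass = (LINT x:{0..}|lborel. x * f 0 (x ^ 3))"

text \<open>A bounded and a decaying estimate with one constant, so that
  \<open>interpolate_bound\<close> can turn them into any power x^(-p) with 0 \<le> p \<le> 1. The
  case m = n - 1 is the one that arises from differentiating f at a multiple of x^3.\<close>

lemma f_mono_powr_bound:
  obtains B where "B > 0" "\<And>x. x \<ge> 0 \<Longrightarrow> x ^ m * \<bar>f n x\<bar> \<le> B" "\<And>x. x > 0 \<Longrightarrow> x ^ m * \<bar>f n x\<bar> \<le> B * x powr - 1"
proof -
  obtain B where B: "B > 0" "\<And>x. x \<ge> 0 \<Longrightarrow> x powr m * \<bar>f n x\<bar> \<le> B"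
    using f_powr_bound[of "real m" n] by auto
  obtain B' where B': "B' > 0" "\<And>x. x \<ge> 0 \<Longrightarrow> x powr (real m + 1) * \<bar>f n x\<bar> \<le> B'"
    using f_powr_bound[of "real m + 1" n] by auto
  \<comment> \<open>Since \<open>0 powr 0\<close> is 0, the bound B says nothing about
    \<open>f n 0\<close>, which is therefore added.\<close>
  define D where "D = B + B' + \<bar>f n 0\<bar>"
  have "x ^ m * \<bar>f n x\<bar> \<le> D" if "x \<ge> 0" for x
  proof (cases "x = 0")
    case True
    then show ?thesis using B B' by (cases m) (auto simp: D_def)
  next
    case False
    then show ?thesis using that B(2)[of x] B'(1) by (simp add: D_def powr_realpow)
  qed
  moreover have "x ^ m * \<bar>f n x\<bar> \<le> D * x powr - 1" if "x > 0" for x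
  proof -
    have "x ^ m * x * \<bar>f n x\<bar> \<le> B'" using that B'(2)[of x] by (simp add: powr_add powr_realpow)
    also have "B' \<le> D" using B(1) by (simp add: D_def)
    finally show ?thesis using that by (simp add: powr_minus field_simps)
  qed
  moreover have "D > 0" using B B' by (simp add: D_def)
  ultimately show ?thesis using that by blast
qed

text \<open>The minimum of 1 and 1/x is at most x^(-p) for p between 0 and 1.\<close>

lemma interpolate_bound:
  fixes x y B :: real
  assumes "x > 0" "y \<le> B" "y \<le> B * x powr - 1" "B \<ge> 0" "0 \<le> p" "p \<le> 1"
  shows "y \<le> B * x powr - p"
proof (cases "x \<ge> 1")
  case True
  then have "x powr - 1 \<le> x powr - p" using assms by (intro powr_mono) auto
  then show ?thesis using assms mult_left_mono[of "x powr - 1" "x powr - p" B] by linarith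
next
  case False
  then have "x powr - p \<ge> x powr 0" using assms by (intro powr_mono') auto
  then show ?thesis using assms mult_left_mono[of 1 "x powr - p" B] by simp
qed

text \<open>The summand is the derivative of f 0 (2 u x^3) / 2, so its integral over the half-line
  is - f 0 0 / 2. It vanishes at x = 0, and the plain trapezoidal rule leaves no boundary term.
  These are the end corrections of the rows, before division by 12.\<close>

lemma diagonal_sum:
  obtains C where "C > 0" "\<And>u. u > 0 \<Longrightarrow> u \<le> 1 \<Longrightarrow> \<exists>S.
     (\<lambda>k. 3 * u * (real (Suc k))\<^sup>2 * f 1 (2 * u * real (Suc k) ^ 3)) sums S \<and> \<bar>S + f 0 0 / 2\<bar> \<le> C * u powr (1/2)"
proof -
  obtain B1 where B1: "B1 > 0" "\<And>x. x \<ge> 0 \<Longrightarrow> x ^ 0 * \<bar>f 1 x\<bar> \<le> B1" "\<And>x. x > 0 \<Longrightarrow> x ^ 0 * \<bar>f 1 x\<bar> \<le> B1 * x powr - 1"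
    using f_mono_powr_bound by blast
  obtain B2 where B2: "B2 > 0" "\<And>x. x \<ge> 0 \<Longrightarrow> x ^ 1 * \<bar>f 2 x\<bar> \<le> B2" "\<And>x. x > 0 \<Longrightarrow> x ^ 1 * \<bar>f 2 x\<bar> \<le> B2 * x powr - 1"
    using f_mono_powr_bound by blast
  obtain B3 where B3: "B3 > 0" "\<And>x. x \<ge> 0 \<Longrightarrow> x ^ 2 * \<bar>f 3 x\<bar> \<le> B3" "\<And>x. x > 0 \<Longrightarrow> x ^ 2 * \<bar>f 3 x\<bar> \<le> B3 * x powr - 1"
    using f_mono_powr_bound by blast
  \<comment> \<open>In terms of q = 2 u x^3 the second derivative of the summand is u times the sum
    of 6 f', 54 q f'' and 27 q^2 f'''.\<close>
  define D where "D = 6 * B1 + 54 * B2 + 27 * B3"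
  have D: "D > 0" using B1 B2 B3 by (simp add: D_def)
  define Z where "Z = (\<Sum>k. real (Suc k) powr - (3/2))"
  have sZ: "summable (\<lambda>k. real (Suc k) powr - (3/2))" by (rule summable_Suc_powr) simp
  have Z0: "Z \<ge> 0" unfolding Z_def by (intro suminf_nonneg sZ) auto
  have "\<exists>S. (\<lambda>k. 3 * u * (real (Suc k))\<^sup>2 * f 1 (2 * u * real (Suc k) ^ 3)) sums S
        \<and> \<bar>S + f 0 0 / 2\<bar> \<le> (D + D * Z) * u powr (1/2)" if u: "u > 0" "u \<le> 1" for u
  proof -
    define q where "q = (\<lambda>x::real. 2 * u * x ^ 3)"
    define g where "g = (\<lambda>i. [\<lambda>x. 3 * u * x\<^sup>2 * f 1 (q x), \<lambda>x. 6 * u * x * f 1 (q x) + 18 * u\<^sup>2 * x ^ 4 * f 2 (q x),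
        \<lambda>x. 6 * u * f 1 (q x) + 108 * u\<^sup>2 * x ^ 3 * f 2 (q x) + 108 * u ^ 3 * x ^ 6 * f 3 (q x)] ! i)"
    have g: "g 0 = (\<lambda>x. 3 * u * x\<^sup>2 * f 1 (q x))" "g 1 = (\<lambda>x. 6 * u * x * f 1 (q x) + 18 * u\<^sup>2 * x ^ 4 * f 2 (q x))"
       "g 2 = (\<lambda>x. 6 * u * f 1 (q x) + 108 * u\<^sup>2 * x ^ 3 * f 2 (q x) + 108 * u ^ 3 * x ^ 6 * f 3 (q x))"
      by (simp_all add: g_def)
    have dq: "(q has_real_derivative 6 * u * x\<^sup>2) (at x)" for x
      unfolding q_def by (auto intro!: derivative_eq_intros simp: power2_eq_square)
    have df: "((\<lambda>x. f n (q x)) has_real_derivative f (Suc n) (q x) * (6 * u * x\<^sup>2)) (at x)" for n x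
      using DERIV_chain2[OF f_deriv dq] by simp
    have df': "((\<lambda>x. f 0 (q x)) has_real_derivative f 1 (q x) * (6 * u * x\<^sup>2)) (at x)"
       "((\<lambda>x. f 1 (q x)) has_real_derivative f 2 (q x) * (6 * u * x\<^sup>2)) (at x)"
       "((\<lambda>x. f 2 (q x)) has_real_derivative f 3 (q x) * (6 * u * x\<^sup>2)) (at x)" for x
      using df[of 0] df[of 1] df[of 2] by (simp_all add: eval_nat_numeral)
    have Dg: "(g i has_real_derivative g (Suc i) x) (at x)" if "i < 2" for i x
    proof -
      have s: "Suc 0 = 1" "Suc 1 = 2" by simp_all
      have "(g 0 has_real_derivative g 1 x) (at x)" unfolding g
        by (rule derivative_eq_intros df' refl | simp)+ (simp add: eval_nat_numeral algebra_simps)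
      moreover have "(g 1 has_real_derivative g 2 x) (at x)" unfolding g
        by (rule derivative_eq_intros df' refl | simp)+ (simp add: eval_nat_numeral algebra_simps)
      moreover have "i = 0 \<or> i = 1" using that by auto
      ultimately show ?thesis using s by metis
    qed
    let ?M = "\<lambda>x. 6 * \<bar>f 1 (q x)\<bar> + 54 * (q x * \<bar>f 2 (q x)\<bar>) + 27 * (q x ^ 2 * \<bar>f 3 (q x)\<bar>)"
    have g2: "\<bar>g 2 x\<bar> \<le> u * ?M x" if "x \<ge> 0" for x
    proof -
      have "\<bar>g 2 x\<bar> \<le> \<bar>6 * u * f 1 (q x)\<bar> + \<bar>108 * u\<^sup>2 * x ^ 3 * f 2 (q x)\<bar> + \<bar>108 * u ^ 3 * x ^ 6 * f 3 (q x)\<bar>"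
        unfolding g by linarith
      also have "\<dots> = u * ?M x"
        using u that by (simp add: abs_mult power_abs q_def power_mult_distrib algebra_simps flip: power_mult)
          (simp add: eval_nat_numeral)
      finally show ?thesis .
    qed
    \<comment> \<open>On the first interval x may be 0 and only boundedness is available; there D u
      \<le> D u^(1/2) because u \<le> 1. Further out, u q^(-1/2) is at most u^(1/2)
      k^(-3/2).\<close>
    define B where "B = (\<lambda>k. case k of 0 \<Rightarrow> D * u | Suc k \<Rightarrow> D * u powr (1/2) * real (Suc k) powr - (3/2))"
    have q0: "q x \<ge> 0" if "x \<ge> 0" for x using that u by (simp add: q_def)
    have E: "\<bar>g 2 x\<bar> \<le> B k" if k: "0 + real k \<le> x" "x \<le> 0 + real k + 1" for k x
    proof -
      have x: "x \<ge> 0" using k by simp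
      note g2[OF x]
      also have "u * ?M x \<le> B k"
      proof (cases k)
        case 0
        have "?M x \<le> D"
          using B1(2) B2(2) B3(2) q0[OF x] unfolding D_def by (intro add_mono) auto
        then show ?thesis using 0 u mult_left_mono[of _ D u] by (simp add: B_def mult.commute)
      next
        case (Suc k')
        then have x1: "x > 0" "x \<ge> real (Suc k')" using k by auto
        then have qp: "q x > 0" using u by (simp add: q_def)
        have qf: "\<bar>f 1 (q x)\<bar> \<le> B1 * q x powr - (1/2)"
          using interpolate_bound[of "q x" "\<bar>f 1 (q x)\<bar>" B1 "1/2"] B1(1) B1(2,3)[of "q x"] qp by auto
        moreover have "q x * \<bar>f 2 (q x)\<bar> \<le> B2 * q x powr - (1/2)"
          using interpolate_bound[of "q x" "q x * \<bar>f 2 (q x)\<bar>" B2 "1/2"] B2(1) B2(2,3)[of "q x"] qp by auto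
        moreover have "q x ^ 2 * \<bar>f 3 (q x)\<bar> \<le> B3 * q x powr - (1/2)"
          using interpolate_bound[of "q x" "q x ^ 2 * \<bar>f 3 (q x)\<bar>" B3 "1/2"] B3(1) B3(2,3)[of "q x"] qp by auto
        ultimately have "?M x \<le> D * q x powr - (1/2)"
          unfolding D_def by (simp add: algebra_simps)
        also have "\<dots> \<le> D * (u * real (Suc k') ^ 3) powr - (1/2)"
        proof (intro mult_left_mono powr_mono2')
          have "u * real (Suc k') ^ 3 \<le> u * x ^ 3" using u x1 by (intro mult_left_mono power_mono) auto
          also have "u * x ^ 3 \<le> q x" using u x1 by (simp add: q_def)
          finally show "u * real (Suc k') ^ 3 \<le> q x" .
        qed (use D u in auto)
        finally have "u * ?M x \<le>
            u * (D * (u * real (Suc k') ^ 3) powr - (1/2))" using u by (intro mult_left_mono) auto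
        also have "(u * real (Suc k') ^ 3) powr - (1/2) = u powr - (1/2) * real (Suc k') powr - (3/2)"
          using u by (simp add: powr_mult powr_powr flip: powr_numeral del: of_nat_Suc)
        also have "u * (D * (u powr - (1/2) * real (Suc k') powr - (3/2))) = D * u powr (1/2) * real (Suc k') powr - (3/2)"
          using u powr_add[of u 1 "-(1/2)"] by simp
        finally show ?thesis by (simp add: B_def Suc)
      qed
      finally show ?thesis .
    qed
    have sB: "summable B"
      by (subst summable_Suc_iff[symmetric]) (simp only: B_def nat.case summable_mult sZ)
    have "suminf B = (\<Sum>k. B (Suc k)) + B 0" using suminf_split_head[OF sB] by simp
    also have "\<dots> = D * u powr (1/2) * Z + D * u"
      by (simp only: B_def nat.case suminf_mult[OF sZ] Z_def)
    also have "\<dots> \<le> D * u powr (1/2) * Z + D * u powr (1/2)"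
      using u powr_mono'[of "1/2" 1 u] D by simp
    finally have sumB: "suminf B \<le> (D + D * Z) * u powr (1/2)" using D by (simp add: algebra_simps)
    have ftc: "(g 0 has_integral f 0 (q (real N)) / 2 - f 0 (q 0) / 2) {0..real N}" for N
    proof (rule fundamental_theorem_of_calculus)
      fix x assume "x \<in> {0..real N}"
      have "((\<lambda>x. f 0 (q x) / 2) has_real_derivative g 0 x) (at x)"
        unfolding g by (rule derivative_eq_intros df' refl | simp)+
      then show "((\<lambda>x. f 0 (q x) / 2) has_vector_derivative g 0 x) (at x within {0..real N})"
        by (simp flip: has_real_derivative_iff_has_vector_derivative add: has_field_derivative_at_within)
    qed simp
    have lim: "(\<lambda>N. x N * f n (q (real N))) \<longlonglongrightarrow> 0" if "(\<lambda>N. B * x N * (q (real N)) powr - 1) \<longlonglongrightarrow> 0"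
       "\<And>y. y > 0 \<Longrightarrow> \<bar>f n y\<bar> \<le> B * y powr - 1" "\<And>N. x N \<ge> 0" for x n B
    proof (rule Lim_null_comparison[OF _ that(1)])
      show "\<forall>\<^sub>F N in sequentially. norm (x N * f n (q (real N))) \<le> B * x N * q (real N) powr - 1"
        using eventually_gt_at_top[of 0]
      proof eventually_elim
        case (elim N)
        then have "\<bar>f n (q (real N))\<bar> \<le> B * q (real N) powr - 1" using u by (intro that) (simp add: q_def)
        then have "x N * \<bar>f n (q (real N))\<bar> \<le> x N * (B * q (real N) powr - 1)" by (rule mult_left_mono[OF _ that(3)])
        then show ?case by (simp only: real_norm_def abs_mult abs_of_nonneg[OF that(3)] mult_ac)
      qed
    qed
    obtain B0 where B0: "\<And>x. x > 0 \<Longrightarrow> x ^ 0 * \<bar>f 0 x\<bar> \<le> B0 * x powr - 1"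
      using f_mono_powr_bound by blast
    have l0: "(\<lambda>N. 1 * f 0 (q (real N))) \<longlonglongrightarrow> 0"
      by (rule lim[where B = B0]) (use B0 u in \<open>simp_all add: q_def, real_asymp?\<close>)
    have l1: "(\<lambda>N. 3 * u * (real N)\<^sup>2 * f 1 (q (real N))) \<longlonglongrightarrow> 0"
    proof (rule lim[where B = B1])
      show "(\<lambda>N. B1 * (3 * u * (real N)\<^sup>2) * q (real N) powr - 1) \<longlonglongrightarrow> 0"
        unfolding q_def using u by real_asymp
    qed (use B1 u in auto)
    have "(\<lambda>N. f 0 (q (real N)) / 2 - f 0 (q 0) / 2) \<longlonglongrightarrow> 0 / 2 - f 0 (q 0) / 2"
      using l0 by (intro tendsto_intros) auto
    then have I: "(\<lambda>N. integral {0..0 + real N} (g 0)) \<longlonglongrightarrow> - f 0 0 / 2"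
      by (simp add: integral_unique[OF ftc] q_def)
    have L: "(\<lambda>N. g 0 (0 + real N)) \<longlonglongrightarrow> 0" using l1 by (simp add: g)
    obtain S where "(\<lambda>k. g 0 (0 + real (Suc k))) sums S" "\<bar>S - (- f 0 0 / 2 - g 0 0 / 2)\<bar> \<le> suminf B"
      using trapezoid_sums[OF Dg E sB I L] by blast
    then show ?thesis using sumB by (intro exI[of _ S]) (simp add: g q_def)
  qed
  moreover have "D + D * Z > 0" using D Z0 by (simp add: add_pos_nonneg)
  ultimately show ?thesis using that by blast
qed


lemma cubic_integrable: "a > 0 \<Longrightarrow> set_integrable lborel {0..} (\<lambda>x. x * f 0 (a * x ^ 3))"
proof -
  assume a: "a > 0"
  obtain B where B: "B > 0" "\<And>x. x \<ge> 0 \<Longrightarrow> x ^ 0 * \<bar>f 0 x\<bar> \<le> B" "\<And>x. x > 0 \<Longrightarrow> x ^ 0 * \<bar>f 0 x\<bar> \<le> B * x powr - 1"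
    using f_mono_powr_bound by blast
  show ?thesis
  proof (rule set_integrable_bounded_decay[where p = 2 and A = B and B = "B * a powr - 1"])
    fix x :: real assume x: "0 \<le> x" "x \<le> 1"
    then have "x * \<bar>f 0 (a * x ^ 3)\<bar> \<le> 1 * B" using B(2)[of "a * x ^ 3"] a by (intro mult_mono) auto
    then show "\<bar>x * f 0 (a * x ^ 3)\<bar> \<le> B" using x by (simp add: abs_mult)
  next
    fix x :: real assume x: "x \<ge> 1"
    then have "x * \<bar>f 0 (a * x ^ 3)\<bar> \<le> x * (B * (a * x ^ 3) powr - 1)"
      using B(3)[of "a * x ^ 3"] a by (intro mult_left_mono) auto
    also have "\<dots> = B * a powr - 1 * x powr -2"
      using x a by (simp add: powr_minus powr_numeral field_simps power2_eq_square power3_eq_cube)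
    finally show "\<bar>x * f 0 (a * x ^ 3)\<bar> \<le> B * a powr - 1 * x powr -2" using x by (simp add: abs_mult)
  qed auto
qed

lemma cubic_integral:
  assumes a: "a > 0"
  shows "integral {0..} (\<lambda>x. x * f 0 (a * x ^ 3)) = cubic_mass * a powr - (2/3)"
proof -
  define c where "c = a powr (1/3)"
  have c: "c > 0" "c ^ 3 = a" using a by (simp_all add: c_def powr_powr flip: powr_numeral)
  have "integral {0..} (\<lambda>x. x * f 0 (a * x ^ 3)) = (LINT x:{0..}|lborel. x * f 0 (a * x ^ 3))"
    using set_borel_integral_eq_integral(2)[OF cubic_integrable[OF a]] by simp
  also have "\<dots> = (LINT x:{0..}|lborel. (1/c) * ((c * x) * f 0 ((c * x) ^ 3)))"
    using c by (simp add: power_mult_distrib)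
  also have "\<dots> = (1/c) * (1/c) * cubic_mass"
  proof -
    have "(LINT x:{0..}|lborel. (c * x) * f 0 ((c * x) ^ 3)) = (1/c) * cubic_mass"
      unfolding cubic_mass_def
      using set_integral_lborel_scale[of c "{0..}" "\<lambda>x. x * f 0 (x ^ 3)"] c by (simp add: zero_le_mult_iff)
    then show ?thesis by (simp only: set_integral_mult_right mult.assoc)
  qed
  also have "(1/c) * (1/c) = a powr - (2/3)"
  proof -
    have "1/c = a powr - (1/3)" by (simp add: c_def powr_minus_divide)
    then show ?thesis using powr_add[of a "-(1/3)" "-(1/3)"] by simp
  qed
  finally show ?thesis by (simp only: mult.commute)
qed

definition cubic_sum :: "real \<Rightarrow> real" where
  "cubic_sum a = (\<Sum>k. real (Suc k) * f 0 (a * real (Suc k) ^ 3))"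

lemma cubic_sum_measurable [measurable]: "cubic_sum \<in> borel_measurable borel"
  unfolding cubic_sum_def by measurable

text \<open>From f(x) = O(1/x). The rate 1/a is faster than a^(-2/3), so for large a the subtracted
  main term, not T, determines the bound on \<open>cubic_error\<close>.\<close>

lemma cubic_sum_large:
  obtains C where "C > 0" "\<And>a. a > 0 \<Longrightarrow> summable (\<lambda>k. real (Suc k) * f 0 (a * real (Suc k) ^ 3))"
    "\<And>a. a > 0 \<Longrightarrow> cubic_sum a \<le> C * a powr - 1"
proof -
  obtain B where B: "B > 0" "\<And>x. x > 0 \<Longrightarrow> x ^ 0 * \<bar>f 0 x\<bar> \<le> B * x powr - 1"
    using f_mono_powr_bound by blast
  have sZ: "summable (\<lambda>k. real (Suc k) powr - 2)" by (rule summable_Suc_powr) simp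
  define Z where "Z = (\<Sum>k. real (Suc k) powr - 2)"
  have Z: "Z \<ge> 0" unfolding Z_def by (intro suminf_nonneg sZ) auto
  have bd: "real (Suc k) * f 0 (a * real (Suc k) ^ 3) \<le> B * a powr - 1 * real (Suc k) powr - 2" if "a > 0" for a k
  proof -
    have "real (Suc k) * f 0 (a * real (Suc k) ^ 3) \<le> real (Suc k) * (B * (a * real (Suc k) ^ 3) powr - 1)"
      using B(2)[of "a * real (Suc k) ^ 3"] that by (intro mult_left_mono) auto
    also have "\<dots> = B * a powr - 1 * real (Suc k) powr -2"
      using that by (simp add: powr_minus powr_numeral field_simps power2_eq_square power3_eq_cube del: of_nat_Suc)
    finally show ?thesis .
  qed
  have s: "summable (\<lambda>k. real (Suc k) * f 0 (a * real (Suc k) ^ 3))" if "a > 0" for a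
    using bd[OF that] by (intro summable_comparison_test'[OF summable_mult[OF sZ, of "B * a powr - 1"]])
      (auto simp: f_nonneg abs_mult)
  have "cubic_sum a \<le> B * a powr - 1 * Z" if "a > 0" for a
    unfolding cubic_sum_def Z_def suminf_mult[OF sZ, symmetric]
    by (intro suminf_le bd s summable_mult sZ that)
  moreover have "B * a powr - 1 * Z \<le> (B * Z + 1) * a powr - 1" for a by (simp add: algebra_simps)
  ultimately have "cubic_sum a \<le> (B * Z + 1) * a powr - 1" if "a > 0" for a
    using that order_trans by blast
  moreover have "B * Z + 1 > 0" using B Z by (simp add: add_nonneg_pos)
  ultimately show ?thesis using that s by blast
qed

lemma cubic_sum_nonneg: "a > 0 \<Longrightarrow> cubic_sum a \<ge> 0"
  unfolding cubic_sum_def using cubic_sum_large by (intro suminf_nonneg) (auto simp: f_nonneg)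

text \<open>The exponent \<open>3/5\<close> may be replaced by any number in \<open>(1/2, 2/3)\<close>: larger than \<open>1/2\<close>
  makes the integral in \<open>defect_remainder\<close> converge, smaller than \<open>2/3\<close> makes the error terms \<open>k\<^bsup>-3(1 - 3/5)\<^esup>\<close> summable.\<close>

lemma cubic_sum_small:
  obtains C where "C > 0" "\<And>a. a > 0 \<Longrightarrow> a \<le> 1 \<Longrightarrow>
     \<bar>cubic_sum a - cubic_mass * a powr - (2/3) + f 0 0 / 12\<bar> \<le> C * a powr (3/5)"
proof -
  obtain B1 where B1: "B1 > 0" "\<And>x. x \<ge> 0 \<Longrightarrow> x ^ 0 * \<bar>f 1 x\<bar> \<le> B1" "\<And>x. x > 0 \<Longrightarrow> x ^ 0 * \<bar>f 1 x\<bar> \<le> B1 * x powr - 1"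
    using f_mono_powr_bound by blast
  obtain B2 where B2: "B2 > 0" "\<And>x. x \<ge> 0 \<Longrightarrow> x ^ 1 * \<bar>f 2 x\<bar> \<le> B2" "\<And>x. x > 0 \<Longrightarrow> x ^ 1 * \<bar>f 2 x\<bar> \<le> B2 * x powr - 1"
    using f_mono_powr_bound by blast
  obtain B3 where B3: "B3 > 0" "\<And>x. x \<ge> 0 \<Longrightarrow> x ^ 2 * \<bar>f 3 x\<bar> \<le> B3" "\<And>x. x > 0 \<Longrightarrow> x ^ 2 * \<bar>f 3 x\<bar> \<le> B3 * x powr - 1"
    using f_mono_powr_bound by blast
  obtain B4 where B4: "B4 > 0" "\<And>x. x \<ge> 0 \<Longrightarrow> x ^ 3 * \<bar>f 4 x\<bar> \<le> B4" "\<And>x. x > 0 \<Longrightarrow> x ^ 3 * \<bar>f 4 x\<bar> \<le> B4 * x powr - 1"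
    using f_mono_powr_bound by blast
  obtain B0 where B0: "B0 > 0" "\<And>x. x > 0 \<Longrightarrow> x ^ 0 * \<bar>f 0 x\<bar> \<le> B0 * x powr - 1"
    using f_mono_powr_bound by blast
  \<comment> \<open>In terms of q = a x^3 the fourth derivative of x f(q) is a times the sum of 24
    f', 396 q f'', 432 q^2 f''' and 81 q^3 f''''.\<close>
  define D where "D = 24 * B1 + 396 * B2 + 432 * B3 + 81 * B4"
  have D: "D > 0" using B1 B2 B3 B4 by (simp add: D_def)
  define Z where "Z = (\<Sum>k. real (Suc k) powr - (6/5))"
  have sZ: "summable (\<lambda>k. real (Suc k) powr - (6/5))" by (rule summable_Suc_powr) simp
  have Z0: "Z \<ge> 0" unfolding Z_def by (intro suminf_nonneg sZ) auto
  have "\<bar>cubic_sum a - cubic_mass * a powr - (2/3) + f 0 0 / 12\<bar> \<le> (D + D * Z) * a powr (3/5)" if u: "a > 0" "a \<le> 1" for a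
  proof -
    define q where "q = (\<lambda>x::real. a * x ^ 3)"
    define g where "g = (\<lambda>i. [\<lambda>x. x * f 0 (q x), \<lambda>x. f 0 (q x) + 3 * a * x ^ 3 * f 1 (q x),
        \<lambda>x. 12 * a * x ^ 2 * f 1 (q x) + 9 * a ^ 2 * x ^ 5 * f 2 (q x),
        \<lambda>x. 24 * a * x * f 1 (q x) + 81 * a ^ 2 * x ^ 4 * f 2 (q x) + 27 * a ^ 3 * x ^ 7 * f 3 (q x),
        \<lambda>x. 24 * a * f 1 (q x) + 396 * a ^ 2 * x ^ 3 * f 2 (q x) + 432 * a ^ 3 * x ^ 6 * f 3 (q x) + 81 * a ^ 4 * x ^ 9 * f 4 (q x)] ! i)"
    have g: "g 0 = (\<lambda>x. x * f 0 (q x))" "g 1 = (\<lambda>x. f 0 (q x) + 3 * a * x ^ 3 * f 1 (q x))"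
       "g 2 = (\<lambda>x. 12 * a * x ^ 2 * f 1 (q x) + 9 * a ^ 2 * x ^ 5 * f 2 (q x))"
       "g 3 = (\<lambda>x. 24 * a * x * f 1 (q x) + 81 * a ^ 2 * x ^ 4 * f 2 (q x) + 27 * a ^ 3 * x ^ 7 * f 3 (q x))"
       "g 4 = (\<lambda>x. 24 * a * f 1 (q x) + 396 * a ^ 2 * x ^ 3 * f 2 (q x) + 432 * a ^ 3 * x ^ 6 * f 3 (q x) + 81 * a ^ 4 * x ^ 9 * f 4 (q x))"
      by (simp_all add: g_def)
    have dq: "(q has_real_derivative 3 * a * x\<^sup>2) (at x)" for x
      unfolding q_def by (auto intro!: derivative_eq_intros simp: power2_eq_square)
    have df: "((\<lambda>x. f n (q x)) has_real_derivative f (Suc n) (q x) * (3 * a * x\<^sup>2)) (at x)" for n x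
      using DERIV_chain2[OF f_deriv dq] by simp
    have df': "((\<lambda>x. f 0 (q x)) has_real_derivative f 1 (q x) * (3 * a * x\<^sup>2)) (at x)"
       "((\<lambda>x. f 1 (q x)) has_real_derivative f 2 (q x) * (3 * a * x\<^sup>2)) (at x)"
       "((\<lambda>x. f 2 (q x)) has_real_derivative f 3 (q x) * (3 * a * x\<^sup>2)) (at x)"
       "((\<lambda>x. f 3 (q x)) has_real_derivative f 4 (q x) * (3 * a * x\<^sup>2)) (at x)" for x
      using df[of 0] df[of 1] df[of 2] df[of 3] by (simp_all add: eval_nat_numeral)
    have Dg: "(g i has_real_derivative g (Suc i) x) (at x)" if "i < 4" for i x
    proof -
      have s: "Suc 0 = 1" "Suc 1 = 2" "Suc 2 = 3" "Suc 3 = 4" by simp_all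
      have "(g 0 has_real_derivative g 1 x) (at x)" unfolding g
        by (rule derivative_eq_intros df' refl | simp)+ algebra
      moreover have "(g 1 has_real_derivative g 2 x) (at x)" unfolding g
        by (rule derivative_eq_intros df' refl | simp)+ algebra
      moreover have "(g 2 has_real_derivative g 3 x) (at x)" unfolding g
        by (rule derivative_eq_intros df' refl | simp)+ algebra
      moreover have "(g 3 has_real_derivative g 4 x) (at x)" unfolding g
        by (rule derivative_eq_intros df' refl | simp)+ algebra
      moreover have "i = 0 \<or> i = 1 \<or> i = 2 \<or> i = 3" using that by auto
      ultimately show ?thesis using s by metis
    qed
    let ?M = "\<lambda>x. 24 * \<bar>f 1 (q x)\<bar> + 396 * (q x * \<bar>f 2 (q x)\<bar>)
        + 432 * (q x ^ 2 * \<bar>f 3 (q x)\<bar>) + 81 * (q x ^ 3 * \<bar>f 4 (q x)\<bar>)"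
    have g4: "\<bar>g 4 x\<bar> \<le> a * ?M x" if "x \<ge> 0" for x
    proof -
      have "\<bar>g 4 x\<bar> \<le> \<bar>24 * a * f 1 (q x)\<bar> + \<bar>396 * a ^ 2 * x ^ 3 * f 2 (q x)\<bar> + \<bar>432 * a ^ 3 * x ^ 6 * f 3 (q x)\<bar>
          + \<bar>81 * a ^ 4 * x ^ 9 * f 4 (q x)\<bar>"
        unfolding g by linarith
      also have "\<dots> = a * ?M x"
        using u that by (simp only: abs_mult power_abs abs_of_pos abs_of_nonneg abs_numeral q_def) algebra
      finally show ?thesis .
    qed
    \<comment> \<open>The exponent 2/5 gives a (a k^3)^(-2/5) = a^(3/5) k^(-6/5) for k \<ge> 1; the
      interval at 0 costs D a \<le> D a^(3/5).\<close>
    define B where "B = (\<lambda>k. case k of 0 \<Rightarrow> D * a | Suc k \<Rightarrow> D * a powr (3/5) * real (Suc k) powr - (6/5))"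
    have q0: "q x \<ge> 0" if "x \<ge> 0" for x using that u by (simp add: q_def)
    have E: "\<bar>g 4 x\<bar> \<le> B k" if k: "0 + real k \<le> x" "x \<le> 0 + real k + 1" for k x
    proof -
      have x: "x \<ge> 0" using k by simp
      note g4[OF x]
      also have "a * ?M x \<le> B k"
      proof (cases k)
        case 0
        have "?M x \<le> D"
          using B1(2) B2(2) B3(2) B4(2) q0[OF x] unfolding D_def by (intro add_mono) auto
        then show ?thesis using 0 u mult_left_mono[of _ D a] by (simp add: B_def mult.commute)
      next
        case (Suc k')
        then have x1: "x > 0" "x \<ge> real (Suc k')" using k by auto
        then have qp: "q x > 0" using u by (simp add: q_def)
        have qf: "\<bar>f 1 (q x)\<bar> \<le> B1 * q x powr - (2/5)"
          using interpolate_bound[of "q x" "\<bar>f 1 (q x)\<bar>" B1 "2/5"] B1(1) B1(2,3)[of "q x"] qp by auto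
        moreover have "q x * \<bar>f 2 (q x)\<bar> \<le> B2 * q x powr - (2/5)"
          using interpolate_bound[of "q x" "q x * \<bar>f 2 (q x)\<bar>" B2 "2/5"] B2(1) B2(2,3)[of "q x"] qp by auto
        moreover have "q x ^ 2 * \<bar>f 3 (q x)\<bar> \<le> B3 * q x powr - (2/5)"
          using interpolate_bound[of "q x" "q x ^ 2 * \<bar>f 3 (q x)\<bar>" B3 "2/5"] B3(1) B3(2,3)[of "q x"] qp by auto
        moreover have "q x ^ 3 * \<bar>f 4 (q x)\<bar> \<le> B4 * q x powr - (2/5)"
          using interpolate_bound[of "q x" "q x ^ 3 * \<bar>f 4 (q x)\<bar>" B4 "2/5"] B4(1) B4(2,3)[of "q x"] qp by auto
        ultimately have "?M x \<le> D * q x powr - (2/5)"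
          unfolding D_def by (simp add: algebra_simps)
        also have "\<dots> \<le> D * (a * real (Suc k') ^ 3) powr - (2/5)"
        proof (intro mult_left_mono powr_mono2')
          show "a * real (Suc k') ^ 3 \<le> q x" unfolding q_def using u x1 by (intro mult_left_mono power_mono) auto
        qed (use D u in auto)
        finally have "a * ?M x \<le>
            a * (D * (a * real (Suc k') ^ 3) powr - (2/5))" using u by (intro mult_left_mono) auto
        also have "(a * real (Suc k') ^ 3) powr - (2/5) = a powr - (2/5) * real (Suc k') powr - (6/5)"
          using u by (simp add: powr_mult powr_powr flip: powr_numeral del: of_nat_Suc)
        also have "a * (D * (a powr - (2/5) * real (Suc k') powr - (6/5))) = D * a powr (3/5) * real (Suc k') powr - (6/5)"
          using u powr_add[of a 1 "-(2/5)"] by simp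
        finally show ?thesis by (simp add: B_def Suc)
      qed
      finally show ?thesis .
    qed
    have sB: "summable B"
      by (subst summable_Suc_iff[symmetric]) (simp only: B_def nat.case summable_mult sZ)
    have "suminf B = (\<Sum>k. B (Suc k)) + B 0" using suminf_split_head[OF sB] by simp
    also have "\<dots> = D * a powr (3/5) * Z + D * a"
      by (simp only: B_def nat.case suminf_mult[OF sZ] Z_def)
    also have "\<dots> \<le> D * a powr (3/5) * Z + D * a powr (3/5)"
      using u powr_mono'[of "3/5" 1 a] D by simp
    finally have sumB: "suminf B \<le> (D + D * Z) * a powr (3/5)" using D by (simp add: algebra_simps)
    have lim: "(\<lambda>N. x N * f n (q (real N))) \<longlonglongrightarrow> 0" if "(\<lambda>N. B * x N * (q (real N)) powr - p) \<longlonglongrightarrow> 0"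
       "\<And>y. y > 0 \<Longrightarrow> \<bar>f n y\<bar> \<le> B * y powr - p" "\<And>N. x N \<ge> 0" for x n B p
    proof (rule Lim_null_comparison[OF _ that(1)])
      show "\<forall>\<^sub>F N in sequentially. norm (x N * f n (q (real N))) \<le> B * x N * q (real N) powr - p"
        using eventually_gt_at_top[of 0]
      proof eventually_elim
        case (elim N)
        then have "\<bar>f n (q (real N))\<bar> \<le> B * q (real N) powr - p" using u by (intro that) (simp add: q_def)
        then have "x N * \<bar>f n (q (real N))\<bar> \<le> x N * (B * q (real N) powr - p)" by (rule mult_left_mono[OF _ that(3)])
        then show ?case by (simp only: real_norm_def abs_mult abs_of_nonneg[OF that(3)] mult_ac)
      qed
    qed
    \<comment> \<open>The factor x^3 in the first derivative grows as fast as the argument of f', so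
      decay of order 1 would not give the limit 0.\<close>
    obtain B1' where B1': "B1' > 0" "\<And>x y. 0 < y \<Longrightarrow> y \<le> x \<Longrightarrow> \<bar>f 1 x\<bar> \<le> B1' * y powr - 2"
      using f_inverse_powr_bound[of 2 1] by auto
    have l0: "(\<lambda>N. real N * f 0 (q (real N))) \<longlonglongrightarrow> 0"
    proof (rule lim[where B = B0])
      show "(\<lambda>N. B0 * real N * q (real N) powr - 1) \<longlonglongrightarrow> 0" unfolding q_def using u by real_asymp
    qed (use B0 in auto)
    have l0': "(\<lambda>N. 1 * f 0 (q (real N))) \<longlonglongrightarrow> 0"
    proof (rule lim[where B = B0])
      show "(\<lambda>N. B0 * 1 * q (real N) powr - 1) \<longlonglongrightarrow> 0" unfolding q_def using u by real_asymp
    qed (use B0 in auto)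
    have l1: "(\<lambda>N. 3 * a * real N ^ 3 * f 1 (q (real N))) \<longlonglongrightarrow> 0"
    proof (rule lim[where B = B1'])
      show "(\<lambda>N. B1' * (3 * a * real N ^ 3) * q (real N) powr - 2) \<longlonglongrightarrow> 0"
        unfolding q_def using u by real_asymp
    qed (use B1' u in auto)
    have I: "(\<lambda>N. integral {0..0 + real N} (g 0)) \<longlonglongrightarrow> cubic_mass * a powr - (2/3)"
      using tendsto_integral_at_top[OF cubic_integrable[OF u(1)]] unfolding cubic_integral[OF u(1)] g q_def .
    have L: "(\<lambda>N. g 0 (0 + real N)) \<longlonglongrightarrow> 0" "(\<lambda>N. g 1 (0 + real N)) \<longlonglongrightarrow> 0"
      using l0 tendsto_add[OF l0' l1] unfolding g by simp_all
    obtain S where "(\<lambda>k. g 0 (0 + real (Suc k))) sums S"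
       "\<bar>S - (cubic_mass * a powr - (2/3) - g 0 0 / 2 - g 1 0 / 12)\<bar> \<le> suminf B"
      using corrected_trapezoid_sums[OF Dg E sB I L] by blast
    moreover from this have "S = cubic_sum a" by (simp add: cubic_sum_def g q_def sums_iff)
    \<comment> \<open>Source of the constant -1/12: at 0 the function x f(a x^3) vanishes and has
      derivative f 0 0.\<close>
    moreover have "g 0 0 = 0" "g 1 0 = f 0 0" unfolding g by (simp_all add: q_def)
    ultimately show ?thesis using sumB by simp
  qed
  moreover have "D + D * Z > 0" using D Z0 by (simp add: add_pos_nonneg)
  ultimately show ?thesis using that by blast
qed

end

section \<open>The integral over the ratio of the summation variables\<close>

text \<open>The function \<open>v \<mapsto> sqrt (v (v + 1))\<close> turns \<open>v (v + 1)\<close> into a square; its derivative differs from 1 by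
  the integrable \<open>subst_defect\<close>.\<close>

definition subst_defect :: "real \<Rightarrow> real" where
  "subst_defect v = (v + 1/2) / sqrt (v * (v + 1)) - 1"

lemma subst_defect_measurable [measurable]: "subst_defect \<in> borel_measurable borel"
  unfolding subst_defect_def by measurable

text \<open>Since (v + 1/2)^2 exceeds v (v + 1) by only 1/4, the quotient exceeds 1 by a term of
  order v^(-2).\<close>

lemma subst_defect_bounds:
  assumes "v \<ge> 1"
  shows "0 \<le> subst_defect v" "subst_defect v \<le> v powr - 2"
proof -
  have w: "sqrt (v * (v + 1)) > 0" using assms by simp
  have "v * (v + 1) \<le> (v + 1/2)\<^sup>2" by (simp add: power2_eq_square algebra_simps)
  then have "sqrt (v * (v + 1)) \<le> v + 1/2" using assms by (intro real_le_lsqrt) auto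
  then show "0 \<le> subst_defect v" using w by (simp add: subst_defect_def)
  have "(v + 1/2)\<^sup>2 \<le> v * (v + 1) * (1 + 1 / v\<^sup>2)\<^sup>2"
  proof -
    have "(v + 1/2)\<^sup>2 = v * (v + 1) * 1 + 1/4" by (simp add: power2_eq_square algebra_simps)
    also have "1/4 \<le> v * (v + 1) * (2 / v\<^sup>2)" using assms by (simp add: field_simps power2_eq_square)
    also have "v * (v + 1) * 1 + v * (v + 1) * (2 / v\<^sup>2) = v * (v + 1) * (1 + 2 / v\<^sup>2)"
      by (simp only: distrib_left)
    also have "\<dots> \<le> v * (v + 1) * (1 + 1 / v\<^sup>2)\<^sup>2"
      using assms by (intro mult_left_mono) (auto simp: power2_sum)
    finally show ?thesis by simp
  qed
  then have "sqrt ((v + 1/2)\<^sup>2) \<le> sqrt (v * (v + 1) * (1 + 1 / v\<^sup>2)\<^sup>2)"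
    by (rule real_sqrt_le_mono)
  then have "v + 1/2 \<le> sqrt (v * (v + 1)) * (1 + 1 / v\<^sup>2)"
    using assms by (simp add: real_sqrt_mult)
  then have "(v + 1/2) / sqrt (v * (v + 1)) \<le> 1 + 1 / v\<^sup>2"
    using w by (simp add: divide_le_eq mult.commute)
  then show "subst_defect v \<le> v powr - 2"
    using assms by (simp add: subst_defect_def powr_minus_divide)
qed

lemma subst_deriv:
  assumes "v \<ge> 1"
  shows "((\<lambda>v. sqrt (v * (v + 1))) has_real_derivative 1 + subst_defect v) (at v within S)"
proof -
  have "v * (v + 1) > 0" using assms by (intro mult_pos_pos) auto
  then show ?thesis
    unfolding subst_defect_def
    by (auto intro!: derivative_eq_intros simp: field_simps)
qed

text \<open>A primitive is sqrt (v (v + 1)) - v, which tends to 1/2. The irrational part of the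
  value will cancel against the interval below sqrt 2 that the substitution does not reach.\<close>

lemma subst_defect_integral:
  "set_integrable lborel {1..} subst_defect" "(LINT v:{1..}|lborel. subst_defect v) = 3/2 - sqrt 2"
proof -
  show i: "set_integrable lborel {1..} subst_defect"
    by (rule set_integrable_decay[where p = 2 and B = 1]) (use subst_defect_bounds in auto)
  have "(subst_defect has_integral (sqrt ((1 + real N) * (1 + real N + 1)) - (1 + real N)) - (sqrt (1 * (1 + 1)) - 1)) {1..1 + real N}" for N
  proof (rule fundamental_theorem_of_calculus)
    fix x assume "x \<in> {1..1 + real N}"
    then have "((\<lambda>v. sqrt (v * (v + 1)) - v) has_real_derivative (1 + subst_defect x) - 1) (at x within {1..1 + real N})"
      by (intro derivative_intros subst_deriv) auto
    then show "((\<lambda>v. sqrt (v * (v + 1)) - v) has_vector_derivative subst_defect x) (at x within {1..1 + real N})"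
      by (simp add: has_real_derivative_iff_has_vector_derivative)
  qed simp
  then have "integral {1..1 + real N} subst_defect = (sqrt ((1 + real N) * (1 + real N + 1)) - (1 + real N)) - (sqrt 2 - 1)" for N
    by (simp add: integral_unique)
  moreover have "(\<lambda>N. (sqrt ((1 + real N) * (1 + real N + 1)) - (1 + real N)) - (sqrt 2 - 1)) \<longlonglongrightarrow> 1/2 - (sqrt 2 - 1)"
    by (intro tendsto_intros) real_asymp
  ultimately have "(\<lambda>N. integral {1..1 + real N} subst_defect) \<longlonglongrightarrow> 1/2 - (sqrt 2 - 1)" by simp
  from LIMSEQ_unique[OF tendsto_integral_at_top[OF i] this]
  show "(LINT v:{1..}|lborel. subst_defect v) = 3/2 - sqrt 2"
    by (simp add: set_lborel_to_absolutely_integrable(2)[OF i])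
qed

lemma subst_image: "(\<lambda>v. sqrt (v * (v + 1))) ` {1..} = {sqrt 2..}"
proof (intro equalityI subsetI)
  fix y assume "y \<in> (\<lambda>v. sqrt (v * (v + 1))) ` {1::real..}"
  then obtain v :: real where v: "v \<ge> 1" "y = sqrt (v * (v + 1))" by auto
  have "1 * (1 + 1) \<le> v * (v + 1)" using v by (intro mult_mono) auto
  then show "y \<in> {sqrt 2..}" using v by simp
next
  fix y assume "y \<in> {sqrt 2..}"
  then have y: "y \<ge> sqrt 2" by simp
  then have y0: "y \<ge> 0" using order_trans real_sqrt_ge_zero zero_le_numeral by blast
  have y2: "y\<^sup>2 \<ge> 2" using y by (metis power_mono real_sqrt_ge_zero real_sqrt_pow2 zero_le_numeral)
  \<comment> \<open>The positive root of v (v + 1) = y^2.\<close>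
  define v where "v = sqrt (y\<^sup>2 + 1/4) - 1/2"
  have "sqrt ((3/2)\<^sup>2) \<le> sqrt (y\<^sup>2 + 1/4)" using y2 by (intro real_sqrt_le_mono) (simp add: power2_eq_square)
  then have "v \<ge> 1" by (simp add: v_def)
  have "v * (v + 1) = (sqrt (y\<^sup>2 + 1/4))\<^sup>2 - 1/4" by (simp add: v_def power2_eq_square algebra_simps)
  also have "\<dots> = y\<^sup>2" by simp
  finally have "sqrt (v * (v + 1)) = y" using y0 by simp
  then show "y \<in> (\<lambda>v. sqrt (v * (v + 1))) ` {1..}" using \<open>v \<ge> 1\<close> by force
qed

lemma subst_inj: "inj_on (\<lambda>v. sqrt (v * (v + 1))) {1::real..}"
proof (rule strict_mono_on_imp_inj_on, rule strict_mono_onI)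
  fix r s :: real assume "r \<in> {1..}" "s \<in> {1..}" "r < s"
  then have "r * (r + 1) < s * (s + 1)" by (intro mult_strict_mono) auto
  then show "sqrt (r * (r + 1)) < sqrt (s * (s + 1))" by simp
qed

lemma integral_subst:
  fixes X :: "real \<Rightarrow> real"
  assumes X: "set_integrable lborel {sqrt 2..} X" and "X \<in> borel_measurable borel"
  shows "set_integrable lborel {1..} (\<lambda>v. (1 + subst_defect v) * X (sqrt (v * (v + 1))))"
    "(LINT v:{1..}|lborel. (1 + subst_defect v) * X (sqrt (v * (v + 1)))) = (LINT y:{sqrt 2..}|lborel. X y)"
  using set_lborel_change_of_variables[where g = "\<lambda>v. sqrt (v * (v + 1))" and g' = "\<lambda>v. 1 + subst_defect v" and S = "{1..}",
      unfolded subst_image, OF X assms(2) _ _ _ subst_deriv _ subst_inj] subst_defect_bounds(1) by auto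

text \<open>The factor that remains when K a^(-2/3) is integrated along a = u v (v + 1); half of a
  Beta value by \<open>beta_mass_eq\<close>.\<close>

definition beta_mass :: real where
  "beta_mass = (LINT v:{1..}|lborel. (v * (v + 1)) powr - (2/3))"

lemma beta_mass_integrable: "set_integrable lborel {1..} (\<lambda>v::real. (v * (v + 1)) powr - (2/3))"
proof (rule set_integrable_decay[where p = "4/3" and B = 1])
  fix v :: real assume v: "v \<ge> 1"
  have "(v * (v + 1)) powr - (2/3) \<le> (v * v) powr - (2/3)"
    using v by (intro powr_mono2') (auto intro!: mult_left_mono mult_pos_pos)
  also have "\<dots> = v powr - (4/3)" using v by (simp add: powr_mult flip: powr_add)
  finally show "\<bar>(v * (v + 1)) powr - (2/3)\<bar> \<le> 1 * v powr - (4/3)" by simp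
qed auto

context decaying begin

definition cubic_error :: "real \<Rightarrow> real" where
  "cubic_error a = cubic_sum a - cubic_mass * a powr - (2/3)"

lemma cubic_error_measurable [measurable]: "cubic_error \<in> borel_measurable borel"
  unfolding cubic_error_def[abs_def] by measurable

text \<open>For a \<le> 1 the expansion of T is used, for a > 1 its decay. The estimates with the
  constant - f 0 0 / 12 removed serve near 0, those without serve integrability at infinity.\<close>

lemma cubic_error_bounds:
  obtains C where "C > 0" "\<And>a. a > 0 \<Longrightarrow> \<bar>cubic_error a + f 0 0 / 12\<bar> \<le> C"
     "\<And>a. a > 0 \<Longrightarrow> \<bar>cubic_error a + f 0 0 / 12\<bar> \<le> C * a powr (3/5)"
     "\<And>a. a > 0 \<Longrightarrow> \<bar>cubic_error a\<bar> \<le> C * a powr - (2/3)"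
     "\<And>a. a > 0 \<Longrightarrow> \<bar>cubic_error a\<bar> \<le> C"
proof -
  obtain C1 where C1: "C1 > 0" "\<And>a. a > 0 \<Longrightarrow> cubic_sum a \<le> C1 * a powr - 1"
    by (rule cubic_sum_large) blast
  obtain C2 where C2: "C2 > 0" "\<And>a. a > 0 \<Longrightarrow> a \<le> 1 \<Longrightarrow>
     \<bar>cubic_error a + f 0 0 / 12\<bar> \<le> C2 * a powr (3/5)"
    unfolding cubic_error_def by (rule cubic_sum_small) blast
  define C where "C = C1 + C2 + \<bar>cubic_mass\<bar> + \<bar>f 0 0\<bar>"
  have C: "C > 0" using C1 C2 by (simp add: C_def)
  have *: "\<bar>cubic_error a + f 0 0 / 12\<bar> \<le> C \<and> \<bar>cubic_error a + f 0 0 / 12\<bar> \<le> C * a powr (3/5) \<and>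
     \<bar>cubic_error a\<bar> \<le> C * a powr - (2/3) \<and> \<bar>cubic_error a\<bar> \<le> C" if a: "a > 0" for a
  proof (cases "a \<le> 1")
    case True
    have p: "a powr (3/5) \<le> 1" using powr_le_one_le a True by (simp add: powr_le1)
    have p': "1 \<le> a powr - (2/3)" using powr_mono'[of "-(2/3)" 0 a] a True by simp
    have 1: "\<bar>cubic_error a + f 0 0 / 12\<bar> \<le> C2 * a powr (3/5)" using C2 a True by blast
    also have 2: "\<dots> \<le> C2" using p C2(1) by (simp add: mult_left_le)
    finally have 3: "\<bar>cubic_error a + f 0 0 / 12\<bar> \<le> C2" .
    then have 4: "\<bar>cubic_error a\<bar> \<le> C2 + \<bar>f 0 0\<bar>" by linarith
    have "C2 * a powr (3/5) \<le> C * a powr (3/5)" using C1 by (intro mult_right_mono) (auto simp: C_def)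
    moreover have "C * 1 \<le> C * a powr - (2/3)" using p' C by (intro mult_left_mono) auto
    moreover have "C2 + \<bar>f 0 0\<bar> \<le> C" using C1(1) by (simp add: C_def)
    ultimately show ?thesis using 1 3 4 by (intro conjI; linarith)
  next
    case False
    have p: "1 \<le> a powr (3/5)" using False by (simp add: ge_one_powr_ge_zero)
    have p': "a powr - (2/3) \<le> 1" using powr_mono[of "-(2/3)" 0 a] False by simp
    have p'': "a powr - 1 \<le> a powr - (2/3)" using powr_mono[of "-1" "-(2/3)" a] False by simp
    have "cubic_sum a \<le> C1 * a powr - (2/3)" using C1(2)[OF a] mult_left_mono[OF p'', of C1] C1(1) by linarith
    moreover have "\<bar>cubic_mass * a powr - (2/3)\<bar> = \<bar>cubic_mass\<bar> * a powr - (2/3)" by (simp add: abs_mult)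
    ultimately have 1: "\<bar>cubic_error a\<bar> \<le> (C1 + \<bar>cubic_mass\<bar>) * a powr - (2/3)"
      using cubic_sum_nonneg[OF a] C1(1) mult_nonneg_nonneg[of C1 "a powr - (2/3)"]
      unfolding cubic_error_def distrib_right by linarith
    also have "\<dots> \<le> C1 + \<bar>cubic_mass\<bar>" using p' C1(1) by (intro mult_left_le) auto
    finally have 2: "\<bar>cubic_error a\<bar> \<le> C1 + \<bar>cubic_mass\<bar>" .
    have "(C1 + \<bar>cubic_mass\<bar>) * a powr - (2/3) \<le> C * a powr - (2/3)"
      using C2(1) by (intro mult_right_mono) (auto simp: C_def)
    moreover have "C * 1 \<le> C * a powr (3/5)" using p C by (intro mult_left_mono) auto
    moreover have "C1 + \<bar>cubic_mass\<bar> + \<bar>f 0 0\<bar> \<le> C" using C2(1) by (simp add: C_def)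
    ultimately show ?thesis using 1 2 by (intro conjI; linarith)
  qed
  then show ?thesis using that C by blast
qed

text \<open>By t = y^2 this is half the Mellin transform of \<open>cubic_error\<close> at 1/2, the
  coefficient of u^(-1/2).\<close>

definition cubic_moment :: real where
  "cubic_moment = (LINT y:{0..}|lborel. cubic_error (y\<^sup>2))"

lemma cubic_moment_integrable: "set_integrable lborel {0..} (\<lambda>y. cubic_error (y\<^sup>2))"
proof -
  obtain C where C: "C > 0" "\<And>a. a > 0 \<Longrightarrow> \<bar>cubic_error a\<bar> \<le> C * a powr - (2/3)"
     "\<And>a. a > 0 \<Longrightarrow> \<bar>cubic_error a\<bar> \<le> C"
    by (rule cubic_error_bounds) blast
  show ?thesis
  proof (rule set_integrable_bounded_decay[where p = "4/3" and A = "C + \<bar>cubic_error 0\<bar>" and B = C])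
    fix x :: real assume "0 \<le> x" "x \<le> 1"
    then show "\<bar>cubic_error (x\<^sup>2)\<bar> \<le> C + \<bar>cubic_error 0\<bar>"
      using C(3)[of "x\<^sup>2"] C(1) by (cases "x = 0") (auto intro: add_increasing2)
  next
    fix x :: real assume "x \<ge> 1"
    moreover from this have "(x\<^sup>2) powr - (2/3) = x powr - (4/3)"
      by (simp add: powr_powr flip: powr_numeral)
    ultimately show "\<bar>cubic_error (x\<^sup>2)\<bar> \<le> C * x powr - (4/3)"
      using C(2)[of "x\<^sup>2"] by simp
  qed auto
qed

lemma cubic_moment_scale:
  assumes u: "u > 0"
  shows "set_integrable lborel {0..} (\<lambda>y. cubic_error (u * y\<^sup>2))"
    "(LINT y:{0..}|lborel. cubic_error (u * y\<^sup>2)) = cubic_moment * u powr - (1/2)"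
proof -
  have e: "(sqrt u * y)\<^sup>2 = u * y\<^sup>2" for y using u by (simp add: power_mult_distrib)
  have s: "sqrt u * x \<in> {0..} \<longleftrightarrow> x \<in> {0..}" for x using u by (simp add: zero_le_mult_iff)
  show "set_integrable lborel {0..} (\<lambda>y. cubic_error (u * y\<^sup>2))"
    using set_integrable_lborel_scale[OF _ s, of "\<lambda>y. cubic_error (y\<^sup>2)"] u cubic_moment_integrable
    by (simp add: e)
  show "(LINT y:{0..}|lborel. cubic_error (u * y\<^sup>2)) = cubic_moment * u powr - (1/2)"
    using set_integral_lborel_scale[OF _ s, of "\<lambda>y. cubic_error (y\<^sup>2)"] u
    by (simp add: e cubic_moment_def powr_minus_divide powr_half_sqrt)
qed

text \<open>The remainder is compared with \<open>u\<^bsup>1/2\<^esup> \<integral> y\<^sup>-\<^sup>2 min 1 (y\<^bsup>6/5\<^esup>) dy\<close>, which converges because \<open>1 < 6/5\<close>.\<close>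

lemma defect_remainder:
  obtains C where "C > 0" "\<And>u. u > 0 \<Longrightarrow>
      set_integrable lborel {1..} (\<lambda>v. subst_defect v * (cubic_error (u * (v * (v + 1))) + f 0 0 / 12)) \<and>
      \<bar>LINT v:{1..}|lborel. subst_defect v * (cubic_error (u * (v * (v + 1))) + f 0 0 / 12)\<bar> \<le> C * u powr (1/2)"
proof -
  obtain C where C: "C > 0" "\<And>a. a > 0 \<Longrightarrow> \<bar>cubic_error a + f 0 0 / 12\<bar> \<le> C"
     "\<And>a. a > 0 \<Longrightarrow> \<bar>cubic_error a + f 0 0 / 12\<bar> \<le> C * a powr (3/5)"
    by (rule cubic_error_bounds) blast
  \<comment> \<open>A majorant in the scaled variable y = sqrt u * v: the bound v^(-2) of the defect
    becomes u y^(-2), and u v (v + 1) \<le> 2 y^2 for v \<ge> 1. The factor 2 is 2^(3/5) rounded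
    up.\<close>
  define b where "b = (\<lambda>y::real. min C (C * 2 * y powr (6/5)) * y powr - 2)"
  have [measurable]: "b \<in> borel_measurable borel" unfolding b_def by measurable
  have b0: "b y \<ge> 0" for y using C(1) by (simp add: b_def)
  have bi: "set_integrable lborel {0<..} b"
  proof (rule set_integrable_powr_bounds[where q = "4/5" and p = 2 and A = "C * 2" and B = C])
    fix x :: real assume x: "0 < x" "x \<le> 1"
    have "b x \<le> (C * 2 * x powr (6/5)) * x powr -2" unfolding b_def by (intro mult_right_mono) auto
    also have "\<dots> = C * 2 * x powr - (4/5)" using x by (simp flip: powr_add)
    finally show "norm (b x) \<le> C * 2 * x powr - (4/5)" using b0 by simp
  next
    fix x :: real assume x: "x \<ge> 1"
    have "b x \<le> C * x powr -2" unfolding b_def by (intro mult_right_mono) auto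
    then show "norm (b x) \<le> C * x powr - 2" using b0 by simp
  qed auto
  define D where "D = (LINT y:{0<..}|lborel. b y)"
  have D0: "D \<ge> 0" unfolding D_def set_lebesgue_integral_def using b0 by (intro integral_nonneg_AE AE_I2) auto
  have "set_integrable lborel {1..} (\<lambda>v. subst_defect v * (cubic_error (u * (v * (v + 1))) + f 0 0 / 12)) \<and>
        \<bar>LINT v:{1..}|lborel. subst_defect v * (cubic_error (u * (v * (v + 1))) + f 0 0 / 12)\<bar> \<le> (D + 1) * u powr (1/2)"
    if u: "u > 0" for u
  proof -
    have s: "sqrt u * x \<in> {0<..} \<longleftrightarrow> x \<in> {0<..}" for x using u by (simp add: zero_less_mult_iff)
    have i: "set_integrable lborel {0<..} (\<lambda>v. u * b (sqrt u * v))"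
      using set_integrable_lborel_scale[OF _ s, of b] u bi by simp
    then have i1: "set_integrable lborel {1..} (\<lambda>v. u * b (sqrt u * v))"
      by (rule set_integrable_subset) auto
    have le: "\<bar>subst_defect v * (cubic_error (u * (v * (v + 1))) + f 0 0 / 12)\<bar> \<le> u * b (sqrt u * v)" if v: "v \<ge> 1" for v
    proof -
      define a where "a = u * (v * (v + 1))"
      have a: "a > 0" using u v by (simp add: a_def)
      have "a \<le> 2 * (sqrt u * v)\<^sup>2" using u v by (simp add: a_def power_mult_distrib power2_eq_square algebra_simps)
      then have "a powr (3/5) \<le> (2 * (sqrt u * v)\<^sup>2) powr (3/5)" using a by (intro powr_mono2) auto
      also have "\<dots> = 2 powr (3/5) * (sqrt u * v) powr (6/5)"
        using u v by (simp add: powr_mult powr_powr flip: powr_numeral)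
      also have "\<dots> \<le> 2 powr 1 * (sqrt u * v) powr (6/5)" by (intro mult_right_mono powr_mono) auto
      finally have "C * a powr (3/5) \<le> C * 2 * (sqrt u * v) powr (6/5)" using C(1) by simp
      then have e: "\<bar>cubic_error a + f 0 0 / 12\<bar> \<le> min C (C * 2 * (sqrt u * v) powr (6/5))"
        using C(2,3)[OF a] by simp
      have "\<bar>subst_defect v * (cubic_error a + f 0 0 / 12)\<bar> \<le> v powr - 2 * min C (C * 2 * (sqrt u * v) powr (6/5))"
        unfolding abs_mult using e subst_defect_bounds[OF v] by (intro mult_mono) auto
      also have "v powr - 2 = u * (sqrt u * v) powr - 2" using u v by (simp add: powr_minus powr_numeral field_simps power_mult_distrib)
      finally show ?thesis unfolding b_def a_def by (simp add: mult_ac)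
    qed
    have i2: "set_integrable lborel {1..} (\<lambda>v. subst_defect v * (cubic_error (u * (v * (v + 1))) + f 0 0 / 12))"
      by (rule set_integrable_bound[OF i1])
        (auto simp: set_borel_measurable_def intro!: order_trans[OF le abs_ge_self])
    have "\<bar>LINT v:{1..}|lborel. subst_defect v * (cubic_error (u * (v * (v + 1))) + f 0 0 / 12)\<bar>
        \<le> (LINT v:{1..}|lborel. \<bar>subst_defect v * (cubic_error (u * (v * (v + 1))) + f 0 0 / 12)\<bar>)"
      using set_integral_norm_bound[OF i2] by simp
    also have "\<dots> \<le> (LINT v:{1..}|lborel. u * b (sqrt u * v))"
      by (rule set_integral_mono[OF set_integrable_abs[OF i2] i1 le]) auto
    also have "\<dots> \<le> (LINT v:{0<..}|lborel. u * b (sqrt u * v))"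
      unfolding set_lebesgue_integral_def
      by (rule integral_mono) (use i i1 b0 u in \<open>auto simp: set_integrable_def indicator_def\<close>)
    also have "\<dots> = u * ((1 / sqrt u) * D)"
      using set_integral_lborel_scale[OF _ s, of b] u by (simp add: D_def)
    also have "\<dots> = D * u powr (1/2)" using u by (simp add: powr_half_sqrt real_div_sqrt field_simps)
    also have "\<dots> \<le> (D + 1) * u powr (1/2)" by (intro mult_right_mono) auto
    finally show ?thesis using i2 by simp
  qed
  moreover have "D + 1 > 0" using D0 by simp
  ultimately show ?thesis using that by blast
qed

text \<open>Let d be the defect and X the remainder at u v (v + 1), and write X = (1 + d) X - d X.
  The first part becomes an integral over y \<ge> sqrt 2, which is the full moment minus an
  interval. Where X is close to - f 0 0 / 12, that interval and the defect contribute (sqrt 2 + (3/2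
  - sqrt 2)) f 0 0 / 12 = f 0 0 / 8.\<close>

lemma cubic_sum_line_integral:
  obtains C where "C > 0" "\<And>u. u > 0 \<Longrightarrow> u \<le> 1 \<Longrightarrow>
      set_integrable lborel {1..} (\<lambda>v. cubic_sum (u * (v * (v + 1)))) \<and>
      \<bar>(LINT v:{1..}|lborel. cubic_sum (u * (v * (v + 1))))
        - (cubic_mass * beta_mass * u powr - (2/3) + cubic_moment * u powr - (1/2) + f 0 0 / 8)\<bar> \<le> C * u powr (1/2)"
proof -
  obtain C where C: "C > 0" "\<And>a. a > 0 \<Longrightarrow> \<bar>cubic_error a + f 0 0 / 12\<bar> \<le> C * a powr (3/5)"
    by (rule cubic_error_bounds) blast
  obtain C' where C': "C' > 0" "\<And>u. u > 0 \<Longrightarrow>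
      set_integrable lborel {1..} (\<lambda>v. subst_defect v * (cubic_error (u * (v * (v + 1))) + f 0 0 / 12))"
      "\<And>u. u > 0 \<Longrightarrow> \<bar>LINT v:{1..}|lborel. subst_defect v * (cubic_error (u * (v * (v + 1))) + f 0 0 / 12)\<bar> \<le> C' * u powr (1/2)"
    by (rule defect_remainder) blast
  have "set_integrable lborel {1..} (\<lambda>v. cubic_sum (u * (v * (v + 1)))) \<and>
      \<bar>(LINT v:{1..}|lborel. cubic_sum (u * (v * (v + 1))))
        - (cubic_mass * beta_mass * u powr - (2/3) + cubic_moment * u powr - (1/2) + f 0 0 / 8)\<bar> \<le> (4 * C + C') * u powr (1/2)"
    if u: "u > 0" "u \<le> 1" for u
  proof -
    define X where "X = (\<lambda>v. cubic_error (u * (v * (v + 1))))"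
    have [measurable]: "X \<in> borel_measurable borel" unfolding X_def by measurable
    note i0 = cubic_moment_scale(1)[OF u(1)]
    have nn: "0 \<le> x" if "sqrt 2 \<le> x" for x using real_sqrt_ge_zero[of 2] that by linarith
    have i1: "set_integrable lborel {sqrt 2..} (\<lambda>y. cubic_error (u * y\<^sup>2))"
      and i2: "set_integrable lborel {0..<sqrt 2} (\<lambda>y. cubic_error (u * y\<^sup>2))"
      by (rule set_integrable_subset[OF i0]; auto intro: nn)+
    have split: "(LINT y:{0..}|lborel. cubic_error (u * y\<^sup>2)) =
        (LINT y:{0..<sqrt 2}|lborel. cubic_error (u * y\<^sup>2)) + (LINT y:{sqrt 2..}|lborel. cubic_error (u * y\<^sup>2))"
    proof -
      have "{0..} = {0..<sqrt 2} \<union> {sqrt 2..}" by (auto intro: nn)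
      moreover have "{0..<sqrt 2} \<inter> {sqrt 2..} = {}" by auto
      ultimately show ?thesis using set_integral_Un[OF _ i2 i1] by simp
    qed
    define M where "M = (\<lambda>v. subst_defect v * (cubic_error (u * (v * (v + 1))) + f 0 0 / 12))"
    have iM: "set_integrable lborel {1..} M" "\<bar>LINT v:{1..}|lborel. M v\<bar> \<le> C' * u powr (1/2)"
      using C' u unfolding M_def by blast+
    have iW: "set_integrable lborel {1..} (\<lambda>v. (1 + subst_defect v) * X v)"
        "(LINT v:{1..}|lborel. (1 + subst_defect v) * X v) = (LINT y:{sqrt 2..}|lborel. cubic_error (u * y\<^sup>2))"
      using set_integrable_cong[OF refl refl, of "{1..}" "\<lambda>v. (1 + subst_defect v) * cubic_error (u * (sqrt (v * (v + 1)))\<^sup>2)" "\<lambda>v. (1 + subst_defect v) * X v"]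
       set_lebesgue_integral_cong[of "{1..}" lborel "\<lambda>v. (1 + subst_defect v) * cubic_error (u * (sqrt (v * (v + 1)))\<^sup>2)" "\<lambda>v. (1 + subst_defect v) * X v"]
       integral_subst[OF i1] by (auto simp: X_def)
    have Xeq: "X v = (1 + subst_defect v) * X v - M v + (f 0 0 / 12) * subst_defect v" for v
      by (simp add: M_def X_def algebra_simps)
    have iX: "set_integrable lborel {1..} X"
      by (subst Xeq[abs_def], intro set_integral_add(1) set_integral_diff(1) iW iM set_integrable_mult_right subst_defect_integral)
    have "(LINT v:{1..}|lborel. X v) = (LINT y:{sqrt 2..}|lborel. cubic_error (u * y\<^sup>2)) - (LINT v:{1..}|lborel. M v) + (f 0 0 / 12) * (3/2 - sqrt 2)"
      by (subst Xeq[abs_def], subst set_integral_add(2), (intro set_integral_diff(1) iW iM set_integrable_mult_right subst_defect_integral)+,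
          subst set_integral_diff(2), (intro iW iM)+, simp add: iW subst_defect_integral)
    then have X1: "(LINT v:{1..}|lborel. X v) = cubic_moment * u powr - (1/2) - (LINT y:{0..<sqrt 2}|lborel. cubic_error (u * y\<^sup>2))
          - (LINT v:{1..}|lborel. M v) + (f 0 0 / 12) * (3/2 - sqrt 2)"
      using split cubic_moment_scale(2)[OF u(1)] by simp
    \<comment> \<open>Below sqrt 2 the argument u y^2 is at most 2 u, and u^(3/5) \<le> u^(1/2)
      because u \<le> 1.\<close>
    have near: "\<bar>(LINT y:{0..<sqrt 2}|lborel. cubic_error (u * y\<^sup>2)) + sqrt 2 * (f 0 0 / 12)\<bar> \<le> 4 * C * u powr (1/2)"
    proof -
      have c: "set_integrable lborel {0<..<sqrt 2} (\<lambda>y::real. k)" for k :: real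
        unfolding set_integrable_def by (intro integrable_scaleR_left) auto
      have i3: "set_integrable lborel {0<..<sqrt 2} (\<lambda>y. cubic_error (u * y\<^sup>2))"
        by (rule set_integrable_subset[OF i2]) auto
      have i4: "set_integrable lborel {0<..<sqrt 2} (\<lambda>y. cubic_error (u * y\<^sup>2) + f 0 0 / 12)"
        by (intro set_integral_add(1) i3 c)
      have "(LINT y:{0..<sqrt 2}|lborel. cubic_error (u * y\<^sup>2)) = (LINT y:{0<..<sqrt 2}|lborel. cubic_error (u * y\<^sup>2))"
        unfolding set_lebesgue_integral_def
        by (rule integral_cong_AE) (use AE_lborel_singleton[of "0::real"] in \<open>auto elim!: eventually_mono simp: indicator_def\<close>)
      also have "\<dots> + sqrt 2 * (f 0 0 / 12) = (LINT y:{0<..<sqrt 2}|lborel. cubic_error (u * y\<^sup>2) + f 0 0 / 12)"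
        by (subst set_integral_add(2)[OF i3 c]) (simp add: set_lebesgue_integral_def)
      also have "\<bar>\<dots>\<bar> \<le> (LINT y:{0<..<sqrt 2}|lborel. \<bar>cubic_error (u * y\<^sup>2) + f 0 0 / 12\<bar>)"
        using set_integral_norm_bound[OF i4] by simp
      also have "\<dots> \<le> (LINT y:{0<..<sqrt 2}|lborel. 2 * C * u powr (1/2))"
      proof (rule set_integral_mono[OF set_integrable_abs[OF i4] c])
        fix y assume y: "y \<in> {0<..<sqrt 2}"
        then have "y\<^sup>2 < (sqrt 2)\<^sup>2" by (intro power_strict_mono) auto
        then have "u * y\<^sup>2 \<le> 2 * u" using u by simp
        have "\<bar>cubic_error (u * y\<^sup>2) + f 0 0 / 12\<bar> \<le> C * (u * y\<^sup>2) powr (3/5)" using u y by (intro C) auto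
        also have "\<dots> \<le> C * (2 * u) powr (3/5)" using C(1) u y \<open>u * y\<^sup>2 \<le> 2 * u\<close> by (intro mult_left_mono powr_mono2) auto
        also have "(2 * u) powr (3/5) = 2 powr (3/5) * u powr (3/5)" using u by (simp add: powr_mult)
        also have "\<dots> \<le> 2 powr 1 * u powr (1/2)" using u by (intro mult_mono powr_mono powr_mono') auto
        finally show "\<bar>cubic_error (u * y\<^sup>2) + f 0 0 / 12\<bar> \<le> 2 * C * u powr (1/2)" using C(1) by (simp add: mult_ac)
      qed
      also have "\<dots> = sqrt 2 * (2 * C * u powr (1/2))" by (simp add: set_lebesgue_integral_def)
      also have "\<dots> \<le> 2 * (2 * C * u powr (1/2))" using C(1) by (intro mult_right_mono) (auto intro: real_le_lsqrt)
      finally show ?thesis by simp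
    qed
    have e: "cubic_sum (u * (v * (v + 1))) = X v + cubic_mass * u powr - (2/3) * (v * (v + 1)) powr - (2/3)" for v
      by (cases "v \<ge> 0 \<or> v \<le> -1") (use u in \<open>auto simp: X_def cubic_error_def powr_mult\<close>)
    have "set_integrable lborel {1..} (\<lambda>v. cubic_sum (u * (v * (v + 1))))"
      unfolding e by (intro set_integral_add(1) iX set_integrable_mult_right beta_mass_integrable)
    moreover have "(LINT v:{1..}|lborel. cubic_sum (u * (v * (v + 1)))) = (LINT v:{1..}|lborel. X v) + cubic_mass * u powr - (2/3) * beta_mass"
      unfolding e beta_mass_def by (subst set_integral_add(2)) (use iX beta_mass_integrable in auto)
    ultimately show ?thesis using X1 near iM(2) by (auto simp: abs_le_iff algebra_simps)
  qed
  moreover have "4 * C + C' > 0" using C C' by simp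
  ultimately show ?thesis using that by blast
qed

end

section \<open>Assembling the double sum\<close>

lemma sum_inverse_cubes_tail:
  assumes "j \<ge> (1::nat)"
  shows "(\<Sum>k. (real j + real k) powr - 3) \<le> 2 * real j powr - 2"
proof -
  \<comment> \<open>Telescoping majorant: 2 / x^2 - 2 / (x + 1)^2 = (4 x + 2) / (x^2 (x + 1)^2) is
    at least 1 / x^3 for x \<ge> 1. Multiplied by the factor x^(1/2) of \<open>row_sum\<close>, the
    resulting bound is summable over x.\<close>
  have t: "(\<lambda>k. 2 / (real j + real k)\<^sup>2 - 2 / (real j + real (Suc k))\<^sup>2) sums (2 / (real j + real 0)\<^sup>2 - 0)"
    by (rule telescope_sums') (use assms in real_asymp)
  have le: "(real j + real k) powr - 3 \<le> 2 / (real j + real k)\<^sup>2 - 2 / (real j + real (Suc k))\<^sup>2" for k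
  proof -
    define x where "x = real j + real k"
    have x: "x \<ge> 1" using assms by (simp add: x_def)
    have "(x + 1)\<^sup>2 * 1 \<le> (4 * x + 2) * x"
    proof -
      have "1 * 1 \<le> x * x" using x by (intro mult_mono) auto
      then show ?thesis using x by (simp add: power2_eq_square algebra_simps)
    qed
    then have "(x + 1)\<^sup>2 * 1 / (x ^ 3 * (x + 1)\<^sup>2) \<le> (4 * x + 2) * x / (x ^ 3 * (x + 1)\<^sup>2)"
      using x by (intro divide_right_mono) auto
    moreover have "(x + 1)\<^sup>2 * 1 / (x ^ 3 * (x + 1)\<^sup>2) = 1 / x ^ 3" using x by simp
    moreover have "(4 * x + 2) * x / (x ^ 3 * (x + 1)\<^sup>2) = (4 * x + 2) / (x\<^sup>2 * (x + 1)\<^sup>2)"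
      using x by (simp add: power3_eq_cube power2_eq_square)
    ultimately have "1 / x ^ 3 \<le> (4 * x + 2) / (x\<^sup>2 * (x + 1)\<^sup>2)" by simp
    also have "4 * x + 2 = 2 * (x + 1)\<^sup>2 - 2 * x\<^sup>2" by (simp add: power2_eq_square algebra_simps)
    also have "\<dots> / (x\<^sup>2 * (x + 1)\<^sup>2) = 2 / x\<^sup>2 - 2 / (x + 1)\<^sup>2"
      using x by (simp add: diff_frac_eq)
    finally show ?thesis using x by (simp add: x_def powr_minus_divide powr_numeral add_ac)
  qed
  have "summable (\<lambda>k. (real j + real k) powr - 3)"
    using le by (intro summable_comparison_test'[OF sums_summable[OF t]]) auto
  then have "(\<Sum>k. (real j + real k) powr - 3) \<le> (\<Sum>k. 2 / (real j + real k)\<^sup>2 - 2 / (real j + real (Suc k))\<^sup>2)"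
    by (rule suminf_le[OF le _ sums_summable[OF t]])
  also have "\<dots> = 2 * real j powr - 2"
    using sums_unique[OF t] by (simp add: powr_minus_divide powr_numeral)
  finally show ?thesis .
qed

text \<open>Tonelli for series: nonnegativity turns an iterated ordered sum into an unordered one,
  which may then be cut along the diagonal.\<close>

lemma has_sum_Times_nonneg:
  fixes g :: "nat \<Rightarrow> nat \<Rightarrow> real"
  assumes "\<And>j k. g j k \<ge> 0" "\<And>j. (g j) sums S j" "S sums s"
  shows "((\<lambda>(j, k). g j k) has_sum s) UNIV"
proof -
  have S: "S j \<ge> 0" for j using suminf_nonneg assms(1,2) by (metis sums_iff)
  have 1: "(g j has_sum S j) UNIV" for j
    by (rule sums_nonneg_imp_has_sum) (use assms in auto)
  have 2: "(S has_sum s) UNIV"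
    by (rule sums_nonneg_imp_has_sum) (use assms S in auto)
  have "(\<lambda>(j, k). g j k) summable_on Sigma UNIV (\<lambda>_. UNIV)"
    by (rule summable_on_SigmaI[where g = S]) (use 1 2 assms has_sum_imp_summable in auto)
  then have "((\<lambda>(j, k). g j k) has_sum s) (Sigma UNIV (\<lambda>_. UNIV))"
    using 1 2 by (intro has_sum_SigmaI[where g = S]) auto
  then show ?thesis by simp
qed

lemma has_sum_symmetric:
  fixes F :: "nat \<Rightarrow> nat \<Rightarrow> real"
  assumes F: "\<And>j k. F j k = F k j"
    and U: "((\<lambda>(j, i). F j (j + Suc i)) has_sum U) UNIV"
    and D: "((\<lambda>j. F j j) has_sum D) UNIV"
  shows "((\<lambda>(j, k). F j k) has_sum (2 * U + D)) UNIV"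
proof -
  have 1: "((\<lambda>(j, k). F j k) has_sum U) {(j, k). j < k}"
    using U by (rule has_sum_reindex_bij_witness[where i = "\<lambda>(j, k). (j, k - Suc j)" and j = "\<lambda>(j, i). (j, j + Suc i)", THEN iffD1, rotated -1]) auto
  have 2: "((\<lambda>(j, k). F j k) has_sum U) {(j, k). k < j}"
    using 1 by (rule has_sum_reindex_bij_witness[where i = "\<lambda>(j, k). (k, j)" and j = "\<lambda>(j, k). (k, j)", THEN iffD1, rotated -1]) (auto simp: F)
  have 3: "((\<lambda>(j, k). F j k) has_sum D) {(j, k). j = k}"
    using D by (rule has_sum_reindex_bij_witness[where i = "\<lambda>(j, k). j" and j = "\<lambda>j. (j, j)", THEN iffD1, rotated -1]) auto
  have 4: "((\<lambda>(j, k). F j k) has_sum (U + U + D)) ({(j, k). j < k} \<union> {(j, k). k < j} \<union> {(j, k). j = k})"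
    by (intro has_sum_Un_disjoint 1 2 3) auto
  have 5: "{(j, k). j < k} \<union> {(j, k). k < j} \<union> {(j, k). j = k} = (UNIV :: (nat \<times> nat) set)"
    using linorder_less_linear by blast
  show ?thesis using 4 unfolding 5 mult_2 .
qed

context decaying begin

text \<open>The substitution y = x v moves every row to the same half-line v \<ge> 1, so that the
  sum over x can be taken under the integral, where it is T.\<close>

lemma row_integral_scale:
  assumes "u > 0" "x > 0"
  shows "set_integrable lborel {1..} (\<lambda>v. x * f 0 (u * (v * (v + 1)) * x ^ 3))"
    "integral {x..} (\<lambda>y. f 0 (u * x * y * (y + x))) = (LINT v:{1..}|lborel. x * f 0 (u * (v * (v + 1)) * x ^ 3))"
proof -
  note i = row_integrable[OF assms]
  have ind: "indicator {x..} (x * v) = (indicator {1..} v :: real)" for v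
    using assms by (auto simp: indicator_def)
  have e: "f 0 (u * x * (x * v) * (x * v + x)) = f 0 (u * (v * (v + 1)) * x ^ 3)" for v
    by (simp add: power3_eq_cube algebra_simps)
  have "integrable lborel (\<lambda>v. indicator {1..} v *\<^sub>R f 0 (u * (v * (v + 1)) * x ^ 3))"
    using lborel_integrable_real_affine[of "\<lambda>y. indicator {x..} y *\<^sub>R f 0 (u * x * y * (y + x))" x 0] i assms
    by (simp add: set_integrable_def ind e)
  then have "set_integrable lborel {1..} (\<lambda>v. f 0 (u * (v * (v + 1)) * x ^ 3))"
    by (simp add: set_integrable_def)
  then show "set_integrable lborel {1..} (\<lambda>v. x * f 0 (u * (v * (v + 1)) * x ^ 3))"
    by (rule set_integrable_mult_right)
  have "integral {x..} (\<lambda>y. f 0 (u * x * y * (y + x))) = (LINT y:{x..}|lborel. f 0 (u * x * y * (y + x)))"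
    by (simp add: set_lborel_to_absolutely_integrable(2)[OF i])
  also have "\<dots> = x * (LINT v:{1..}|lborel. f 0 (u * (v * (v + 1)) * x ^ 3))"
    using lborel_integral_real_affine[of x "\<lambda>y. indicator {x..} y *\<^sub>R f 0 (u * x * y * (y + x))" 0] assms
    by (simp add: set_lebesgue_integral_def ind e)
  finally show "integral {x..} (\<lambda>y. f 0 (u * x * y * (y + x))) = (LINT v:{1..}|lborel. x * f 0 (u * (v * (v + 1)) * x ^ 3))"
    by simp
qed

lemma cubic_summable: "a > 0 \<Longrightarrow> summable (\<lambda>k. real (Suc k) * f 0 (a * real (Suc k) ^ 3))"
  by (rule cubic_sum_large) blast

text \<open>Monotone convergence in the guise of dominated convergence: the terms are nonnegative,
  so the full sum dominates its partial sums.\<close>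

lemma row_integral_sums:
  assumes u: "u > 0" and int: "set_integrable lborel {1..} (\<lambda>v. cubic_sum (u * (v * (v + 1))))"
  shows "(\<lambda>k. integral {real (Suc k)..} (\<lambda>y. f 0 (u * real (Suc k) * y * (y + real (Suc k)))))
           sums (LINT v:{1..}|lborel. cubic_sum (u * (v * (v + 1))))"
proof -
  define c where "c = (\<lambda>k v. real (Suc k) * f 0 (u * (v * (v + 1)) * real (Suc k) ^ 3))"
  have c0: "c k v \<ge> 0" for k v by (simp add: c_def f_nonneg)
  have ci: "set_integrable lborel {1..} (c k)" for k
    unfolding c_def by (rule row_integral_scale(1)[OF u]) simp
  have sm: "summable (\<lambda>k. c k v)" if "v \<ge> 1" for v
  proof -
    have "u * (v * (v + 1)) > 0" using u that by (intro mult_pos_pos) auto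
    then show ?thesis unfolding c_def by (rule cubic_summable)
  qed
  have cs: "cubic_sum (u * (v * (v + 1))) = (\<Sum>k. c k v)" for v by (simp add: c_def cubic_sum_def)
  have "(\<lambda>N. LINT v|lborel. (\<Sum>k<N. indicator {1..} v *\<^sub>R c k v)) \<longlonglongrightarrow> (LINT v|lborel. indicator {1..} v *\<^sub>R cubic_sum (u * (v * (v + 1))))"
  proof (rule integral_dominated_convergence)
    show "integrable lborel (\<lambda>v. indicator {1..} v *\<^sub>R cubic_sum (u * (v * (v + 1))))"
      using int by (simp add: set_integrable_def)
    then show "(\<lambda>v. indicator {1..} v *\<^sub>R cubic_sum (u * (v * (v + 1)))) \<in> borel_measurable lborel" by auto
    show "(\<lambda>v. \<Sum>k<N. indicator {1..} v *\<^sub>R c k v) \<in> borel_measurable lborel" for N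
      using ci unfolding set_integrable_def by (intro borel_measurable_sum) auto
    show "AE v in lborel. (\<lambda>N. \<Sum>k<N. indicator {1..} v *\<^sub>R c k v) \<longlonglongrightarrow> indicator {1..} v *\<^sub>R cubic_sum (u * (v * (v + 1)))"
      using sm by (intro AE_I2) (auto simp: indicator_def cs intro!: summable_LIMSEQ)
    show "AE v in lborel. norm (\<Sum>k<N. indicator {1..} v *\<^sub>R c k v) \<le> indicator {1..} v *\<^sub>R cubic_sum (u * (v * (v + 1)))" for N
      using sm c0 by (intro AE_I2) (auto simp: indicator_def cs abs_of_nonneg sum_nonneg intro!: sum_le_suminf)
  qed
  moreover have "(LINT v|lborel. (\<Sum>k<N. indicator {1..} v *\<^sub>R c k v)) = (\<Sum>k<N. LINT v:{1..}|lborel. c k v)" for N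
    using ci unfolding set_integrable_def set_lebesgue_integral_def by (intro Bochner_Integration.integral_sum) auto
  ultimately have "(\<lambda>k. LINT v:{1..}|lborel. c k v) sums (LINT v:{1..}|lborel. cubic_sum (u * (v * (v + 1))))"
    by (simp add: sums_def set_lebesgue_integral_def)
  moreover have "(LINT v:{1..}|lborel. c k v) = integral {real (Suc k)..} (\<lambda>y. f 0 (u * real (Suc k) * y * (y + real (Suc k))))" for k
    unfolding c_def by (rule row_integral_scale(2)[symmetric, OF u]) simp
  ultimately show ?thesis by simp
qed

text \<open>The constant is 2 (1/8 + 1/24) = 1/3 times f 0 0: the line integral gives 1/8, and the
  end corrections, whose sum is close to - f 0 0 / 2, enter with the factor -1/12. The values d j on
  the diagonal cancel exactly, so that only their summability has to be known.\<close>

theorem grid_sum: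
  obtains C where "C > 0" "\<And>u. u > 0 \<Longrightarrow> u \<le> 1 \<Longrightarrow> \<exists>S.
    ((\<lambda>(j, k). f 0 (u * real (Suc j * Suc k * (Suc j + Suc k)))) has_sum S) UNIV \<and>
    \<bar>S - (2 * (cubic_mass * beta_mass * u powr - (2/3)) + 2 * (cubic_moment * u powr - (1/2)) + f 0 0 / 3)\<bar> \<le> C * u powr (1/2)"
proof -
  obtain C1 where C1: "C1 > 0" "\<And>u x. u > 0 \<Longrightarrow> x > 0 \<Longrightarrow> \<exists>S.
     (\<lambda>k. f 0 (u * x * (x + real (Suc k)) * ((x + real (Suc k)) + x))) sums S \<and>
     \<bar>S - (integral {x..} (\<lambda>y. f 0 (u * x * y * (y + x))) - f 0 (2 * u * x ^ 3) / 2
            - 3 * u * x\<^sup>2 * f 1 (2 * u * x ^ 3) / 12)\<bar> \<le> C1 * u powr (1/2) * x powr (1/2) * (\<Sum>k. (x + real k) powr -3)"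
    by (rule row_sum) blast
  obtain C2 where C2: "C2 > 0" "\<And>u. u > 0 \<Longrightarrow> u \<le> 1 \<Longrightarrow> \<exists>S.
     (\<lambda>k. 3 * u * (real (Suc k))\<^sup>2 * f 1 (2 * u * real (Suc k) ^ 3)) sums S \<and> \<bar>S + f 0 0 / 2\<bar> \<le> C2 * u powr (1/2)"
    by (rule diagonal_sum) blast
  obtain C3 where C3: "C3 > 0" "\<And>u. u > 0 \<Longrightarrow> u \<le> 1 \<Longrightarrow>
      set_integrable lborel {1..} (\<lambda>v. cubic_sum (u * (v * (v + 1)))) \<and>
      \<bar>(LINT v:{1..}|lborel. cubic_sum (u * (v * (v + 1))))
        - (cubic_mass * beta_mass * u powr - (2/3) + cubic_moment * u powr - (1/2) + f 0 0 / 8)\<bar> \<le> C3 * u powr (1/2)"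
    by (rule cubic_sum_line_integral) blast
  have sZ: "summable (\<lambda>k. real (Suc k) powr - (3/2))" by (rule summable_Suc_powr) simp
  define Z where "Z = (\<Sum>k. real (Suc k) powr - (3/2))"
  have Z0: "Z \<ge> 0" unfolding Z_def by (intro suminf_nonneg sZ) auto
  define C where "C = 2 * C3 + C2 + 4 * C1 * Z"
  have C: "C > 0" using C1(1) C2(1) C3(1) Z0 by (simp add: C_def add_pos_nonneg)
  have "\<exists>S.
    ((\<lambda>(j, k). f 0 (u * real (Suc j * Suc k * (Suc j + Suc k)))) has_sum S) UNIV \<and>
    \<bar>S - (2 * (cubic_mass * beta_mass * u powr - (2/3)) + 2 * (cubic_moment * u powr - (1/2)) + f 0 0 / 3)\<bar> \<le> C * u powr (1/2)"
    if u: "u > 0" "u \<le> 1" for u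
  proof -
    define I where "I = (\<lambda>j. integral {real (Suc j)..} (\<lambda>y. f 0 (u * real (Suc j) * y * (y + real (Suc j)))))"
    define d where "d = (\<lambda>j. f 0 (2 * u * real (Suc j) ^ 3))"
    define a where "a = (\<lambda>j. 3 * u * (real (Suc j))\<^sup>2 * f 1 (2 * u * real (Suc j) ^ 3))"
    define T where "T = (LINT v:{1..}|lborel. cubic_sum (u * (v * (v + 1))))"
    define row where "row = (\<lambda>j k. f 0 (u * real (Suc j) * (real (Suc j) + real (Suc k)) * ((real (Suc j) + real (Suc k)) + real (Suc j))))"
    have I: "I sums T" using row_integral_sums[OF u(1)] C3(2)[OF u] unfolding I_def T_def by blast
    have T: "\<bar>T - (cubic_mass * beta_mass * u powr - (2/3) + cubic_moment * u powr - (1/2) + f 0 0 / 8)\<bar> \<le> C3 * u powr (1/2)"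
      using C3(2)[OF u] by (simp add: T_def)
    obtain A where A: "a sums A" "\<bar>A + f 0 0 / 2\<bar> \<le> C2 * u powr (1/2)"
      using C2(2)[OF u] unfolding a_def by blast
    have "\<forall>j. \<exists>S. row j sums S \<and> \<bar>S - (I j - d j / 2 - a j / 12)\<bar> \<le> 2 * C1 * u powr (1/2) * real (Suc j) powr - (3/2)"
    proof
      fix j
      obtain S where S: "row j sums S" "\<bar>S - (I j - d j / 2 - a j / 12)\<bar> \<le> C1 * u powr (1/2) * real (Suc j) powr (1/2) * (\<Sum>k. (real (Suc j) + real k) powr -3)"
        using C1(2)[OF u(1), of "real (Suc j)"] unfolding row_def I_def d_def a_def by auto
      note S(2)
      also have "C1 * u powr (1/2) * real (Suc j) powr (1/2) * (\<Sum>k. (real (Suc j) + real k) powr -3)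
          \<le> C1 * u powr (1/2) * real (Suc j) powr (1/2) * (2 * real (Suc j) powr -2)"
        using sum_inverse_cubes_tail[of "Suc j"] C1(1) by (intro mult_left_mono) auto
      also have "real (Suc j) powr (1/2) * real (Suc j) powr -2 = real (Suc j) powr - (3/2)"
        using powr_add[of "real (Suc j)" "1/2" "-2"] by simp
      then have "C1 * u powr (1/2) * real (Suc j) powr (1/2) * (2 * real (Suc j) powr -2) = 2 * C1 * u powr (1/2) * real (Suc j) powr - (3/2)"
        by (metis (no_types, opaque_lifting) mult.assoc mult.left_commute)
      finally show "\<exists>S. row j sums S \<and> \<bar>S - (I j - d j / 2 - a j / 12)\<bar> \<le> 2 * C1 * u powr (1/2) * real (Suc j) powr - (3/2)"
        using S(1) by blast
    qed
    then obtain R where R: "\<And>j. row j sums R j" "\<And>j. \<bar>R j - (I j - d j / 2 - a j / 12)\<bar> \<le> 2 * C1 * u powr (1/2) * real (Suc j) powr - (3/2)"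
      by metis
    define \<delta> where "\<delta> = (\<lambda>j. R j - (I j - d j / 2 - a j / 12))"
    have sB: "summable (\<lambda>j. 2 * C1 * u powr (1/2) * real (Suc j) powr - (3/2))" by (intro summable_mult sZ)
    have s1: "summable (\<lambda>j. \<bar>\<delta> j\<bar>)"
      by (rule summable_comparison_test'[OF sB]) (use R(2) in \<open>simp add: \<delta>_def\<close>)
    have s2: "summable \<delta>" using s1 by (rule summable_rabs_cancel)
    have "\<bar>suminf \<delta>\<bar> \<le> (\<Sum>j. \<bar>\<delta> j\<bar>)" by (rule summable_rabs[OF s1])
    also have "\<dots> \<le> (\<Sum>j. 2 * C1 * u powr (1/2) * real (Suc j) powr - (3/2))"
      using R(2) by (intro suminf_le s1 sB) (simp add: \<delta>_def)
    also have "\<dots> = 2 * C1 * u powr (1/2) * Z" unfolding Z_def by (rule suminf_mult[OF sZ])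
    finally have \<delta>: "\<bar>suminf \<delta>\<bar> \<le> 2 * C1 * u powr (1/2) * Z" .
    obtain B where B: "B > 0" "\<And>x. x > 0 \<Longrightarrow> x ^ 0 * \<bar>f 0 x\<bar> \<le> B * x powr - 1"
      by (rule f_mono_powr_bound) blast
    have sd: "summable d"
    proof (rule summable_comparison_test'[OF summable_mult[OF summable_Suc_powr[of 3], of "B * (2 * u) powr - 1"]])
      fix j :: nat
      have "\<bar>d j\<bar> \<le> B * (2 * u * real (Suc j) ^ 3) powr - 1" using B(2)[of "2 * u * real (Suc j) ^ 3"] u by (simp add: d_def del: of_nat_Suc)
      also have "\<dots> = B * (2 * u) powr - 1 * real (Suc j) powr - 3"
        using u by (simp add: powr_minus_divide powr_numeral field_simps del: of_nat_Suc)
      finally show "norm (d j) \<le> B * (2 * u) powr - 1 * real (Suc j) powr - 3" by simp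
    qed simp
    have Rs: "R sums (suminf \<delta> + (T - suminf d / 2 - A / 12))"
    proof -
      have "(\<lambda>j. \<delta> j + (I j - d j / 2 - a j / 12)) sums (suminf \<delta> + (T - suminf d / 2 - A / 12))"
        by (intro sums_add sums_diff sums_divide I A summable_sums s2 sd)
      then show ?thesis by (simp add: \<delta>_def)
    qed
    have U: "((\<lambda>(j, k). row j k) has_sum (suminf \<delta> + (T - suminf d / 2 - A / 12))) UNIV"
      by (rule has_sum_Times_nonneg[OF _ R(1) Rs]) (simp add: row_def f_nonneg)
    have D: "(d has_sum suminf d) UNIV"
      by (rule sums_nonneg_imp_has_sum[OF summable_sums[OF sd]]) (simp add: d_def f_nonneg)
    define F where "F = (\<lambda>j k. f 0 (u * real (Suc j * Suc k * (Suc j + Suc k))))"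
    have "((\<lambda>(j, k). F j k) has_sum (2 * (suminf \<delta> + (T - suminf d / 2 - A / 12)) + suminf d)) UNIV"
    proof (rule has_sum_symmetric)
      have "F j (j + Suc i) = row j i" for j i
        unfolding F_def row_def by (intro arg_cong[of _ _ "f 0"]) (simp add: algebra_simps)
      then show "((\<lambda>(j, i). F j (j + Suc i)) has_sum (suminf \<delta> + (T - suminf d / 2 - A / 12))) UNIV"
        using U by simp
      have "F j j = d j" for j
        unfolding F_def d_def by (intro arg_cong[of _ _ "f 0"]) (simp add: power3_eq_cube algebra_simps)
      then show "((\<lambda>j. F j j) has_sum suminf d) UNIV" using D by simp
      show "F j k = F k j" for j k unfolding F_def by (intro arg_cong[of _ _ "f 0"]) (simp add: algebra_simps)
    qed
    moreover have "\<bar>(2 * (suminf \<delta> + (T - suminf d / 2 - A / 12)) + suminf d) -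
       (2 * (cubic_mass * beta_mass * u powr - (2/3)) + 2 * (cubic_moment * u powr - (1/2)) + f 0 0 / 3)\<bar> \<le> C * u powr (1/2)"
    proof -
      have pos: "0 \<le> C2 * u powr (1/2)" using C2(1) by simp
      have Ce: "C * u powr (1/2) = 2 * (C3 * u powr (1/2)) + C2 * u powr (1/2) + 2 * (2 * C1 * u powr (1/2) * Z)"
        by (simp add: C_def algebra_simps)
      \<comment> \<open>A enters with the factor -1/6, so its share of the error is c2 / 6,
        generously bounded by c2.\<close>
      have arith: "\<bar>2 * (D + (t - d / 2 - A / 12)) + d - (2 * X + 2 * Y + g / 3)\<bar> \<le> 2 * c3 + c2 + 2 * c1"
        if "\<bar>t - (X + Y + g / 8)\<bar> \<le> c3" "\<bar>A + g / 2\<bar> \<le> c2" "\<bar>D\<bar> \<le> c1" "0 \<le> c2"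
        for D t d A X Y g c1 c2 c3 :: real
        using that unfolding abs_le_iff by (elim conjE, intro conjI; simp add: field_simps)
      show ?thesis unfolding Ce by (rule arith[OF T A(2) \<delta> pos])
    qed
    ultimately show ?thesis unfolding F_def by blast
  qed
  then show ?thesis using that C by blast
qed

end

section \<open>Mellin transforms\<close>

definition mellin :: "(real \<Rightarrow> real) \<Rightarrow> complex \<Rightarrow> complex" where
  "mellin \<phi> s = (LINT t:{0<..}|lborel. of_real (\<phi> t) * of_real t powr (s - 1))"

text \<open>Absolute convergence depends only on the real part of s, hence the real
  parameter.\<close>

definition mellin_integrable :: "(real \<Rightarrow> real) \<Rightarrow> real \<Rightarrow> bool" where
  "mellin_integrable \<phi> \<sigma> \<longleftrightarrow> set_integrable lborel {0<..} (\<lambda>t. \<phi> t * t powr (\<sigma> - 1))"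

lemma norm_mellin_integrand: "t > 0 \<Longrightarrow> norm (of_real x * of_real t powr (s - 1)) = \<bar>x\<bar> * t powr (Re s - 1)"
  by (simp add: norm_mult norm_powr_real_powr)

lemma mellin_set_integrable_iff:
  assumes [measurable]: "\<phi> \<in> borel_measurable borel"
  shows "set_integrable lborel {0<..} (\<lambda>t. of_real (\<phi> t) * of_real t powr (s - 1) :: complex) \<longleftrightarrow> mellin_integrable \<phi> (Re s)"
proof
  assume a: "set_integrable lborel {0<..} (\<lambda>t. of_real (\<phi> t) * of_real t powr (s - 1) :: complex)"
  show "mellin_integrable \<phi> (Re s)"
    unfolding mellin_integrable_def
    by (rule set_integrable_bound[OF a])
       (auto simp: set_borel_measurable_def norm_mellin_integrand abs_mult)
next
  assume "mellin_integrable \<phi> (Re s)"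
  then have a: "set_integrable lborel {0<..} (\<lambda>t. \<phi> t * t powr (Re s - 1))" by (simp add: mellin_integrable_def)
  show "set_integrable lborel {0<..} (\<lambda>t. of_real (\<phi> t) * of_real t powr (s - 1) :: complex)"
    by (rule set_integrable_bound[OF a])
       (auto simp: set_borel_measurable_def norm_mellin_integrand abs_mult)
qed

lemma mellin_of_real:
  "mellin \<phi> (of_real \<sigma>) = of_real (LINT t:{0<..}|lborel. \<phi> t * t powr (\<sigma> - 1))"
proof -
  have "(of_real t :: complex) powr (of_real \<sigma> - 1) = of_real (t powr (\<sigma> - 1))" if "t > 0" for t
    using powr_of_real[of t "\<sigma> - 1"] that by simp
  then have "mellin \<phi> (of_real \<sigma>) = (LINT t:{0<..}|lborel. complex_of_real (\<phi> t * t powr (\<sigma> - 1)))"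
    unfolding mellin_def by (intro set_lebesgue_integral_cong) auto
  then show ?thesis by (simp only: set_integral_complex_of_real)
qed

lemma mellin_integrable_powr_bounds:
  assumes [measurable]: "\<phi> \<in> borel_measurable borel"
    and A: "-a < \<sigma>" "\<And>t. 0 < t \<Longrightarrow> t \<le> 1 \<Longrightarrow> \<bar>\<phi> t\<bar> \<le> A * t powr a"
    and B: "\<sigma> < -b" "\<And>t. t \<ge> 1 \<Longrightarrow> \<bar>\<phi> t\<bar> \<le> B * t powr b"
  shows "mellin_integrable \<phi> \<sigma>"
  unfolding mellin_integrable_def
proof (rule set_integrable_powr_bounds[where q = "1 - (a + \<sigma>)" and p = "1 - (b + \<sigma>)" and A = A and B = B])
  fix t :: real assume t: "0 < t" "t \<le> 1"
  have "\<bar>\<phi> t\<bar> * t powr (\<sigma> - 1) \<le> A * t powr a * t powr (\<sigma> - 1)" using A t by (intro mult_right_mono) auto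
  also have "\<dots> = A * t powr - (1 - (a + \<sigma>))" by (simp add: algebra_simps flip: powr_add)
  finally show "norm (\<phi> t * t powr (\<sigma> - 1)) \<le> A * t powr - (1 - (a + \<sigma>))" by (simp add: abs_mult)
next
  fix t :: real assume t: "t \<ge> 1"
  have "\<bar>\<phi> t\<bar> * t powr (\<sigma> - 1) \<le> B * t powr b * t powr (\<sigma> - 1)" using B t by (intro mult_right_mono) auto
  also have "\<dots> = B * t powr - (1 - (b + \<sigma>))" by (simp add: algebra_simps flip: powr_add)
  finally show "norm (\<phi> t * t powr (\<sigma> - 1)) \<le> B * t powr - (1 - (b + \<sigma>))" by (simp add: abs_mult)
qed (use A B in auto)

lemma mellin_integrable_dominated:
  assumes [measurable]: "\<phi> \<in> borel_measurable borel" and "mellin_integrable \<psi> \<sigma>"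
    and le: "\<And>t. t > 0 \<Longrightarrow> \<bar>\<phi> t * t powr (\<tau> - 1)\<bar> \<le> \<bar>\<psi> t * t powr (\<sigma> - 1)\<bar>"
  shows "mellin_integrable \<phi> \<tau>"
  unfolding mellin_integrable_def
  by (rule set_integrable_bound[OF assms(2)[unfolded mellin_integrable_def]])
     (use le in \<open>auto simp: set_borel_measurable_def\<close>)

lemma norm_exp_minus_linear: "norm (exp z - 1 - z) \<le> (norm z)\<^sup>2 * exp (norm z)" for z :: complex
proof -
  have "norm (exp z - (\<Sum>i\<le>1. z ^ i / fact i)) \<le> exp \<bar>Re z\<bar> * norm z ^ Suc 1 / fact 1"
    by (rule Taylor_exp)
  also have "\<dots> = (norm z)\<^sup>2 * exp \<bar>Re z\<bar>" by (simp add: power2_eq_square)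
  also have "\<dots> \<le> (norm z)\<^sup>2 * exp (norm z)"
    using abs_Re_le_cmod[of z] by (intro mult_left_mono) auto
  finally show ?thesis by (simp add: algebra_simps)
qed

text \<open>Differentiation under the integral sign: t^w = exp (w ln t) is expanded to second order,
  and the remainder is dominated uniformly in small w. Integrability at the two abscissas Re s - d
  and Re s + d is enough, since t^(-d) + t^d dominates every logarithmic factor that occurs.\<close>

lemma mellin_field_differentiable:
  assumes [measurable]: "\<phi> \<in> borel_measurable borel" and d: "d > 0"
    and i: "mellin_integrable \<phi> (Re s - d)" "mellin_integrable \<phi> (Re s + d)"
  shows "mellin \<phi> field_differentiable (at s)"
proof -
  \<comment> \<open>One half of d is the range allowed for |w|, the other half absorbs the square of
    the logarithm.\<close>
  define e where "e = d / 2"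
  have e: "e > 0" using d by (simp add: e_def)
  \<comment> \<open>Majorant of the second order remainder divided by |w|^2. The factor 2 / e^2
    comes from (e |ln t|)^2 \<le> 2 exp (e |ln t|).\<close>
  define E where "E = (\<lambda>t. (2 / e\<^sup>2) * (\<bar>\<phi> t\<bar> * t powr (Re s - d - 1) + \<bar>\<phi> t\<bar> * t powr (Re s + d - 1)))"
  have iE: "set_integrable lborel {0<..} E"
    unfolding E_def using i[unfolded mellin_integrable_def, THEN set_integrable_abs]
    by (intro set_integrable_mult_right set_integral_add(1)) (auto simp: abs_mult)
  have [measurable]: "E \<in> borel_measurable borel" unfolding E_def by measurable
  have E0: "E t \<ge> 0" for t by (simp add: E_def)
  have key: "(e * \<bar>ln t\<bar>)\<^sup>2 * exp (e * \<bar>ln t\<bar>) \<le> 2 * (t powr - d + t powr d)"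
            "e * \<bar>ln t\<bar> \<le> t powr - d + t powr d" "1 \<le> t powr - d + t powr d" if "t > 0" for t
  proof -
    define x where "x = e * \<bar>ln t\<bar>"
    have x: "x \<ge> 0" using e by (simp add: x_def)
    have "exp (2 * x) = exp (d * \<bar>ln t\<bar>)" by (simp add: x_def e_def)
    also have "\<dots> \<le> exp (- d * ln t) + exp (d * ln t)" by (cases "ln t \<ge> 0") (auto simp: abs_if)
    also have "\<dots> = t powr - d + t powr d" using that by (simp add: powr_def)
    finally have ex: "exp (2 * x) \<le> t powr - d + t powr d" .
    have "1 + x + x\<^sup>2 / 2 \<le> exp x" using exp_lower_Taylor_quadratic[OF x] .
    then have "x\<^sup>2 \<le> 2 * exp x" using x by linarith
    then have "x\<^sup>2 * exp x \<le> 2 * exp x * exp x" by (intro mult_right_mono) auto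
    also have "\<dots> = 2 * exp (2 * x)" by (simp flip: exp_add)
    finally show "(e * \<bar>ln t\<bar>)\<^sup>2 * exp (e * \<bar>ln t\<bar>) \<le> 2 * (t powr - d + t powr d)" using ex by (simp add: x_def)
    have "x \<le> exp (2 * x)" "1 \<le> exp (2 * x)" using exp_ge_add_one_self[of "2 * x"] x by linarith+
    then have "x \<le> t powr - d + t powr d" and "1 \<le> t powr - d + t powr d" using ex by linarith+
    then show "e * \<bar>ln t\<bar> \<le> t powr - d + t powr d" "1 \<le> t powr - d + t powr d" unfolding x_def .
  qed
  have mi: "mellin_integrable \<phi> \<sigma>" if "Re s - d \<le> \<sigma>" "\<sigma> \<le> Re s + d" for \<sigma>
  proof -
    have "set_integrable lborel {0<..} (\<lambda>t. \<bar>\<phi> t\<bar> * t powr (Re s - d - 1) + \<bar>\<phi> t\<bar> * t powr (Re s + d - 1))"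
      using i[unfolded mellin_integrable_def, THEN set_integrable_abs] by (intro set_integral_add(1)) (auto simp: abs_mult)
    then show ?thesis unfolding mellin_integrable_def
    proof (rule set_integrable_bound)
      show "AE t in lborel. t \<in> {0<..} \<longrightarrow> norm (\<phi> t * t powr (\<sigma> - 1)) \<le> norm (\<bar>\<phi> t\<bar> * t powr (Re s - d - 1) + \<bar>\<phi> t\<bar> * t powr (Re s + d - 1))"
      proof (intro AE_I2 impI)
        fix t :: real assume "t \<in> {0<..}"
        then have t: "t > 0" by simp
        have "t powr (\<sigma> - 1) \<le> t powr (Re s - d - 1) + t powr (Re s + d - 1)"
          using that t powr_mono[of "\<sigma> - 1" "Re s + d - 1" t] powr_mono'[of "Re s - d - 1" "\<sigma> - 1" t]
          by (cases "t \<ge> 1") (auto intro: add_increasing add_increasing2)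
        then have "\<bar>\<phi> t\<bar> * t powr (\<sigma> - 1) \<le> \<bar>\<phi> t\<bar> * (t powr (Re s - d - 1) + t powr (Re s + d - 1))"
          by (intro mult_left_mono) auto
        then show "norm (\<phi> t * t powr (\<sigma> - 1)) \<le> norm (\<bar>\<phi> t\<bar> * t powr (Re s - d - 1) + \<bar>\<phi> t\<bar> * t powr (Re s + d - 1))"
          by (simp add: abs_mult distrib_left)
      qed
    qed (auto simp: set_borel_measurable_def)
  qed
  define I where "I = (\<lambda>z t. of_real (\<phi> t) * of_real t powr (z - 1) :: complex)"
  have iI: "set_integrable lborel {0<..} (I z)" if "Re s - d \<le> Re z" "Re z \<le> Re s + d" for z
    unfolding I_def using mi[OF that] mellin_set_integrable_iff by auto
  define J where "J = (\<lambda>t. of_real (\<phi> t) * of_real t powr (s - 1) * of_real (ln t) :: complex)"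
  have shift: "\<bar>\<phi> t\<bar> * t powr (Re s - 1) * (t powr - d + t powr d) = (e\<^sup>2 / 2) * E t" if "t > 0" for t
    using e that by (simp add: E_def algebra_simps flip: powr_add)
  have iJ: "set_integrable lborel {0<..} J"
  proof (rule set_integrable_bound)
    show "set_integrable lborel {0<..} (\<lambda>t. (e / 2) * E t)" using iE by simp
    show "AE t in lborel. t \<in> {0<..} \<longrightarrow> norm (J t) \<le> norm ((e / 2) * E t)"
    proof (intro AE_I2 impI)
      fix t :: real assume "t \<in> {0<..}"
      then have t: "t > 0" by simp
      have "e * norm (J t) = \<bar>\<phi> t\<bar> * t powr (Re s - 1) * (e * \<bar>ln t\<bar>)"
        using t by (simp add: J_def norm_mult norm_powr_real_powr)
      also have "\<dots> \<le> \<bar>\<phi> t\<bar> * t powr (Re s - 1) * (t powr - d + t powr d)"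
        using key(2)[OF t] by (intro mult_left_mono) auto
      also have "\<dots> = e * (e / 2 * E t)" using shift[OF t] by (simp add: power2_eq_square)
      finally have "norm (J t) \<le> e / 2 * E t" using e mult_le_cancel_left_pos by blast
      then show "norm (J t) \<le> norm ((e / 2) * E t)" by simp
    qed
  qed (auto simp: set_borel_measurable_def J_def)
  define D where "D = (LINT t:{0<..}|lborel. J t)"
  define K where "K = (LINT t:{0<..}|lborel. E t)"
  have bound: "norm (mellin \<phi> (s + w) - mellin \<phi> s - w * D) \<le> (norm w)\<^sup>2 * K" if w: "norm w \<le> e" for w
  proof -
    have wd: "\<bar>Re w\<bar> \<le> d" using abs_Re_le_cmod[of w] w e by (simp add: e_def)
    have i1: "set_integrable lborel {0<..} (\<lambda>t. I (s + w) t - I s t)"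
      using wd d by (intro set_integral_diff(1) iI) auto
    have i2: "set_integrable lborel {0<..} (\<lambda>t. I (s + w) t - I s t - w * J t)"
      by (intro set_integral_diff(1) i1 set_integrable_mult_right iJ)
    have "mellin \<phi> (s + w) - mellin \<phi> s - w * D = (LINT t:{0<..}|lborel. I (s + w) t - I s t - w * J t)"
      using wd d by (subst set_integral_diff(2)[OF i1], (intro set_integrable_mult_right iJ),
            subst set_integral_diff(2), (intro iI; simp), (intro iI; simp)) (simp add: mellin_def I_def D_def)
    also have "norm \<dots> \<le> (LINT t:{0<..}|lborel. norm (I (s + w) t - I s t - w * J t))"
      by (rule set_integral_norm_bound[OF i2])
    also have "\<dots> \<le> (LINT t:{0<..}|lborel. (norm w)\<^sup>2 * E t)"
    proof (rule set_integral_mono)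
      show "set_integrable lborel {0<..} (\<lambda>t. norm (I (s + w) t - I s t - w * J t))"
        using i2 by (rule set_integrable_norm)
      show "set_integrable lborel {0<..} (\<lambda>t. (norm w)\<^sup>2 * E t)" using iE by simp
      fix t :: real assume "t \<in> {0<..}"
      then have t: "t > 0" by simp
      define z where "z = w * of_real (ln t)"
      have pw: "complex_of_real t powr (s + w - 1) = of_real t powr (s - 1) * exp z"
        using t by (simp add: powr_def z_def Ln_of_real algebra_simps flip: exp_add)
      have "I (s + w) t - I s t - w * J t = of_real (\<phi> t) * of_real t powr (s - 1) * (exp z - 1 - z)"
        by (simp add: I_def J_def pw z_def algebra_simps)
      then have "norm (I (s + w) t - I s t - w * J t) = \<bar>\<phi> t\<bar> * t powr (Re s - 1) * norm (exp z - 1 - z)"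
        using t by (simp add: norm_mult norm_powr_real_powr)
      also have "\<dots> \<le> \<bar>\<phi> t\<bar> * t powr (Re s - 1) * ((norm z)\<^sup>2 * exp (norm z))"
        by (intro mult_left_mono norm_exp_minus_linear) auto
      also have "\<dots> \<le> \<bar>\<phi> t\<bar> * t powr (Re s - 1) * ((norm w)\<^sup>2 * (2 / e\<^sup>2 * (t powr - d + t powr d)))"
      proof (intro mult_left_mono)
        have nz: "norm z = norm w * \<bar>ln t\<bar>" by (simp add: z_def norm_mult)
        have "(norm z)\<^sup>2 * exp (norm z) \<le> (norm w)\<^sup>2 * \<bar>ln t\<bar>\<^sup>2 * exp (e * \<bar>ln t\<bar>)"
          unfolding nz using w by (intro mult_mono) (auto simp: power_mult_distrib mult_right_mono)
        also have "\<dots> = (norm w)\<^sup>2 / e\<^sup>2 * ((e * \<bar>ln t\<bar>)\<^sup>2 * exp (e * \<bar>ln t\<bar>))"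
          using e by (simp add: power_mult_distrib)
        also have "\<dots> \<le> (norm w)\<^sup>2 / e\<^sup>2 * (2 * (t powr - d + t powr d))"
          using key(1)[OF t] by (intro mult_left_mono) auto
        finally show "(norm z)\<^sup>2 * exp (norm z) \<le> (norm w)\<^sup>2 * (2 / e\<^sup>2 * (t powr - d + t powr d))" by simp
      qed auto
      also have "\<dots> = (norm w)\<^sup>2 * (2 / e\<^sup>2) * (\<bar>\<phi> t\<bar> * t powr (Re s - 1) * (t powr - d + t powr d))"
        by (simp add: mult_ac)
      also have "\<dots> = (norm w)\<^sup>2 * E t" unfolding shift[OF t] using e by simp
      finally show "norm (I (s + w) t - I s t - w * J t) \<le> (norm w)\<^sup>2 * E t" .
    qed
    also have "\<dots> = (norm w)\<^sup>2 * K" by (simp add: K_def)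
    finally show ?thesis .
  qed
  have "(\<lambda>w. (mellin \<phi> (s + w) - mellin \<phi> s) / w - D) \<midarrow>0\<rightarrow> 0"
  proof (rule Lim_null_comparison)
    show "\<forall>\<^sub>F w in at 0. norm ((mellin \<phi> (s + w) - mellin \<phi> s) / w - D) \<le> norm w * K"
      unfolding eventually_at
    proof (intro exI[of _ e] conjI ballI impI e)
      fix w :: complex assume w: "w \<noteq> 0 \<and> dist w 0 < e"
      have "(mellin \<phi> (s + w) - mellin \<phi> s) / w - D = (mellin \<phi> (s + w) - mellin \<phi> s - w * D) / w"
        using w by (simp add: field_simps)
      also have "norm \<dots> \<le> (norm w)\<^sup>2 * K / norm w"
        unfolding norm_divide using bound[of w] w by (intro divide_right_mono) auto
      also have "\<dots> = norm w * K" using w by (simp add: power2_eq_square)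
      finally show "norm ((mellin \<phi> (s + w) - mellin \<phi> s) / w - D) \<le> norm w * K" .
    qed
    have "((\<lambda>w::complex. norm w * K) \<longlongrightarrow> norm (0::complex) * K) (at 0)" by (intro tendsto_intros)
    then show "((\<lambda>w::complex. norm w * K) \<longlongrightarrow> 0) (at 0)" by simp
  qed
  then have "(\<lambda>w. (mellin \<phi> (s + w) - mellin \<phi> s) / w) \<midarrow>0\<rightarrow> D" by (simp add: LIM_zero_iff)
  then have "(mellin \<phi> has_field_derivative D) (at s)" by (simp add: DERIV_def)
  then show ?thesis by (auto simp: field_differentiable_def)
qed

lemma mellin_holomorphic:
  assumes "\<phi> \<in> borel_measurable borel" "open S" "\<And>s. s \<in> S \<Longrightarrow> \<exists>d>0. mellin_integrable \<phi> (Re s - d) \<and> mellin_integrable \<phi> (Re s + d)"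
  shows "mellin \<phi> holomorphic_on S"
  unfolding holomorphic_on_def
  using mellin_field_differentiable assms field_differentiable_at_within by blast

lemma mellin_scale:
  assumes "l > 0" and [measurable]: "\<phi> \<in> borel_measurable borel"
  shows "mellin_integrable (\<lambda>t. \<phi> (l * t)) \<sigma> \<longleftrightarrow> mellin_integrable \<phi> \<sigma>"
    "mellin (\<lambda>t. \<phi> (l * t)) s = of_real l powr (- s) * mellin \<phi> s"
proof -
  have S: "l * x \<in> {0<..} \<longleftrightarrow> x \<in> {0<..}" for x using assms by (simp add: zero_less_mult_iff)
  have e: "\<phi> (l * t) * t powr (\<sigma> - 1) = l powr (1 - \<sigma>) * (\<phi> (l * t) * (l * t) powr (\<sigma> - 1))" if "t \<in> {0<..}" for t
  proof -
    have "(l * t) powr (\<sigma> - 1) = l powr (\<sigma> - 1) * t powr (\<sigma> - 1)" using assms that by (simp add: powr_mult)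
    then have "l powr (1 - \<sigma>) * (\<phi> (l * t) * (l * t) powr (\<sigma> - 1)) = (l powr (1 - \<sigma>) * l powr (\<sigma> - 1)) * (\<phi> (l * t) * t powr (\<sigma> - 1))"
      by (simp only: mult_ac)
    moreover have "l powr (1 - \<sigma>) * l powr (\<sigma> - 1) = 1" using assms by (simp flip: powr_add)
    ultimately show ?thesis by (simp only: mult_1)
  qed
  have "mellin_integrable (\<lambda>t. \<phi> (l * t)) \<sigma> \<longleftrightarrow> set_integrable lborel {0<..} (\<lambda>t. l powr (1 - \<sigma>) * (\<phi> (l * t) * (l * t) powr (\<sigma> - 1)))"
    unfolding mellin_integrable_def by (intro set_integrable_cong refl e) auto
  also have "\<dots> \<longleftrightarrow> set_integrable lborel {0<..} (\<lambda>t. (\<phi> (l * t) * (l * t) powr (\<sigma> - 1)))"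
    using assms by (simp add: set_integrable_mult_right_iff)
  also have "\<dots> \<longleftrightarrow> mellin_integrable \<phi> \<sigma>"
    unfolding mellin_integrable_def using set_integrable_lborel_scale[OF assms(1) S, of "\<lambda>t. \<phi> t * t powr (\<sigma> - 1)"] by simp
  finally show "mellin_integrable (\<lambda>t. \<phi> (l * t)) \<sigma> \<longleftrightarrow> mellin_integrable \<phi> \<sigma>" .
  have e: "of_real (\<phi> (l * t)) * complex_of_real t powr (s - 1)
      = of_real l powr (1 - s) * (of_real (\<phi> (l * t)) * of_real (l * t) powr (s - 1))" if "t \<in> {0<..}" for t
  proof -
    have "complex_of_real (l * t) powr (s - 1) = of_real l powr (s - 1) * of_real t powr (s - 1)"
      using assms that powr_times_real[of "of_real l" "of_real t" "s - 1"] by simp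
    then have "of_real l powr (1 - s) * (of_real (\<phi> (l * t)) * of_real (l * t) powr (s - 1))
       = (complex_of_real l powr (1 - s) * of_real l powr (s - 1)) * (of_real (\<phi> (l * t)) * of_real t powr (s - 1))"
      by (simp only: mult_ac)
    moreover have "complex_of_real l powr (1 - s) * of_real l powr (s - 1) = 1" using assms by (simp flip: powr_add)
    ultimately show ?thesis by (simp only: mult_1)
  qed
  have "mellin (\<lambda>t. \<phi> (l * t)) s = (LINT t:{0<..}|lborel. of_real l powr (1 - s) * (of_real (\<phi> (l * t)) * of_real (l * t) powr (s - 1)))"
    unfolding mellin_def by (rule set_lebesgue_integral_cong) (use e in auto)
  also have "\<dots> = of_real l powr (1 - s) * ((1 / l) *\<^sub>R mellin \<phi> s)"
    unfolding mellin_def set_integral_mult_right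
    by (subst set_integral_lborel_scale[OF assms(1) S, symmetric]) simp
  also have "\<dots> = of_real l powr (- s) * mellin \<phi> s"
  proof -
    have "complex_of_real l powr (1 - s) = of_real l * of_real l powr (- s)"
      using assms powr_add[of "complex_of_real l" 1 "- s"] by simp
    then show ?thesis using assms by (simp add: scaleR_conv_of_real)
  qed
  finally show "mellin (\<lambda>t. \<phi> (l * t)) s = of_real l powr (- s) * mellin \<phi> s" .
qed

text \<open>A series of dilates becomes a Dirichlet series times a single transform; this is applied
  to psi, to T and to h. Nonnegativity of \<phi> makes the assumed pointwise convergence absolute,
  as termwise integration requires.\<close>

lemma mellin_sum:
  fixes w l :: "nat \<Rightarrow> real"
  assumes [measurable]: "\<phi> \<in> borel_measurable borel" "F \<in> borel_measurable borel"
    and i: "mellin_integrable \<phi> (Re s)"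
    and pos: "\<And>n. l n > 0" "\<And>n. w n \<ge> 0"
    and sm: "summable (\<lambda>n. w n * l n powr (- Re s))"
    and F: "\<And>t. t > 0 \<Longrightarrow> (\<lambda>n. w n * \<phi> (l n * t)) sums F t"
    and nn: "\<And>t. t > 0 \<Longrightarrow> \<phi> t \<ge> 0"
  shows "mellin_integrable F (Re s)"
    "mellin F s = (\<Sum>n. of_real (w n) * of_real (l n) powr (- s)) * mellin \<phi> s"
proof -
  define g where "g = (\<lambda>n t. indicator {0<..} t *\<^sub>R (of_real (w n) * (of_real (\<phi> (l n * t)) * complex_of_real t powr (s - 1))))"
  have gi: "integrable lborel (g n)" for n
    using mellin_scale(1)[OF pos(1), of \<phi>] i mellin_set_integrable_iff[of "\<lambda>t. \<phi> (l n * t)" s]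
    unfolding g_def by (subst set_integrable_def[symmetric], intro set_integrable_mult_right) auto
  have gI: "integral\<^sup>L lborel (g n) = of_real (w n) * of_real (l n) powr (- s) * mellin \<phi> s" for n
    using mellin_scale(2)[OF pos(1), of \<phi> n s]
    unfolding g_def by (subst set_lebesgue_integral_def[symmetric], subst set_integral_mult_right) (simp add: mellin_def)
  define N where "N = (LINT t:{0<..}|lborel. \<bar>\<phi> t\<bar> * t powr (Re s - 1))"
  have ng: "integral\<^sup>L lborel (\<lambda>t. norm (g n t)) = w n * l n powr (- Re s) * N" for n
  proof -
    have "integral\<^sup>L lborel (\<lambda>t. norm (g n t)) = (LINT t:{0<..}|lborel. w n * (\<bar>\<phi> (l n * t)\<bar> * t powr (Re s - 1)))"
      unfolding set_lebesgue_integral_def g_def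
      by (intro Bochner_Integration.integral_cong refl) (auto simp: indicator_def norm_mult norm_powr_real_powr pos)
    also have "\<dots> = w n * (LINT t:{0<..}|lborel. \<bar>\<phi> (l n * t)\<bar> * t powr (Re s - 1))" by simp
    \<comment> \<open>The scaling rule concerns the complex transform, so the real integral is read
      off from the transform of |\<phi>| at the real point Re s.\<close>
    also have "complex_of_real (LINT t:{0<..}|lborel. \<bar>\<phi> (l n * t)\<bar> * t powr (Re s - 1)) = of_real (l n powr (- Re s) * N)"
      using mellin_scale(2)[OF pos(1)[of n], of "\<lambda>t. \<bar>\<phi> t\<bar>" "of_real (Re s)"] powr_of_real[of "l n" "- Re s"] pos(1)[of n]
      unfolding mellin_of_real N_def by simp
    then have "(LINT t:{0<..}|lborel. \<bar>\<phi> (l n * t)\<bar> * t powr (Re s - 1)) = l n powr (- Re s) * N"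
      unfolding of_real_eq_iff .
    finally show ?thesis by simp
  qed
  have AEs: "AE t in lborel. summable (\<lambda>n. norm (g n t))"
  proof (intro AE_I2)
    fix t :: real
    show "summable (\<lambda>n. norm (g n t))"
    proof (cases "t > 0")
      case True
      have "norm (g n t) = w n * \<phi> (l n * t) * t powr (Re s - 1)" for n
        using True pos nn[of "l n * t"] by (simp add: g_def norm_mult norm_powr_real_powr)
      then show ?thesis using F[OF True] by (simp add: sums_iff summable_mult2)
    qed (simp add: g_def)
  qed
  have sn: "summable (\<lambda>n. integral\<^sup>L lborel (\<lambda>t. norm (g n t)))"
    unfolding ng by (intro summable_mult2 sm)
  have Fe: "indicator {0<..} t *\<^sub>R (of_real (F t) * complex_of_real t powr (s - 1)) = (\<Sum>n. g n t)" for t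
  proof (cases "t > 0")
    case True
    have "(\<lambda>n. complex_of_real (w n * \<phi> (l n * t)) * of_real t powr (s - 1)) sums (of_real (F t) * of_real t powr (s - 1))"
      by (intro sums_mult2 sums_of_real F True)
    then show ?thesis using True by (simp add: sums_iff g_def mult.assoc)
  qed (simp add: g_def)
  have "integrable lborel (\<lambda>t. \<Sum>n. g n t)" by (rule integrable_suminf[OF gi AEs sn])
  then have "set_integrable lborel {0<..} (\<lambda>t. of_real (F t) * complex_of_real t powr (s - 1))"
    unfolding set_integrable_def Fe .
  then show "mellin_integrable F (Re s)" by (simp add: mellin_set_integrable_iff)
  have "mellin F s = (\<Sum>n. integral\<^sup>L lborel (g n))"
    unfolding mellin_def set_lebesgue_integral_def Fe by (rule integral_suminf[OF gi AEs sn])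
  also have "\<dots> = (\<Sum>n. of_real (w n) * of_real (l n) powr (- s)) * mellin \<phi> s"
  proof -
    have "summable (\<lambda>n. norm (of_real (w n) * complex_of_real (l n) powr (- s)))"
    proof -
      have "norm (of_real (w n) * complex_of_real (l n) powr (- s)) = w n * l n powr (- Re s)" for n
        unfolding norm_mult using pos[of n] by (subst norm_powr_real_powr) auto
      with sm show ?thesis by presburger
    qed
    then show ?thesis unfolding gI by (rule suminf_mult2[OF summable_norm_cancel, symmetric])
  qed
  finally show "mellin F s = (\<Sum>n. of_real (w n) * of_real (l n) powr (- s)) * mellin \<phi> s" .
qed

section \<open>The zeta function as a Mellin transform\<close>

text \<open>The identity theorem, applied at the midpoint, where the segment accumulates. The
  conclusion is about a punctured neighbourhood because \<open>meromorphic_on\<close> leaves the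
  values at singular points arbitrary.\<close>

lemma meromorphic_eq_on_segment:
  fixes F G :: "complex \<Rightarrow> complex"
  assumes F: "F meromorphic_on S" and G: "G meromorphic_on S" and S: "open S" "connected S"
    and ab: "a < b" and eq: "\<And>x. a < x \<Longrightarrow> x < b \<Longrightarrow> of_real x \<in> S \<and> F (of_real x) = G (of_real x)"
    and z: "z \<in> S"
  shows "\<forall>\<^sub>F w in at z. F w = G w"
proof -
  define D where "D = (\<lambda>z. F z - G z)"
  have mD: "D meromorphic_on S" unfolding D_def by (intro meromorphic_intros F G)
  define c where "c = (a + b) / 2"
  have c: "a < c" "c < b" using ab by (auto simp: c_def)
  have cS: "complex_of_real c \<in> S" using eq c by auto
  have ev: "\<forall>\<^sub>F w in at w0. remove_sings D w = D w" if "w0 \<in> S" for w0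
    using that by (intro eventually_remove_sings_eq_at meromorphic_on_isolated_singularity meromorphic_on_subset[OF mD]) auto
  have "\<exists>\<^sub>F w in at (complex_of_real c). D w = 0"
    unfolding frequently_at
  proof (intro allI impI)
    fix e :: real assume e: "e > 0"
    define x where "x = c + min (e / 2) ((b - c) / 2)"
    have x: "c < x" "x < b" "\<bar>x - c\<bar> < e" using e c by (auto simp: x_def min_def field_simps)
    then have "D (of_real x) = 0" using eq[of x] c by (simp add: D_def)
    moreover have "dist (complex_of_real x) (of_real c) < e" using x(3) by (simp add: dist_norm flip: of_real_diff)
    ultimately show "\<exists>x\<in>UNIV. x \<noteq> of_real c \<and> dist x (complex_of_real c) < e \<and> D x = 0"
      using x(1) by (intro bexI[of _ "of_real x"]) auto
  qed
  then have "\<exists>\<^sub>F w in at (complex_of_real c). remove_sings D w = 0"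
    by (rule frequently_rev_mp) (use ev[OF cS] in \<open>auto elim!: eventually_mono\<close>)
  then have R: "remove_sings D w = 0" if "w \<in> S" for w
    using frequently_eq_meromorphic_imp_constant[OF _ remove_sings_nicely_meromorphic[OF mD] S cS] that by blast
  have "\<forall>\<^sub>F w in at z. w \<in> S" using S(1) z by (intro eventually_at_in_open') auto
  then show ?thesis using ev[OF z]
    by eventually_elim (use R in \<open>auto simp: D_def\<close>)
qed

text \<open>This fills the puncture: continuity of H excludes a pole of F, and away from its poles a
  nicely meromorphic function equals its limit.\<close>

lemma nicely_meromorphic_value:
  assumes F: "F nicely_meromorphic_on UNIV" and ev: "\<forall>\<^sub>F w in at z. F w = H w" and H: "isCont H z"
  shows "F z = H z" "F analytic_on {z}" "\<forall>\<^sub>F w in nhds z. F w = H w"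
proof -
  have lim: "F \<midarrow>z\<rightarrow> H z"
    using H ev unfolding isCont_def by (metis (mono_tags, lifting) tendsto_cong)
  then have np: "\<not> is_pole F z"
    unfolding is_pole_def using not_tendsto_and_filterlim_at_infinity trivial_limit_at by blast
  then have "F \<midarrow>z\<rightarrow> F z" using F unfolding nicely_meromorphic_on_def by blast
  then show v: "F z = H z" using lim LIM_unique by blast
  show "F analytic_on {z}" by (rule nicely_meromorphic_on_imp_analytic_at[OF F _ np]) simp
  show "\<forall>\<^sub>F w in nhds z. F w = H w"
    using ev v by (auto simp: eventually_at_filter elim!: eventually_mono)
qed

context decaying begin

lemma f_mellin_integrable:
  assumes "\<sigma> > 0"
  shows "mellin_integrable (f n) \<sigma>"
proof -
  obtain A where A: "\<And>x. x \<ge> 0 \<Longrightarrow> x powr 0 * \<bar>f n x\<bar> \<le> A" by (rule f_powr_bound[of 0 n]) auto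
  have p: "\<sigma> + 1 \<ge> 0" using assms by simp
  obtain B where B: "\<And>x y. 0 < y \<Longrightarrow> y \<le> x \<Longrightarrow> \<bar>f n x\<bar> \<le> B * y powr - (\<sigma> + 1)"
    by (rule f_inverse_powr_bound[OF p, of n]) blast
  show ?thesis
  proof (rule mellin_integrable_powr_bounds[where a = 0 and A = A and b = "- (\<sigma> + 1)" and B = B])
    fix t :: real assume "0 < t" "t \<le> 1"
    then show "\<bar>f n t\<bar> \<le> A * t powr 0" using A[of t] by simp
  next
    fix t :: real assume "t \<ge> 1"
    then show "\<bar>f n t\<bar> \<le> B * t powr - (\<sigma> + 1)" by (intro B) auto
  qed (use assms in auto)
qed

text \<open>The boundary terms vanish, at 0 because f is bounded and Re s > 0, at infinity by rapid
  decay.\<close>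

lemma mellin_by_parts:
  assumes "Re s > 0"
  shows "s * mellin (f n) s = - mellin (f (Suc n)) (s + 1)"
proof -
  define I where "I = (\<lambda>t. of_real (f (Suc n) t) * complex_of_real t powr (s + 1 - 1))"
  define J where "J = (\<lambda>t. of_real (f n t) * complex_of_real t powr (s - 1))"
  have i: "set_integrable lborel {0<..} I" "set_integrable lborel {0<..} J"
    unfolding I_def J_def using assms by (subst mellin_set_integrable_iff; auto intro!: f_mellin_integrable)+
  have i': "set_integrable lborel {0<..} (\<lambda>t. I t + s * J t)"
    by (intro set_integral_add(1) i set_integrable_mult_right)
  have dp: "((\<lambda>t. complex_of_real t powr s) has_vector_derivative s * complex_of_real t powr (s - 1)) (at t)" if "t > 0" for t
  proof -
    have "((\<lambda>z. z powr s) has_field_derivative s * complex_of_real t powr (s - 1)) (at (of_real t))"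
      using that by (intro has_field_derivative_powr) (auto simp: complex_nonpos_Reals_iff)
    from field_vector_diff_chain_at[OF has_vector_derivative_of_real[OF DERIV_ident] this]
    show ?thesis by (simp add: o_def)
  qed
  have "(LBINT t=ereal 0..\<infinity>. I t + s * J t) = 0 - 0"
  proof (rule interval_integral_FTC_integrable[where F = "\<lambda>t. of_real (f n t) * complex_of_real t powr s"])
    fix t :: real assume "ereal 0 < ereal t"
    then have t: "t > 0" by simp
    have "((\<lambda>t. complex_of_real (f n t)) has_vector_derivative of_real (f (Suc n) t)) (at t)"
      using f_deriv[of n t] by (rule has_vector_derivative_of_real)
    from has_vector_derivative_mult[OF this dp[OF t]]
    show "((\<lambda>t. of_real (f n t) * complex_of_real t powr s) has_vector_derivative I t + s * J t) (at t)"
      by (simp add: I_def J_def algebra_simps)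
    have "isCont (\<lambda>t. complex_of_real t powr a) t" for a
      using t by (intro continuous_intros) (auto simp: complex_nonpos_Reals_iff)
    moreover have "isCont (\<lambda>t. complex_of_real (f m t)) t" for m
      using f_deriv by (intro continuous_intros DERIV_isCont)
    ultimately show "isCont (\<lambda>t. I t + s * J t) t"
      unfolding I_def J_def by (intro continuous_add continuous_mult continuous_const)
  next
    show "set_integrable lborel (einterval (ereal 0) \<infinity>) (\<lambda>t. I t + s * J t)" using i' by simp
    have nrm: "norm (of_real (f n t) * complex_of_real t powr s) = \<bar>f n t\<bar> * t powr Re s" if "t > 0" for t
      using that by (simp add: norm_mult norm_powr_real_powr)
    obtain A where A: "\<And>x. x \<ge> 0 \<Longrightarrow> x powr 0 * \<bar>f n x\<bar> \<le> A" by (rule f_powr_bound[of 0 n]) auto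
    have A': "\<bar>f n x\<bar> \<le> A" if "x > 0" for x using A[of x] that by simp
    have p: "Re s + 1 \<ge> 0" using assms by simp
    obtain B where B: "\<And>x. x \<ge> 0 \<Longrightarrow> x powr (Re s + 1) * \<bar>f n x\<bar> \<le> B"
      by (rule f_powr_bound[OF p, of n]) blast
    have "((\<lambda>t. of_real (f n t) * complex_of_real t powr s) \<longlongrightarrow> 0) (at_right 0)"
    proof (rule Lim_null_comparison)
      show "((\<lambda>t. A * t powr Re s) \<longlongrightarrow> 0) (at_right 0)" using assms by real_asymp
      show "\<forall>\<^sub>F t in at_right 0. norm (of_real (f n t) * complex_of_real t powr s) \<le> A * t powr Re s"
        unfolding eventually_at_filter
        using nrm A' by (intro always_eventually) (auto intro!: mult_right_mono)
    qed
    then show "(((\<lambda>t. of_real (f n t) * complex_of_real t powr s) \<circ> real_of_ereal) \<longlongrightarrow> 0) (at_right (ereal 0))"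
      by (simp add: ereal_tendsto_simps1)
    have "((\<lambda>t. of_real (f n t) * complex_of_real t powr s) \<longlongrightarrow> 0) at_top"
    proof (rule Lim_null_comparison)
      show "((\<lambda>t. B / t) \<longlongrightarrow> 0) at_top" by real_asymp
      show "\<forall>\<^sub>F t in at_top. norm (of_real (f n t) * complex_of_real t powr s) \<le> B / t"
        using eventually_gt_at_top[of 0]
      proof eventually_elim
        case (elim t)
        have "t * (\<bar>f n t\<bar> * t powr Re s) \<le> B" using B[of t] elim by (simp add: powr_add mult_ac)
        then show ?case using elim by (simp add: nrm field_simps)
      qed
    qed
    then show "(((\<lambda>t. of_real (f n t) * complex_of_real t powr s) \<circ> real_of_ereal) \<longlongrightarrow> 0) (at_left \<infinity>)"
      by (simp add: ereal_tendsto_simps1)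
  qed simp
  then have "(LINT t:{0<..}|lborel. I t + s * J t) = 0"
    by (simp add: interval_lebesgue_integral_def)
  then have "(LINT t:{0<..}|lborel. I t) + s * (LINT t:{0<..}|lborel. J t) = 0"
    by (subst (asm) set_integral_add(2)) (use i in auto)
  then show ?thesis
    by (simp add: I_def J_def mellin_def eq_neg_iff_add_eq_0 add.commute)
qed

text \<open>The outcome of n integrations by parts. It is meaningful for Re s > - n, with possible
  poles only at the zeros of the Pochhammer symbol.\<close>

definition mellin_shift :: "nat \<Rightarrow> complex \<Rightarrow> complex" where
  "mellin_shift n s = (-1) ^ n * mellin (f n) (s + of_nat n) / pochhammer s n"

text \<open>The number of integrations by parts grows with |Re s|. By \<open>mellin_cont_eq\<close>
  any sufficiently large number gives the same value, so locally one fixed n serves, which yields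
  meromorphy.\<close>

definition mellin_cont :: "complex \<Rightarrow> complex" where
  "mellin_cont s = mellin_shift (nat \<lceil>\<bar>Re s\<bar>\<rceil> + 1) s"

lemma mellin_shift_eq:
  assumes "Re s > - real m" "m \<le> n"
  shows "mellin_shift n s = mellin_shift m s"
  using assms(2)
proof (induction rule: dec_induct)
  case (step n)
  have re: "Re (s + of_nat n) > 0" using assms(1) step.hyps by simp
  then have nz: "s + of_nat n \<noteq> 0" by (metis less_irrefl zero_complex.simps(1))
  have "mellin (f (Suc n)) (s + of_nat (Suc n)) = - ((s + of_nat n) * mellin (f n) (s + of_nat n))"
    using mellin_by_parts[OF re, of n] by (simp add: add_ac)
  then have "mellin_shift (Suc n) s = mellin_shift n s"
    using nz by (simp add: mellin_shift_def pochhammer_Suc)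
  then show ?case using step.IH by simp
qed simp

lemma mellin_cont_eq:
  assumes "Re s > - real n"
  shows "mellin_cont s = mellin_shift n s"
proof -
  define m where "m = nat \<lceil>\<bar>Re s\<bar>\<rceil> + 1"
  have "Re s > - real m" unfolding m_def by linarith
  then show ?thesis
    unfolding mellin_cont_def m_def[symmetric]
    using mellin_shift_eq[of m s n] mellin_shift_eq[of n s m] assms by (cases "m \<le> n") auto
qed

lemma mellin_cont_eq_mellin: "Re s > 0 \<Longrightarrow> mellin_cont s = mellin (f 0) s"
  using mellin_cont_eq[of 0 s] by (simp add: mellin_shift_def)

lemma mellin_f_holomorphic: "mellin (f n) holomorphic_on {s. Re s > 0}"
proof (rule mellin_holomorphic)
  fix s assume "s \<in> {s. Re s > 0}"
  then show "\<exists>d>0. mellin_integrable (f n) (Re s - d) \<and> mellin_integrable (f n) (Re s + d)"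
    by (intro exI[of _ "Re s / 2"]) (auto intro!: f_mellin_integrable)
qed (auto simp: open_halfspace_Re_gt)

lemma mellin_cont_meromorphic: "mellin_cont meromorphic_on UNIV"
  unfolding meromorphic_on_meromorphic_at[of _ UNIV]
proof
  fix z :: complex
  define n where "n = nat \<lceil>\<bar>Re z\<bar>\<rceil> + 1"
  have n: "Re z > - real n" unfolding n_def by linarith
  have op: "open {s. Re s > - real n}" by (rule open_halfspace_Re_gt)
  have "mellin_shift n meromorphic_on {z}"
    unfolding mellin_shift_def[abs_def]
  proof (intro meromorphic_on_divide meromorphic_on_mult meromorphic_on_const)
    have "(\<lambda>s. mellin (f n) (s + of_nat n)) holomorphic_on {s. Re s > - real n}"
      by (rule holomorphic_on_compose_gen[OF _ mellin_f_holomorphic, unfolded o_def]) (auto intro!: holomorphic_intros)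
    then show "(\<lambda>s. mellin (f n) (s + of_nat n)) meromorphic_on {z}"
      using op n by (intro analytic_on_imp_meromorphic_on holomorphic_on_imp_analytic_at) auto
    show "(\<lambda>s. pochhammer s n) meromorphic_on {z}"
      by (intro analytic_on_imp_meromorphic_on holomorphic_on_imp_analytic_at[of _ UNIV] holomorphic_intros) auto
  qed
  moreover have "\<forall>\<^sub>F w in at z. w \<in> {s. Re s > - real n}"
    using op n by (intro eventually_at_in_open') auto
  then have "\<forall>\<^sub>F w in at z. mellin_cont w = mellin_shift n w"
    by eventually_elim (simp add: mellin_cont_eq)
  ultimately show "mellin_cont meromorphic_on {z}"
    by (subst meromorphic_on_cong[of "{z}" _ "mellin_shift n"]) auto
qed

end

definition dirichlet_zeta :: "complex \<Rightarrow> complex" where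
  "dirichlet_zeta s = (\<Sum>n. of_nat (Suc n) powr - s)"

text \<open>Expand e^t / (e^t - 1)^2 as the sum of n e^(-n t) and write n t^2 = (n t)^2 / n: psi is
  a weighted sum of dilates of t^2 e^(-t).\<close>

lemma bose_sums:
  assumes "t > 0"
  shows "(\<lambda>n. 1 / real (Suc n) * ((real (Suc n) * t)\<^sup>2 * exp (- (real (Suc n) * t)))) sums bose 0 t"
proof -
  define x where "x = exp (- t)"
  have x: "0 < x" "x < 1" using assms by (simp_all add: x_def)
  have "(\<lambda>n. t\<^sup>2 * x * (of_nat (Suc n) * x ^ n)) sums (t\<^sup>2 * x * (1 / (1 - x)\<^sup>2))"
    using geometric_deriv_sums[of x] x by (intro sums_mult) auto
  moreover have "t\<^sup>2 * x * (of_nat (Suc n) * x ^ n) = 1 / real (Suc n) * ((real (Suc n) * t)\<^sup>2 * exp (- (real (Suc n) * t)))" for n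
  proof -
    have "exp (- (real (Suc n) * t)) = x * x ^ n"
      unfolding x_def by (simp add: algebra_simps exp_of_nat_mult[symmetric] flip: exp_add)
    then show ?thesis by (simp add: power2_eq_square field_simps del: of_nat_Suc)
  qed
  moreover have "t\<^sup>2 * x * (1 / (1 - x)\<^sup>2) = bose 0 t"
  proof -
    have "exp t = 1 / x" by (simp add: x_def exp_minus inverse_eq_divide)
    then show ?thesis using assms x by (simp add: bose_0 power2_eq_square divide_simps) (simp add: algebra_simps)
  qed
  ultimately show ?thesis by simp
qed

lemma mellin_gamma_kernel:
  assumes "Re s > 0"
  shows "mellin_integrable (\<lambda>t. t\<^sup>2 * exp (- t)) (Re s)" "mellin (\<lambda>t. t\<^sup>2 * exp (- t)) s = Gamma (s + 2)"
proof -
  have e: "of_real (t\<^sup>2 * exp (- t)) * complex_of_real t powr (s - 1) = of_real t powr (s + 2 - 1) / of_real (exp t)" if "t > 0" for t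
  proof -
    have "s + 2 - 1 = 2 + (s - 1)" by simp
    then have "complex_of_real t powr (s + 2 - 1) = complex_of_real t powr 2 * complex_of_real t powr (s - 1)"
      by (simp only: powr_add)
    also have "complex_of_real t powr 2 = of_real (t\<^sup>2)" using that by (simp add: powr_numeral)
    finally show ?thesis by (simp add: exp_minus divide_inverse)
  qed
  have a: "(\<lambda>t. complex_of_real t powr (s + 2 - 1) / of_real (exp t)) absolutely_integrable_on {0<..}"
    using assms by (intro absolutely_integrable_Gamma_integral') auto
  then have i: "set_integrable lborel {0<..} (\<lambda>t. complex_of_real t powr (s + 2 - 1) / of_real (exp t))"
    by (simp add: set_integrable_def integrable_completion)
  then have i': "set_integrable lborel {0<..} (\<lambda>t. of_real (t\<^sup>2 * exp (- t)) * complex_of_real t powr (s - 1))"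
    by (subst set_integrable_cong[OF refl refl e]) auto
  then show "mellin_integrable (\<lambda>t. t\<^sup>2 * exp (- t)) (Re s)" by (subst (asm) mellin_set_integrable_iff) auto
  have "mellin (\<lambda>t. t\<^sup>2 * exp (- t)) s = (LINT t:{0<..}|lborel. complex_of_real t powr (s + 2 - 1) / of_real (exp t))"
    unfolding mellin_def by (rule set_lebesgue_integral_cong) (use e in auto)
  also have "\<dots> = Gamma (s + 2)"
    using set_lborel_to_absolutely_integrable(2)[OF i] Gamma_integral_complex'[of "s + 2"] assms
    by (simp add: integral_unique)
  finally show "mellin (\<lambda>t. t\<^sup>2 * exp (- t)) s = Gamma (s + 2)" .
qed

text \<open>The weight 1/n and the dilation by n contribute n^(-1) n^(-s), hence the argument s +
  1.\<close>

lemma mellin_bose: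
  assumes "Re s > 0"
  shows "mellin (bose 0) s = dirichlet_zeta (s + 1) * Gamma (s + 2)"
proof -
  have pw: "1 / real (Suc n) * real (Suc n) powr - Re s = real (Suc n) powr - (Re s + 1)" for n
    by (simp add: powr_diff powr_minus_divide powr_add)
  have "mellin (bose 0) s = (\<Sum>n. of_real (1 / real (Suc n)) * of_real (real (Suc n)) powr (- s)) * mellin (\<lambda>t. t\<^sup>2 * exp (- t)) s"
  proof (rule mellin_sum(2))
    show "summable (\<lambda>n. 1 / real (Suc n) * real (Suc n) powr - Re s)"
      unfolding pw using assms by (intro summable_Suc_powr) auto
    show "(\<lambda>n. 1 / real (Suc n) * ((real (Suc n) * t)\<^sup>2 * exp (- (real (Suc n) * t)))) sums bose 0 t" if "t > 0" for t
      by (rule bose_sums[OF that])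
  qed (use mellin_gamma_kernel[OF assms] in auto)
  moreover have "of_real (1 / real (Suc n)) * of_real (real (Suc n)) powr (- s) = of_nat (Suc n) powr - (s + 1)" for n
    using powr_add[of "of_nat (Suc n) :: complex" "- s" "-1"]
    by (simp add: powr_minus_divide[of _ 1] mult.commute del: of_nat_Suc)
  ultimately show ?thesis by (simp only: dirichlet_zeta_def mellin_gamma_kernel(2)[OF assms])
qed

text \<open>Solving \<open>mellin_bose\<close> for the Dirichlet series continues zeta as the
  continued transform of psi at s - 1 times the entire function 1 / Gamma (s + 1). Together with
  uniqueness this shows that the definite description \<open>zeta\<close> denotes the
  continuation.\<close>

lemma zeta_continuation: "is_meromorphic_continuation zeta (\<lambda>s. \<Sum>n. of_nat (Suc n) powr (-s)) {s. Re s > 1}"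
proof -
  define Z where "Z = (\<lambda>s. bose.mellin_cont (s - 1) * rGamma (s + 1))"
  have mZ: "Z meromorphic_on UNIV"
    unfolding Z_def
  proof (intro meromorphic_on_mult)
    show "(\<lambda>s. bose.mellin_cont (s - 1)) meromorphic_on UNIV"
      by (rule meromorphic_on_compose[OF bose.mellin_cont_meromorphic]) (auto intro!: analytic_intros)
    show "(\<lambda>s. rGamma (s + 1)) meromorphic_on UNIV"
      by (intro analytic_on_imp_meromorphic_on analytic_intros)
  qed
  have Zs: "Z s = dirichlet_zeta s" if "Re s > 1" for s
  proof -
    have e: "s - 1 + 1 = s" "s - 1 + 2 = s + 1" by simp_all
    have "Z s = dirichlet_zeta s * (Gamma (s + 1) * rGamma (s + 1))"
      using that mellin_bose[of "s - 1", unfolded e] by (simp add: Z_def bose.mellin_cont_eq_mellin)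
    also have "Gamma (s + 1) * rGamma (s + 1) = 1"
    proof -
      have "s + 1 \<notin> \<int>\<^sub>\<le>\<^sub>0"
      proof
        assume "s + 1 \<in> \<int>\<^sub>\<le>\<^sub>0"
        then obtain n where n: "s + 1 = of_int n" "n \<le> 0" by (auto elim: nonpos_Ints_cases)
        then have "Re (s + 1) = of_int n" by simp
        then show False using that n(2) by simp
      qed
      then show ?thesis by (simp add: rGamma_inverse_Gamma Gamma_eq_zero_iff)
    qed
    finally show ?thesis by simp
  qed
  \<comment> \<open>\<open>remove_sings\<close> supplies the values at singular points that
    \<open>nicely_meromorphic_on\<close> prescribes.\<close>
  have c: "is_meromorphic_continuation (remove_sings Z) (\<lambda>s. \<Sum>n. of_nat (Suc n) powr (-s)) {s. Re s > 1}"
    unfolding is_meromorphic_continuation_def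
  proof (intro conjI ballI)
    show "remove_sings Z nicely_meromorphic_on UNIV" by (rule remove_sings_nicely_meromorphic[OF mZ])
    fix s :: complex assume s: "s \<in> {s. Re s > 1}"
    have op: "open {s. Re s > 1}" by (rule open_halfspace_Re_gt)
    have "(\<lambda>s. mellin (bose 0) (s - 1)) holomorphic_on {s. Re s > 1}"
      by (rule holomorphic_on_compose_gen[OF _ bose.mellin_f_holomorphic, unfolded o_def]) (auto intro!: holomorphic_intros)
    then have "(\<lambda>s. mellin (bose 0) (s - 1) * rGamma (s + 1)) holomorphic_on {s. Re s > 1}"
      by (intro holomorphic_intros)
    then have "Z holomorphic_on {s. Re s > 1}"
      by (rule holomorphic_transform) (auto simp: Z_def bose.mellin_cont_eq_mellin)
    then have "Z analytic_on {s}" using op s by (rule holomorphic_on_imp_analytic_at)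
    then have "remove_sings Z s = Z s" by simp
    then show "remove_sings Z s = (\<Sum>n. of_nat (Suc n) powr (-s))"
      using Zs s by (simp add: dirichlet_zeta_def)
  qed
  show ?thesis
    unfolding zeta_def
  proof (rule theI[where P = "\<lambda>Z. is_meromorphic_continuation Z (\<lambda>s. \<Sum>n. of_nat (Suc n) powr (-s)) {s. Re s > 1}", OF c])
    fix Z' assume Z': "is_meromorphic_continuation Z' (\<lambda>s. \<Sum>n. of_nat (Suc n) powr (-s)) {s. Re s > 1}"
    have "(2::complex) \<in> {s. Re s > 1}" by simp
    then have ne: "{s::complex. Re s > 1} \<noteq> {}" by blast
    show "Z' = remove_sings Z"
      by (rule is_meromorphic_continuation_unique[OF Z' c open_halfspace_Re_gt ne])
  qed
qed

lemma zeta_eq_series: "Re s > 1 \<Longrightarrow> zeta s = dirichlet_zeta s"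
  using zeta_continuation by (auto simp: is_meromorphic_continuation_def dirichlet_zeta_def)

lemma zeta_nicely_meromorphic: "zeta nicely_meromorphic_on UNIV"
  using zeta_continuation by (auto simp: is_meromorphic_continuation_def)

lemma mellin_bose_zeta: "Re s > 0 \<Longrightarrow> mellin (bose 0) s = zeta (s + 1) * Gamma (s + 2)"
  by (simp add: mellin_bose zeta_eq_series)

section \<open>The coefficients\<close>

lemma mellin_cong: "(\<And>t. t > 0 \<Longrightarrow> \<phi> t = \<psi> t) \<Longrightarrow> mellin \<phi> s = mellin \<psi> s"
  unfolding mellin_def by (intro set_lebesgue_integral_cong) auto

lemma mellin_add:
  assumes [measurable]: "\<phi> \<in> borel_measurable borel" "\<psi> \<in> borel_measurable borel"
    and i: "mellin_integrable \<phi> (Re s)" "mellin_integrable \<psi> (Re s)"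
  shows "mellin_integrable (\<lambda>t. \<phi> t + \<psi> t) (Re s)" "mellin (\<lambda>t. \<phi> t + \<psi> t) s = mellin \<phi> s + mellin \<psi> s"
proof -
  show "mellin_integrable (\<lambda>t. \<phi> t + \<psi> t) (Re s)"
    using i unfolding mellin_integrable_def distrib_right by (rule set_integral_add(1))
  have "set_integrable lborel {0<..} (\<lambda>t. of_real (\<phi> t) * complex_of_real t powr (s - 1))"
    "set_integrable lborel {0<..} (\<lambda>t. of_real (\<psi> t) * complex_of_real t powr (s - 1))"
    using i by (simp_all add: mellin_set_integrable_iff)
  then show "mellin (\<lambda>t. \<phi> t + \<psi> t) s = mellin \<phi> s + mellin \<psi> s"
    unfolding mellin_def of_real_add distrib_right by (rule set_integral_add(2))
qed

lemma mellin_cmult: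
  shows "mellin_integrable \<phi> \<sigma> \<Longrightarrow> mellin_integrable (\<lambda>t. c * \<phi> t) \<sigma>" "mellin (\<lambda>t. c * \<phi> t) s = of_real c * mellin \<phi> s"
  unfolding mellin_integrable_def mellin_def by (simp_all add: mult.assoc)

text \<open>Cutting at 1 separates the two ends: the part near 0 converges in a right half-plane,
  the rest in a left half-plane. Powers and logarithms split off near 0 have elementary transforms,
  and this provides the continuations below.\<close>

definition near0 :: "(real \<Rightarrow> real) \<Rightarrow> real \<Rightarrow> real" where
  "near0 \<phi> t = (if t \<le> 1 then \<phi> t else 0)"

definition near_top :: "(real \<Rightarrow> real) \<Rightarrow> real \<Rightarrow> real" where
  "near_top \<phi> t = (if t \<le> 1 then 0 else \<phi> t)"

lemma near_measurable [measurable]: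
  assumes [measurable]: "\<phi> \<in> borel_measurable borel"
  shows "near0 \<phi> \<in> borel_measurable borel" "near_top \<phi> \<in> borel_measurable borel"
  unfolding near0_def[abs_def] near_top_def[abs_def] by measurable

lemma mellin_integrable_near:
  assumes [measurable]: "\<phi> \<in> borel_measurable borel" and i: "mellin_integrable \<phi> \<sigma>"
  shows "\<tau> \<ge> \<sigma> \<Longrightarrow> mellin_integrable (near0 \<phi>) \<tau>" "\<tau> \<le> \<sigma> \<Longrightarrow> mellin_integrable (near_top \<phi>) \<tau>"
proof -
  show "mellin_integrable (near0 \<phi>) \<tau>" if "\<tau> \<ge> \<sigma>"
    by (rule mellin_integrable_dominated[OF _ i])
       (use that in \<open>auto simp: near0_def abs_mult intro!: mult_left_mono powr_mono'\<close>)
  show "mellin_integrable (near_top \<phi>) \<tau>" if "\<tau> \<le> \<sigma>"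
    by (rule mellin_integrable_dominated[OF _ i])
       (use that in \<open>auto simp: near_top_def abs_mult intro!: mult_left_mono powr_mono\<close>)
qed

lemma mellin_integrable_near0_bound:
  assumes "\<phi> \<in> borel_measurable borel" "-a < \<sigma>" "\<And>t. 0 < t \<Longrightarrow> t \<le> 1 \<Longrightarrow> \<bar>\<phi> t\<bar> \<le> A * t powr a"
  shows "mellin_integrable (near0 \<phi>) \<sigma>"
proof (rule mellin_integrable_powr_bounds[where a = a and A = A and b = "-\<sigma> - 1" and B = "\<bar>A\<bar>"])
  fix t :: real assume t: "t \<ge> 1"
  show "\<bar>near0 \<phi> t\<bar> \<le> \<bar>A\<bar> * t powr (- \<sigma> - 1)"
    using assms(3)[of t] t by (cases "t = 1") (auto simp: near0_def)
qed (use assms in \<open>auto simp: near0_def\<close>)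

lemma mellin_split:
  assumes [measurable]: "\<phi> \<in> borel_measurable borel" and i: "mellin_integrable \<phi> (Re s)"
  shows "mellin \<phi> s = mellin (near0 \<phi>) s + mellin (near_top \<phi>) s"
proof -
  have "mellin \<phi> s = mellin (\<lambda>t. near0 \<phi> t + near_top \<phi> t) s"
    by (rule mellin_cong) (auto simp: near0_def near_top_def)
  also have "\<dots> = mellin (near0 \<phi>) s + mellin (near_top \<phi>) s"
    by (intro mellin_add mellin_integrable_near[OF _ i]) auto
  finally show ?thesis .
qed

lemma mellin_near0_powr:
  assumes "\<sigma> + a > 0"
  shows "mellin_integrable (near0 (\<lambda>t. t powr a)) \<sigma>" "mellin (near0 (\<lambda>t. t powr a)) (of_real \<sigma>) = 1 / of_real (\<sigma> + a)"
proof -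
  show "mellin_integrable (near0 (\<lambda>t. t powr a)) \<sigma>"
    by (rule mellin_integrable_near0_bound[where a = a and A = 1]) (use assms in auto)
  have i: "set_integrable lborel {0<..1} (\<lambda>t::real. t powr (\<sigma> + a - 1))"
    using set_integrable_lborel_powr_at_0[of "1 - (\<sigma> + a)"] assms by (simp add: algebra_simps)
  have "(LINT t:{0<..}|lborel. near0 (\<lambda>t. t powr a) t * t powr (\<sigma> - 1)) = (LINT t:{0<..1}|lborel. t powr (\<sigma> + a - 1))"
    unfolding set_lebesgue_integral_def near0_def
    by (intro Bochner_Integration.integral_cong refl) (auto simp: indicator_def algebra_simps simp flip: powr_add)
  also have "\<dots> = integral {0<..1} (\<lambda>t. t powr (\<sigma> + a - 1))" by (rule set_lborel_to_absolutely_integrable(2)[OF i])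
  also have "\<dots> = integral {0..1} (\<lambda>t. t powr (\<sigma> + a - 1))"
    by (rule integral_spike_set; rule negligible_subset[of "{0}"]; auto)
  also have "\<dots> = 1 / (\<sigma> + a)"
    using has_integral_powr_from_0[of "\<sigma> + a - 1" 1] assms by (simp add: integral_unique)
  finally show "mellin (near0 (\<lambda>t. t powr a)) (of_real \<sigma>) = 1 / of_real (\<sigma> + a)"
    by (simp add: mellin_of_real)
qed

text \<open>The formula is the negative of the one over (0, 1], on the complementary range of
  \<sigma>; in this sense a pure power has regularised Mellin transform 0.\<close>

lemma mellin_near_top_powr:
  assumes "\<sigma> + a < 0"
  shows "mellin_integrable (near_top (\<lambda>t. t powr a)) \<sigma>" "mellin (near_top (\<lambda>t. t powr a)) (of_real \<sigma>) = - 1 / of_real (\<sigma> + a)"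
proof -
  show "mellin_integrable (near_top (\<lambda>t. t powr a)) \<sigma>"
    by (rule mellin_integrable_powr_bounds[where a = "1 - \<sigma>" and A = 0 and b = a and B = 1]) (use assms in \<open>auto simp: near_top_def\<close>)
  have i: "set_integrable lborel {1..} (\<lambda>t::real. t powr (\<sigma> + a - 1))"
    using set_integrable_lborel_powr_at_top[of "1 - (\<sigma> + a)" 1] assms by (simp add: algebra_simps)
  have "(LINT t:{0<..}|lborel. near_top (\<lambda>t. t powr a) t * t powr (\<sigma> - 1)) = (LINT t:{1..}|lborel. t powr (\<sigma> + a - 1))"
    unfolding set_lebesgue_integral_def near_top_def
    by (intro integral_cong_AE) (use AE_lborel_singleton[of "1::real"] in \<open>auto elim!: eventually_mono simp: indicator_def algebra_simps simp flip: powr_add\<close>)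
  also have "\<dots> = integral {1..} (\<lambda>t. t powr (\<sigma> + a - 1))" by (rule set_lborel_to_absolutely_integrable(2)[OF i])
  also have "\<dots> = - 1 / (\<sigma> + a)"
    using has_integral_powr_to_inf[of "\<sigma> + a - 1" 1] assms by (simp add: integral_unique)
  finally show "mellin (near_top (\<lambda>t. t powr a)) (of_real \<sigma>) = - 1 / of_real (\<sigma> + a)"
    by (simp add: mellin_of_real)
qed

lemma integral_power_subst:
  fixes \<phi> :: "real \<Rightarrow> real"
  assumes i: "set_integrable lborel {0<..} \<phi>" and p: "p > 0" and "\<phi> \<in> borel_measurable borel"
  shows "(LINT x:{0<..}|lborel. real p * x ^ (p - 1) * \<phi> (x ^ p)) = (LINT t:{0<..}|lborel. \<phi> t)"
proof -
  have im: "(\<lambda>x::real. x ^ p) ` {0<..} = {0<..}"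
  proof (intro equalityI subsetI)
    fix y :: real assume "y \<in> {0<..}"
    then show "y \<in> (\<lambda>x. x ^ p) ` {0<..}" using p by (intro image_eqI[of _ _ "root p y"]) auto
  qed auto
  have inj: "inj_on (\<lambda>x::real. x ^ p) {0<..}"
    using p by (intro inj_onI) (simp add: power_eq_iff_eq_base)
  have "((\<lambda>x. x ^ p) has_real_derivative real p * x ^ (p - 1)) (at x within {0<..})" for x :: real
    by (auto intro!: derivative_eq_intros)
  from set_lborel_change_of_variables(2)[where g = "\<lambda>x. x ^ p" and S = "{0<..}", unfolded im, OF i assms(3) _ _ _ this _ inj]
  show ?thesis by auto
qed

lemma set_integral_atLeast_greaterThan:
  fixes g :: "real \<Rightarrow> real"
  assumes [measurable]: "g \<in> borel_measurable borel"
  shows "(LINT x:{a..}|lborel. g x) = (LINT x:{a<..}|lborel. g x)"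
  unfolding set_lebesgue_integral_def
  by (rule integral_cong_AE) (use AE_lborel_singleton[of a] in \<open>auto elim!: eventually_mono simp: indicator_def\<close>)

text \<open>The map v = x / (1 - x) takes [1/2, 1) onto [1, oo) and turns the integrand into
  x^(-2/3) (1 - x)^(-2/3), whose integral over [0, 1] is Beta (1/3) (1/3). By the symmetry x -> 1 -
  x half of that lies above 1/2.\<close>

lemma beta_mass_eq: "beta_mass = Gamma (1/3) ^ 2 / (2 * Gamma (2/3))"
proof -
  define B where "B = (\<lambda>x::real. x powr - (2/3) * (1 - x) powr - (2/3))"
  have [measurable]: "B \<in> borel_measurable borel" unfolding B_def by measurable
  have hB: "(B has_integral Beta (1/3) (1/3)) {0..1}"
    using has_integral_Beta_real[of "1/3" "1/3"] by (simp add: B_def)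
  have "B absolutely_integrable_on {0..1}"
    using hB by (intro nonnegative_absolutely_integrable_1) (auto simp: has_integral_integrable B_def)
  then have iB: "set_integrable lborel {0..1} B" by (simp add: set_integrable_def integrable_completion)
  have vB: "(LINT x:{0..1}|lborel. B x) = Beta (1/3) (1/3)"
    using set_lborel_to_absolutely_integrable(2)[OF iB] hB by (simp add: integral_unique)
  have i1: "set_integrable lborel {0..<1/2} B" and i2: "set_integrable lborel {1/2..1} B"
    by (rule set_integrable_subset[OF iB]; auto)+
  have un: "{0..1} = {0..<1/2} \<union> {1/2..1::real}" "{0..<1/2} \<inter> {1/2..1::real} = {}" by auto
  have s: "(LINT x:{0..1}|lborel. B x) = (LINT x:{0..<1/2}|lborel. B x) + (LINT x:{1/2..1}|lborel. B x)"
    unfolding un(1) by (rule set_integral_Un[OF un(2) i1 i2])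
  have refl1: "(LINT x:{0..<1/2}|lborel. B x) = (LINT x:{1/2<..1}|lborel. B x)"
    unfolding set_lebesgue_integral_def
    by (subst lborel_integral_real_affine[where c = "-1" and t = 1])
       (auto intro!: Bochner_Integration.integral_cong simp: indicator_def B_def mult.commute)
  have ae: "(LINT x:{1/2<..1}|lborel. B x) = (LINT x:{1/2..<1}|lborel. B x)" "(LINT x:{1/2..1}|lborel. B x) = (LINT x:{1/2..<1}|lborel. B x)"
    unfolding set_lebesgue_integral_def
    by (rule integral_cong_AE; use AE_lborel_singleton[of "1/2::real"] AE_lborel_singleton[of "1::real"] in \<open>auto simp: indicator_def elim: eventually_elim2\<close>)+
  have half: "(LINT x:{1/2..<1}|lborel. B x) = Beta (1/3) (1/3) / 2" using s refl1 ae vB by simp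
  have der: "((\<lambda>x. x / (1 - x)) has_field_derivative 1 / (1 - x)\<^sup>2) (at x within {1/2..<1})" if "x \<in> {1/2..<1}" for x :: real
    using that by (auto intro!: derivative_eq_intros simp: power2_eq_square field_simps)
  have inj: "inj_on (\<lambda>x::real. x / (1 - x)) {1/2..<1}" by (auto simp: inj_on_def divide_simps algebra_simps)
  have im: "(\<lambda>x::real. x / (1 - x)) ` {1/2..<1} = {1..}"
  proof (intro equalityI subsetI)
    fix y :: real assume "y \<in> {1..}"
    then show "y \<in> (\<lambda>x. x / (1 - x)) ` {1/2..<1}" by (intro image_eqI[of _ _ "y / (1 + y)"]) (auto simp: field_simps)
  qed (auto simp: field_simps)
  define V where "V = (\<lambda>v::real. (v * (v + 1)) powr - (2/3))"
  have [measurable]: "V \<in> borel_measurable borel" unfolding V_def by measurable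
  have iV: "set_integrable lborel {1..} V" using beta_mass_integrable by (simp add: V_def)
  have "(LINT x:{1/2..<1}|lborel. 1 / (1 - x)\<^sup>2 * V (x / (1 - x))) = (LINT v:{1..}|lborel. V v)"
    using set_lborel_change_of_variables(2)[of "\<lambda>x. x / (1 - x)" "{1/2..<1}" V "\<lambda>x. 1 / (1 - x)\<^sup>2"]
      iV der inj unfolding im by auto
  moreover have "1 / (1 - x)\<^sup>2 * V (x / (1 - x)) = B x" if "x \<in> {1/2..<1}" for x
  proof -
    have x: "0 < x" "0 < 1 - x" using that by auto
    have "x / (1 - x) * (x / (1 - x) + 1) = x / (1 - x)\<^sup>2" using x by (simp add: field_simps power2_eq_square)
    then have "V (x / (1 - x)) = x powr - (2/3) / ((1 - x)\<^sup>2) powr - (2/3)"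
      unfolding V_def using x by (simp add: powr_divide)
    also have "((1 - x)\<^sup>2) powr - (2/3) = (1 - x) powr - (4/3)" using x by (simp add: powr_powr flip: powr_numeral)
    finally have "1 / (1 - x)\<^sup>2 * V (x / (1 - x)) = x powr - (2/3) * (1 / ((1 - x) powr 2 * (1 - x) powr - (4/3)))"
      using x by (simp add: powr_numeral)
    also have "(1 - x) powr 2 * (1 - x) powr - (4/3) = (1 - x) powr (2/3)" by (simp flip: powr_add)
    finally show ?thesis using x by (simp add: B_def powr_minus_divide)
  qed
  then have "(LINT x:{1/2..<1}|lborel. 1 / (1 - x)\<^sup>2 * V (x / (1 - x))) = (LINT x:{1/2..<1}|lborel. B x)"
    by (intro set_lebesgue_integral_cong) auto
  ultimately have "beta_mass = Beta (1/3) (1/3) / 2" unfolding beta_mass_def V_def using half by simp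
  then show ?thesis by (simp add: Beta_def power2_eq_square field_simps)
qed

context decaying begin

text \<open>Substitute t = x^3, so that t^(-1/3) dt = 3 x dx.\<close>

lemma cubic_mass_eq: "3 * of_real cubic_mass = mellin (f 0) (2/3)"
proof -
  define \<phi> where "\<phi> = (\<lambda>t. f 0 t * t powr (2/3 - 1))"
  have [measurable]: "\<phi> \<in> borel_measurable borel" unfolding \<phi>_def by measurable
  have i: "set_integrable lborel {0<..} \<phi>"
    using f_mellin_integrable[of "2/3" 0] by (simp add: mellin_integrable_def \<phi>_def)
  have "(LINT t:{0<..}|lborel. \<phi> t) = (LINT x:{0<..}|lborel. real 3 * x ^ (3 - 1) * \<phi> (x ^ 3))"
    by (rule integral_power_subst[symmetric, OF i]) auto
  also have "\<dots> = (LINT x:{0<..}|lborel. 3 * (x * f 0 (x ^ 3)))"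
  proof (intro set_lebesgue_integral_cong)
    show "\<forall>x. x \<in> {0<..} \<longrightarrow> real 3 * x ^ (3 - 1) * \<phi> (x ^ 3) = 3 * (x * f 0 (x ^ 3))"
    proof (intro allI impI)
      fix x :: real assume "x \<in> {0<..}"
      then have "(x ^ 3) powr (2/3 - 1) = 1 / x" by (simp add: powr_powr powr_minus_divide flip: powr_numeral)
      then show "real 3 * x ^ (3 - 1) * \<phi> (x ^ 3) = 3 * (x * f 0 (x ^ 3))"
        using \<open>x \<in> {0<..}\<close> by (simp add: \<phi>_def power2_eq_square)
    qed
  qed auto
  also have "\<dots> = 3 * cubic_mass"
    unfolding cubic_mass_def by (subst set_integral_atLeast_greaterThan) auto
  finally show ?thesis
    using mellin_of_real[of "f 0" "2/3"] by (simp add: \<phi>_def)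
qed

text \<open>Dilations by n^3 with weights n lead to the sum of n^(1 - 3 s), which is zeta (3 s - 1)
  and converges for Re s > 2/3.\<close>

lemma mellin_cubic_sum:
  assumes "\<sigma> > 2/3"
  shows "mellin_integrable cubic_sum \<sigma>" "mellin cubic_sum (of_real \<sigma>) = zeta (3 * of_real \<sigma> - 1) * mellin (f 0) (of_real \<sigma>)"
proof -
  have pw: "real (Suc n) * (real (Suc n) ^ 3) powr - \<sigma> = real (Suc n) powr - (3 * \<sigma> - 1)" for n
  proof -
    have "(real (Suc n) ^ 3) powr - \<sigma> = real (Suc n) powr - (3 * \<sigma>)" by (simp add: powr_powr flip: powr_numeral del: of_nat_Suc)
    then show ?thesis using powr_add[of "real (Suc n)" 1 "- (3 * \<sigma>)"] by (simp add: algebra_simps)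
  qed
  have A: "mellin_integrable (f 0) (Re (of_real \<sigma>))" using assms by (intro f_mellin_integrable) auto
  have B: "summable (\<lambda>n. real (Suc n) * (real (Suc n) ^ 3) powr - Re (of_real \<sigma>))"
    unfolding Re_complex_of_real pw using assms by (intro summable_Suc_powr) auto
  have C: "(\<lambda>n. real (Suc n) * f 0 (real (Suc n) ^ 3 * t)) sums cubic_sum t" if "t > 0" for t
    using summable_sums[OF cubic_summable[OF that]] by (simp only: cubic_sum_def mult.commute)
  have *: "mellin_integrable cubic_sum (Re (of_real \<sigma>))"
    by (rule mellin_sum(1)[where l = "\<lambda>n. real (Suc n) ^ 3" and w = "\<lambda>n. real (Suc n)" and \<phi> = "f 0"])
       (fact A B | erule C | simp add: f_nonneg)+
  have **: "mellin cubic_sum (of_real \<sigma>) =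
     (\<Sum>n. of_real (real (Suc n)) * of_real (real (Suc n) ^ 3) powr - of_real \<sigma>) * mellin (f 0) (of_real \<sigma>)"
    by (rule mellin_sum(2)[where l = "\<lambda>n. real (Suc n) ^ 3" and w = "\<lambda>n. real (Suc n)" and \<phi> = "f 0"])
       (fact A B | erule C | simp add: f_nonneg)+
  show "mellin_integrable cubic_sum \<sigma>" using * by simp
  have pc: "complex_of_real (real (Suc n)) * of_real (real (Suc n) ^ 3) powr - of_real \<sigma> = of_nat (Suc n) powr - (3 * of_real \<sigma> - 1)" for n
  proof -
    have "complex_of_real (real (Suc n) ^ 3) powr - of_real \<sigma> = of_real ((real (Suc n) ^ 3) powr - \<sigma>)"
      using powr_of_real[of "real (Suc n) ^ 3" "- \<sigma>"] by (simp del: of_nat_Suc of_real_power)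
    moreover have "complex_of_real (real (Suc n)) powr of_real (- (3 * \<sigma> - 1)) = of_real (real (Suc n) powr - (3 * \<sigma> - 1))"
      by (rule powr_of_real) auto
    moreover have "complex_of_real (- (3 * \<sigma> - 1)) = - (3 * of_real \<sigma> - 1)" by simp
    ultimately show ?thesis unfolding pw[symmetric] by (simp only: of_real_mult of_real_of_nat_eq)
  qed
  have "1 < Re (3 * of_real \<sigma> - 1)" using assms by simp
  then show "mellin cubic_sum (of_real \<sigma>) = zeta (3 * of_real \<sigma> - 1) * mellin (f 0) (of_real \<sigma>)"
    using ** unfolding pc by (simp add: zeta_eq_series dirichlet_zeta_def)
qed

text \<open>On \<open>0 < Re s < 2/3\<close> the Mellin transform of \<open>cubic_error\<close> continues that of \<open>cubic_sum\<close>, because the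
  subtracted power has a vanishing regularised Mellin transform.\<close>

lemma cubic_moment_eq:
  assumes nz: "mellin (f 0) (1/2) \<noteq> 0"
  shows "2 * of_real cubic_moment = zeta (1/2) * mellin (f 0) (1/2)"
proof -
  obtain C where C: "C > 0" "\<And>a. a > 0 \<Longrightarrow> \<bar>cubic_error a\<bar> \<le> C" "\<And>a. a > 0 \<Longrightarrow> \<bar>cubic_error a\<bar> \<le> C * a powr - (2/3)"
    by (rule cubic_error_bounds) blast
  obtain C' where C': "C' > 0" "\<And>a. a > 0 \<Longrightarrow> cubic_sum a \<le> C' * a powr - 1"
    by (rule cubic_sum_large) blast
  define K where "K = cubic_mass"
  define H1 where "H1 = mellin (near0 cubic_error)"
  define H2 where "H2 = mellin (near_top cubic_sum)"
  \<comment> \<open>R continues the transform of \<open>cubic_sum\<close> to 0 < Re s < 1: splitting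
    off K t^(-2/3) on (0, 1] leaves K / (s - 2/3), the remaining \<open>cubic_error\<close> is
    bounded near 0, and beyond 1 the sum decays like 1/t.\<close>
  define R where "R = (\<lambda>s. of_real K / (s - 2/3) + H1 s + H2 s)"
  have i1: "mellin_integrable (near0 cubic_error) \<sigma>" if "\<sigma> > 0" for \<sigma>
    by (rule mellin_integrable_near0_bound[where a = 0 and A = C]) (use that C in auto)
  have i2: "mellin_integrable (near_top cubic_sum) \<sigma>" if "\<sigma> < 1" for \<sigma>
  proof (rule mellin_integrable_powr_bounds[where a = "1 - \<sigma>" and A = 0 and b = "-1" and B = C'])
    fix t :: real assume "t \<ge> 1"
    then show "\<bar>near_top cubic_sum t\<bar> \<le> C' * t powr - 1"
      using C'(2)[of t] C'(1) cubic_sum_nonneg[of t] by (simp add: near_top_def)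
  qed (use that in \<open>auto simp: near_top_def\<close>)
  define S where "S = {s. 0 < Re s} \<inter> {s. Re s < 1}"
  have S: "open S" "connected S"
    unfolding S_def by (auto intro!: open_Int open_halfspace_Re_gt open_halfspace_Re_lt convex_connected convex_Int convex_halfspace_Re_gt convex_halfspace_Re_lt)
  have h1: "H1 holomorphic_on S" unfolding H1_def
  proof (rule mellin_holomorphic)
    fix s assume "s \<in> S"
    then show "\<exists>d>0. mellin_integrable (near0 cubic_error) (Re s - d) \<and> mellin_integrable (near0 cubic_error) (Re s + d)"
      by (intro exI[of _ "Re s / 2"]) (auto intro!: i1 simp: S_def)
  qed (use S in auto)
  have h2: "H2 holomorphic_on S" unfolding H2_def
  proof (rule mellin_holomorphic)
    fix s assume "s \<in> S"
    then show "\<exists>d>0. mellin_integrable (near_top cubic_sum) (Re s - d) \<and> mellin_integrable (near_top cubic_sum) (Re s + d)"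
      by (intro exI[of _ "(1 - Re s) / 2"]) (auto intro!: i2 simp: S_def field_simps)
  qed (use S in auto)
  have hM: "mellin (f 0) holomorphic_on S"
    by (rule holomorphic_on_subset[OF mellin_f_holomorphic]) (auto simp: S_def)
  have half: "1/2 \<in> S" by (simp add: S_def)
  have val: "R (of_real \<sigma>) = mellin cubic_sum (of_real \<sigma>)" if "2/3 < \<sigma>" for \<sigma>
  proof -
    have e: "near0 cubic_sum t = K * near0 (\<lambda>t. t powr - (2/3)) t + near0 cubic_error t" for t
      by (simp add: near0_def cubic_error_def K_def)
    have "mellin (near0 cubic_sum) (of_real \<sigma>) = of_real K * (1 / of_real (\<sigma> + - (2/3))) + H1 (of_real \<sigma>)"
      unfolding e[abs_def] H1_def using that
      by (subst mellin_add(2)) (auto simp: mellin_cmult(2) mellin_near0_powr intro!: mellin_cmult(1) mellin_near0_powr(1) i1)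
    then show ?thesis
      using mellin_split[of cubic_sum "of_real \<sigma>"] mellin_cubic_sum(1)[OF that] by (simp add: R_def H2_def)
  qed
  have ev: "\<forall>\<^sub>F s in at (1/2). zeta (3 * s - 1) * mellin (f 0) s = R s"
  proof (rule meromorphic_eq_on_segment[of _ S _ "2/3" 1])
    have "(\<lambda>s. zeta (3 * s - 1)) meromorphic_on S"
      by (rule meromorphic_on_compose[of zeta UNIV])
         (use zeta_nicely_meromorphic in \<open>auto simp: nicely_meromorphic_on_def intro!: analytic_intros\<close>)
    moreover have "mellin (f 0) meromorphic_on S"
      using hM S(1) by (intro analytic_on_imp_meromorphic_on) (simp add: analytic_on_open)
    ultimately show "(\<lambda>s. zeta (3 * s - 1) * mellin (f 0) s) meromorphic_on S" by (rule meromorphic_on_mult)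
    show "R meromorphic_on S" unfolding R_def
      using h1 h2 S(1) by (intro meromorphic_intros analytic_on_imp_meromorphic_on) (simp_all add: analytic_on_open)
    fix x :: real assume x: "2/3 < x" "x < 1"
    then show "of_real x \<in> S \<and> zeta (3 * of_real x - 1) * mellin (f 0) (of_real x) = R (of_real x)"
      using val[of x] mellin_cubic_sum(2)[of x] by (simp add: S_def)
  qed (use S half in auto)
  have cM: "isCont (mellin (f 0)) (1/2)" and c1: "isCont H1 (1/2)" and c2: "isCont H2 (1/2)"
    using hM h1 h2 S(1) half by (auto intro: analytic_at_imp_isCont holomorphic_on_imp_analytic_at)
  have cR: "isCont R (1/2)" unfolding R_def using c1 c2 by (intro continuous_intros) auto
  have "\<forall>\<^sub>F s in at (1/2). mellin (f 0) s \<noteq> 0"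
    using cM nz unfolding isCont_def by (rule tendsto_imp_eventually_ne)
  \<comment> \<open>The value of zeta at 1/2 is only accessible as a limit, so the identity is
    solved for zeta, which uses that the transform of f does not vanish at 1/2. The map w -> (w + 1)
    / 3 inverts s -> 3 s - 1 and fixes 1/2, so both sides are evaluated at the same point.\<close>
  with ev have "\<forall>\<^sub>F s in at (1/2). zeta (3 * s - 1) = R s / mellin (f 0) s"
    by eventually_elim (simp add: field_simps)
  moreover have "filterlim (\<lambda>w::complex. (w + 1) / 3) (at (1/2)) (at (1/2))"
  proof (rule filterlim_atI)
    show "((\<lambda>w::complex. (w + 1) / 3) \<longlongrightarrow> 1/2) (at (1/2))"
      by (auto intro!: tendsto_eq_intros)
    show "\<forall>\<^sub>F w in at (1/2). (w + 1) / 3 \<noteq> (1/2 :: complex)"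
      unfolding eventually_at_filter by (auto simp: field_simps)
  qed
  ultimately have "\<forall>\<^sub>F w in at (1/2). zeta (3 * ((w + 1) / 3) - 1) = R ((w + 1) / 3) / mellin (f 0) ((w + 1) / 3)"
    by (rule eventually_compose_filterlim)
  moreover have "3 * ((w + 1) / 3) - 1 = w" for w :: complex by (simp add: field_simps)
  ultimately have ev': "\<forall>\<^sub>F w in at (1/2). zeta w = R ((w + 1) / 3) / mellin (f 0) ((w + 1) / 3)" by (simp only:)
  have z: "zeta (1/2) = R ((1/2 + 1) / 3) / mellin (f 0) ((1/2 + 1) / 3)"
  proof (rule nicely_meromorphic_value(1)[OF zeta_nicely_meromorphic ev'])
    have h: "(1/2 + 1) / 3 = (1/2 :: complex)" by simp
    have cg: "isCont (\<lambda>w::complex. (w + 1) / 3) (1/2)" by (intro continuous_intros) auto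
    have r: "isCont (\<lambda>w. R ((w + 1) / 3)) (1/2)"
      by (rule isCont_o2[OF cg]) (simp only: h cR)
    have m: "isCont (\<lambda>w. mellin (f 0) ((w + 1) / 3)) (1/2)"
      by (rule isCont_o2[OF cg, where g = "mellin (f 0)"]) (simp only: h cM)
    show "isCont (\<lambda>w. R ((w + 1) / 3) / mellin (f 0) ((w + 1) / 3)) (1 / 2)"
      by (rule continuous_divide[OF r m]) (simp only: h Lim_ident_at netlimit_at nz not_False_eq_True)
  qed
  moreover have "(1/2 + 1) / 3 = (1/2 :: complex)" by simp
  ultimately have zR: "zeta (1/2) * mellin (f 0) (1/2) = R (1/2)" using nz by simp
  \<comment> \<open>To the left of 2/3 the term K / (s - 2/3) is the transform of - K t^(-2/3) over
    (1, oo), so R becomes the transform of \<open>cubic_error\<close> on the whole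
    half-line.\<close>
  have "R (of_real (1/2)) = mellin cubic_error (of_real (1/2))"
  proof -
    have i3: "mellin_integrable cubic_error (1/2)"
      by (rule mellin_integrable_powr_bounds[where a = 0 and A = C and b = "- (2/3)" and B = C]) (use C in auto)
    have e: "near_top cubic_error t = near_top cubic_sum t + (- K) * near_top (\<lambda>t. t powr - (2/3)) t" for t
      by (simp add: near_top_def cubic_error_def K_def)
    have "mellin (near_top cubic_error) (of_real (1/2)) = H2 (of_real (1/2)) + of_real (- K) * (- 1 / of_real (1/2 + - (2/3)))"
    proof -
      define P where "P = near_top (\<lambda>t. t powr - (2/3))"
      have [measurable]: "P \<in> borel_measurable borel" unfolding P_def by measurable
      have p: "mellin_integrable P (1/2)" "mellin P (of_real (1/2)) = - 1 / of_real (1/2 + - (2/3))"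
        unfolding P_def by (rule mellin_near_top_powr; simp)+
      have "mellin (\<lambda>t. near_top cubic_sum t + - K * P t) (of_real (1/2)) = mellin (near_top cubic_sum) (of_real (1/2)) + mellin (\<lambda>t. - K * P t) (of_real (1/2))"
      proof (rule mellin_add(2))
        show "mellin_integrable (near_top cubic_sum) (Re (of_real (1/2)))" by (rule i2) simp
        show "mellin_integrable (\<lambda>t. - K * P t) (Re (of_real (1/2)))"
          using mellin_cmult(1)[OF p(1), of "- K"] by (simp only: Re_complex_of_real)
      qed auto
      then show ?thesis unfolding mellin_cmult(2) p(2) unfolding e[abs_def] H2_def P_def .
    qed
    then show ?thesis
      using mellin_split[of cubic_error "of_real (1/2)"] i3 by (simp add: R_def H1_def)
  qed
  also have "\<dots> = of_real (LINT t:{0<..}|lborel. cubic_error t * t powr (1/2 - 1))" by (rule mellin_of_real)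
  \<comment> \<open>Substitute t = x^2, so that t^(-1/2) dt = 2 dx.\<close>
  also have "(LINT t:{0<..}|lborel. cubic_error t * t powr (1/2 - 1)) = 2 * cubic_moment"
  proof -
    define \<phi> where "\<phi> = (\<lambda>t. cubic_error t * t powr (1/2 - 1))"
    have [measurable]: "\<phi> \<in> borel_measurable borel" unfolding \<phi>_def by measurable
    have i3: "mellin_integrable cubic_error (1/2)"
      by (rule mellin_integrable_powr_bounds[where a = 0 and A = C and b = "- (2/3)" and B = C]) (use C in auto)
    then have i: "set_integrable lborel {0<..} \<phi>" by (simp add: mellin_integrable_def \<phi>_def)
    have "(LINT t:{0<..}|lborel. \<phi> t) = (LINT x:{0<..}|lborel. real 2 * x ^ (2 - 1) * \<phi> (x ^ 2))"
      by (rule integral_power_subst[symmetric, OF i]) auto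
    also have "\<dots> = (LINT x:{0<..}|lborel. 2 * cubic_error (x\<^sup>2))"
    proof (intro set_lebesgue_integral_cong)
      show "\<forall>x. x \<in> {0<..} \<longrightarrow> real 2 * x ^ (2 - 1) * \<phi> (x ^ 2) = 2 * cubic_error (x\<^sup>2)"
      proof (intro allI impI)
        fix x :: real assume "x \<in> {0<..}"
        then have "(x\<^sup>2) powr (1/2 - 1) = 1 / x" by (simp add: powr_powr powr_minus_divide flip: powr_numeral)
        then show "real 2 * x ^ (2 - 1) * \<phi> (x ^ 2) = 2 * cubic_error (x\<^sup>2)"
          using \<open>x \<in> {0<..}\<close> by (simp add: \<phi>_def)
      qed
    qed auto
    also have "\<dots> = 2 * cubic_moment"
      unfolding cubic_moment_def by (subst set_integral_atLeast_greaterThan) auto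
    finally show ?thesis by (simp add: \<phi>_def)
  qed
  finally show ?thesis using zR by simp
qed

end

text \<open>A series of positive terms. This supplies the nonvanishing that
  \<open>cubic_moment_eq\<close> asks for.\<close>

lemma zeta_three_halves: "Re (dirichlet_zeta (3/2)) > 0"
proof -
  have e: "of_nat (Suc n) powr - (3/2) = complex_of_real (real (Suc n) powr - (3/2))" for n
    using powr_of_real[of "real (Suc n)" "- (3/2)"] by simp
  have s: "summable (\<lambda>n. real (Suc n) powr - (3/2))" by (rule summable_Suc_powr) simp
  have "dirichlet_zeta (3/2) = of_real (\<Sum>n. real (Suc n) powr - (3/2))"
    unfolding dirichlet_zeta_def e by (rule suminf_of_real[OF s, symmetric])
  moreover have "(\<Sum>n. real (Suc n) powr - (3/2)) > 0" by (rule suminf_pos[OF s]) auto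
  ultimately show ?thesis by simp
qed

text \<open>Gamma (8/3) = (5/3) (2/3) Gamma (2/3), and Gamma (2/3) cancels against the denominator
  in \<open>beta_mass_eq\<close>; Gamma (5/2) = (3/4) sqrt pi. The powers of 2 come from u = t /
  2.\<close>

theorem bose_constants:
  "of_real (2 * bose.cubic_mass * beta_mass * 2 powr (2/3)) = 10/9 * mu1"
  "of_real (2 * bose.cubic_moment * 2 powr (1/2)) = 3/4 * mu2"
proof -
  have g1: "Gamma (8/3 :: complex) = 10/9 * of_real (Gamma (2/3))"
  proof -
    have "Gamma (8/3 :: complex) = of_real (Gamma (8/3))" using Gamma_complex_of_real[of "8/3"] by simp
    moreover have "Gamma (8/3 :: real) = 10/9 * Gamma (2/3)"
    proof -
      have "(5/3::real) \<notin> \<int>\<^sub>\<le>\<^sub>0" "(2/3::real) \<notin> \<int>\<^sub>\<le>\<^sub>0" by (auto dest: nonpos_Ints_nonpos)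
      then show ?thesis using Gamma_plus1[of "5/3::real"] Gamma_plus1[of "2/3::real"] by simp
    qed
    ultimately show ?thesis by simp
  qed
  have M: "mellin (bose 0) (2/3) = zeta (5/3) * Gamma (8/3)" "mellin (bose 0) (1/2) = zeta (3/2) * Gamma (5/2)"
    using mellin_bose_zeta[of "2/3"] mellin_bose_zeta[of "1/2"] by simp_all
  have "Gamma (2/3::real) > 0" by (rule Gamma_real_pos) simp
  then have g0: "Gamma (2/3::real) \<noteq> 0" by linarith
  have "3 * complex_of_real (2 * bose.cubic_mass * beta_mass * 2 powr (2/3)) =
      2 * mellin (bose 0) (2/3) * of_real beta_mass * of_real (2 powr (2/3))"
    using bose.cubic_mass_eq by (simp add: mult_ac)
  also have "\<dots> = 3 * (10/9 * mu1)"
    unfolding M g1 mu1_def beta_mass_eq using g0 by (simp add: field_simps)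
  finally show "of_real (2 * bose.cubic_mass * beta_mass * 2 powr (2/3)) = 10/9 * mu1" by simp
  have g2: "Gamma (5/2 :: complex) = 3/4 * of_real (sqrt pi)"
  proof -
    have "Gamma (5/2 :: complex) = of_real (Gamma (5/2))" using Gamma_complex_of_real[of "5/2"] by simp
    moreover have "Gamma (5/2 :: real) = 3/4 * sqrt pi"
    proof -
      have "(3/2::real) \<notin> \<int>\<^sub>\<le>\<^sub>0" "(1/2::real) \<notin> \<int>\<^sub>\<le>\<^sub>0" by (auto dest: nonpos_Ints_nonpos)
      then show ?thesis
        using Gamma_plus1[of "3/2::real"] Gamma_plus1[of "1/2::real"] by (simp add: Gamma_one_half_real)
    qed
    ultimately show ?thesis by simp
  qed
  have "zeta (3/2) \<noteq> 0" using zeta_three_halves by (auto simp: zeta_eq_series)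
  then have "mellin (bose 0) (1/2) \<noteq> 0" unfolding M(2) g2 by simp
  from bose.cubic_moment_eq[OF this]
  have "of_real (2 * bose.cubic_moment * 2 powr (1/2)) = zeta (1/2) * zeta (3/2) * (3/4 * of_real (sqrt pi)) * of_real (sqrt 2)"
    unfolding M g2 by (simp add: powr_half_sqrt)
  also have "\<dots> = 3/4 * mu2" by (simp add: mu2_def real_sqrt_mult)
  finally show "of_real (2 * bose.cubic_moment * 2 powr (1/2)) = 3/4 * mu2" .
qed

section \<open>The logarithm of the product\<close>

definition grid_weight :: "nat \<Rightarrow> nat \<Rightarrow> nat" where
  "grid_weight j k = Suc j * Suc k * (Suc j + Suc k)"

text \<open>The pairs are enumerated by a single index because termwise differentiation and
  \<open>mellin_sum\<close> are stated for series. Half the weight is the exponent in the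
  product.\<close>

definition grid_scale :: "nat \<Rightarrow> real" where
  "grid_scale i = real (case prod_decode i of (j, k) \<Rightarrow> grid_weight j k) / 2"

lemma even_grid_weight: "even (grid_weight j k)"
  by (auto simp: grid_weight_def)

lemma grid_scale_ge_1: "grid_scale i \<ge> 1"
proof (cases "prod_decode i")
  case (Pair j k)
  have "1 * 1 * (1 + 1) \<le> Suc j * Suc k * (Suc j + Suc k)" by (intro mult_mono add_mono) auto
  then have "2 \<le> grid_weight j k" by (simp only: grid_weight_def mult_1 one_add_one)
  then have "real 2 \<le> real (grid_weight j k)" by (rule of_nat_mono)
  then show ?thesis using Pair by (simp add: grid_scale_def)
qed

lemma grid_scale_pos: "grid_scale i > 0"
  using grid_scale_ge_1[of i] by linarith

lemma has_sum_prod_decode: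
  "((\<lambda>i. g (case prod_decode i of (j, k) \<Rightarrow> F j k)) has_sum S) UNIV \<longleftrightarrow> ((\<lambda>(j, k). g (F j k)) has_sum S) UNIV"
proof -
  have "(\<lambda>i. g (case prod_decode i of (j, k) \<Rightarrow> F j k)) = (\<lambda>i. (\<lambda>(j, k). g (F j k)) (prod_decode i))"
    by (auto simp: fun_eq_iff split: prod.split)
  then show ?thesis using has_sum_reindex_bij_betw[OF bij_prod_decode, of "\<lambda>(j, k). g (F j k)"] by simp
qed

text \<open>Since j k (j + k) / 2 \<ge> j k, a product of two convergent series is a majorant. The
  exponent 2 is far from the abscissa 2/3 but suffices for termwise differentiation and for an
  identity on a real segment.\<close>

lemma summable_grid_scale: "p \<ge> 2 \<Longrightarrow> summable (\<lambda>i. grid_scale i powr - p)"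
proof -
  assume p: "p \<ge> 2"
  define z where "z = (\<lambda>j. real (Suc j) powr - 2)"
  have z: "z sums suminf z" unfolding z_def by (intro summable_sums summable_Suc_powr) simp
  have "((\<lambda>(j, k). z j * z k) has_sum (suminf z * suminf z)) UNIV"
  proof (rule has_sum_Times_nonneg)
    show "(\<lambda>k. z j * z k) sums (z j * suminf z)" for j by (rule sums_mult[OF z])
    show "(\<lambda>j. z j * suminf z) sums (suminf z * suminf z)" by (rule sums_mult2[OF z])
  qed (simp add: z_def)
  then have s: "(\<lambda>(j, k). z j * z k) summable_on UNIV" by (rule has_sum_imp_summable)
  have "(\<lambda>(j, k). (real (grid_weight j k) / 2) powr - p) summable_on UNIV"
  proof (rule summable_on_comparison_test[OF s])
    fix x :: "nat \<times> nat"
    obtain j k where x: "x = (j, k)" by (cases x)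
    have "(real (grid_weight j k) / 2) \<ge> real (Suc j) * real (Suc k)"
    proof -
      have "real (Suc j) * real (Suc k) * 2 \<le> real (Suc j) * real (Suc k) * (real (Suc j) + real (Suc k))"
        by (intro mult_left_mono) auto
      then show ?thesis by (simp only: grid_weight_def of_nat_mult of_nat_add le_divide_eq_numeral1)
    qed
    moreover have "1 * 1 \<le> real (Suc j) * real (Suc k)" by (intro mult_mono) auto
    ultimately have "(real (grid_weight j k) / 2) powr - p \<le> (real (grid_weight j k) / 2) powr - 2"
       "(real (grid_weight j k) / 2) powr - 2 \<le> (real (Suc j) * real (Suc k)) powr - 2"
      using p by (intro powr_mono powr_mono2'; simp)+
    then show "(case x of (j, k) \<Rightarrow> (real (grid_weight j k) / 2) powr - p) \<le> (case x of (j, k) \<Rightarrow> z j * z k)"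
      by (simp add: x z_def powr_mult del: of_nat_Suc)
  qed (auto split: prod.split)
  then have "((\<lambda>i. (\<lambda>n. (real n / 2) powr - p) (case prod_decode i of (j, k) \<Rightarrow> grid_weight j k)) has_sum
      infsum (\<lambda>(j, k). (real (grid_weight j k) / 2) powr - p) UNIV) UNIV"
    by (subst has_sum_prod_decode) (rule has_sum_infsum)
  then show ?thesis unfolding grid_scale_def by (intro sums_summable has_sum_imp_sums)
qed

definition log_kernel :: "real \<Rightarrow> real" where
  "log_kernel x = - ln (1 - exp (- x))"

lemma log_kernel_measurable [measurable]: "log_kernel \<in> borel_measurable borel"
  unfolding log_kernel_def by measurable

lemma log_kernel_nonneg: "x > 0 \<Longrightarrow> log_kernel x \<ge> 0"
  by (simp add: log_kernel_def)

lemma log_kernel_le: "x > 0 \<Longrightarrow> log_kernel x \<le> 1 / (exp x - 1)"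
proof -
  assume x: "x > 0"
  have e: "0 < 1 - exp (- x)" using x by simp
  have "ln (1 / (1 - exp (- x))) \<le> 1 / (1 - exp (- x)) - 1" using e by (intro ln_le_minus_one) simp
  also have "\<dots> = 1 / (exp x - 1)"
    using e x by (simp add: exp_minus field_simps)
  finally show ?thesis using e by (simp add: log_kernel_def ln_div)
qed

text \<open>The quadratic bound gives the majorant for the series of logarithms, the cubic one that
  for its derivative, where a factor \<open>grid_scale\<close> has to be compensated.\<close>

lemma exp_minus_one_lower:
  assumes "x \<ge> (0::real)" shows "x\<^sup>2 / 2 \<le> exp x - 1" "x ^ 3 / 6 \<le> exp x - 1"
proof -
  have "(\<Sum>i<4. x ^ i /\<^sub>R fact i) \<le> exp x"
    unfolding exp_def using assms by (intro sum_le_suminf summable_exp_generic) auto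
  then have "1 + x + x\<^sup>2 / 2 + x ^ 3 / 6 \<le> exp x" by (simp add: eval_nat_numeral field_simps)
  moreover have "0 \<le> x\<^sup>2 / 2" "0 \<le> x ^ 3 / 6" using assms by simp_all
  ultimately show "x\<^sup>2 / 2 \<le> exp x - 1" "x ^ 3 / 6 \<le> exp x - 1" using assms by linarith+
qed

lemma log_kernel_le_powr: "x > 0 \<Longrightarrow> log_kernel x \<le> 2 * x powr - 2"
proof -
  assume x: "x > 0"
  have "log_kernel x \<le> 1 / (exp x - 1)" by (rule log_kernel_le[OF x])
  also have "\<dots> \<le> 1 / (x\<^sup>2 / 2)" using exp_minus_one_lower(1)[of x] x by (intro divide_left_mono mult_pos_pos) auto
  also have "\<dots> = 2 * x powr - 2" using x by (simp add: powr_minus_divide powr_numeral)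
  finally show ?thesis .
qed

lemma log_kernel_deriv: "x > 0 \<Longrightarrow> (log_kernel has_real_derivative - 1 / (exp x - 1)) (at x)"
proof -
  assume x: "x > 0"
  then have "exp x \<noteq> 1" "exp (-x) < 1" by auto
  then show ?thesis unfolding log_kernel_def
    by (auto intro!: derivative_eq_intros simp: exp_minus field_simps)
qed

text \<open>The origin of the kernel: psi(x) is x^2 times the second derivative of
  \<open>log_kernel\<close>.\<close>

lemma bose_deriv_eq: "x > 0 \<Longrightarrow> ((\<lambda>x. - 1 / (exp x - 1)) has_real_derivative bose 0 x / x\<^sup>2) (at x)"
  by (auto intro!: derivative_eq_intros simp: bose_0 power2_eq_square)

definition log_sum :: "real \<Rightarrow> real" where
  "log_sum t = (\<Sum>i. log_kernel (grid_scale i * t))"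

definition log_sum1 :: "real \<Rightarrow> real" where
  "log_sum1 t = (\<Sum>i. grid_scale i * (- 1 / (exp (grid_scale i * t) - 1)))"

definition bose_sum :: "real \<Rightarrow> real" where
  "bose_sum t = (\<Sum>i. bose 0 (grid_scale i * t))"

lemma log_sum_measurable [measurable]: "log_sum \<in> borel_measurable borel"
  unfolding log_sum_def[abs_def] by measurable

lemma summable_log_kernel:
  assumes t: "t > 0"
  shows "summable (\<lambda>i. log_kernel (grid_scale i * t))"
proof (rule summable_comparison_test'[OF summable_mult[OF summable_grid_scale[of 2], of "2 * t powr - 2"]])
  fix i :: nat
  have p: "grid_scale i * t > 0" using t grid_scale_pos by simp
  have "norm (log_kernel (grid_scale i * t)) \<le> 2 * (grid_scale i * t) powr - 2"
    using log_kernel_le_powr[OF p] log_kernel_nonneg[OF p] by simp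
  also have "\<dots> = 2 * t powr - 2 * grid_scale i powr - 2" using grid_scale_pos[of i] t by (simp add: powr_mult)
  finally show "norm (log_kernel (grid_scale i * t)) \<le> 2 * t powr - 2 * grid_scale i powr - 2" .
qed simp

lemma summable_log_kernel_deriv:
  assumes t: "t > 0"
  shows "\<bar>grid_scale i * (- 1 / (exp (grid_scale i * t) - 1))\<bar> \<le> 6 / t ^ 3 * grid_scale i powr - 2"
    "summable (\<lambda>i. grid_scale i * (- 1 / (exp (grid_scale i * t) - 1)))"
proof -
  show *: "\<bar>grid_scale i * (- 1 / (exp (grid_scale i * t) - 1))\<bar> \<le> 6 / t ^ 3 * grid_scale i powr - 2" for i
  proof -
    have p: "grid_scale i * t > 0" using t grid_scale_pos by simp
    have "\<bar>grid_scale i * (- 1 / (exp (grid_scale i * t) - 1))\<bar> = grid_scale i * (1 / (exp (grid_scale i * t) - 1))"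
      using p grid_scale_pos[of i] by (simp add: abs_mult)
    also have "\<dots> \<le> grid_scale i * (1 / ((grid_scale i * t) ^ 3 / 6))"
      using p grid_scale_pos[of i] exp_minus_one_lower(2)[of "grid_scale i * t"]
      by (intro mult_left_mono divide_left_mono mult_pos_pos) auto
    also have "\<dots> = 6 / t ^ 3 * grid_scale i powr - 2"
      using t grid_scale_pos[of i] by (simp add: powr_minus_divide powr_numeral power2_eq_square power3_eq_cube field_simps)
    finally show ?thesis .
  qed
  show "summable (\<lambda>i. grid_scale i * (- 1 / (exp (grid_scale i * t) - 1)))"
    by (rule summable_comparison_test'[OF summable_mult[OF summable_grid_scale[of 2], of "6 / t ^ 3"]]) (use * in auto)
qed

lemma log_sum_deriv:
  assumes t: "t > 0"
  shows "(log_sum has_real_derivative log_sum1 t) (at t)"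
proof -
  \<comment> \<open>The majorants blow up at 0, so the M-test is used on a half-line that stays away
    from 0 and has t in its interior.\<close>
  define S where "S = {t/2<..}"
  have tS: "t \<in> interior S" "t \<in> S" using t by (auto simp: S_def interior_open)
  have "uniformly_convergent_on S (\<lambda>n x. \<Sum>i<n. grid_scale i * (- 1 / (exp (grid_scale i * x) - 1)))"
  proof (rule Weierstrass_m_test')
    show "summable (\<lambda>i. 6 / (t/2) ^ 3 * grid_scale i powr - 2)" by (intro summable_mult summable_grid_scale) simp
    fix i x assume "x \<in> S"
    then have x: "x > t/2" "x > 0" using t by (auto simp: S_def)
    have "norm (grid_scale i * (- 1 / (exp (grid_scale i * x) - 1))) \<le> 6 / x ^ 3 * grid_scale i powr - 2"
      using summable_log_kernel_deriv(1)[OF x(2)] by simp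
    also have "\<dots> \<le> 6 / (t/2) ^ 3 * grid_scale i powr - 2"
      using x t by (intro mult_right_mono divide_left_mono power_mono) auto
    finally show "norm (grid_scale i * (- 1 / (exp (grid_scale i * x) - 1))) \<le> 6 / (t/2) ^ 3 * grid_scale i powr - 2" .
  qed
  moreover have "((\<lambda>x. log_kernel (grid_scale i * x)) has_real_derivative grid_scale i * (- 1 / (exp (grid_scale i * x) - 1))) (at x within S)" if "x \<in> S" for i x
  proof -
    have "grid_scale i * x > 0" using that t grid_scale_pos[of i] by (auto simp: S_def)
    from DERIV_chain2[OF log_kernel_deriv[OF this] DERIV_cmult_Id]
    show ?thesis by (simp add: has_field_derivative_at_within mult.commute)
  qed
  ultimately have "((\<lambda>x. \<Sum>i. log_kernel (grid_scale i * x)) has_real_derivative (\<Sum>i. grid_scale i * (- 1 / (exp (grid_scale i * t) - 1)))) (at t)"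
    using tS summable_log_kernel[OF t]
    by (intro has_field_derivative_series'(2)[where S = S and ?x0.0 = t]) (auto simp: S_def)
  then show ?thesis by (simp add: log_sum_def[abs_def] log_sum1_def)
qed

lemma bose_term_bound:
  obtains B where "B > 0" "\<And>i t. t > 0 \<Longrightarrow> bose 0 (grid_scale i * t) / t\<^sup>2 \<le> B / t ^ 4 * grid_scale i powr - 2"
proof -
  obtain B where B: "B > 0" "\<And>x y. 0 < y \<Longrightarrow> y \<le> x \<Longrightarrow> \<bar>bose 0 x\<bar> \<le> B * y powr - 2"
    using bose.f_inverse_powr_bound[of 2 0] by auto
  have "bose 0 (grid_scale i * t) / t\<^sup>2 \<le> B / t ^ 4 * grid_scale i powr - 2" if t: "t > 0" for i t
  proof -
    have p: "grid_scale i * t > 0" using t grid_scale_pos by simp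
    have "bose 0 (grid_scale i * t) \<le> B * (grid_scale i * t) powr - 2" using B(2)[OF p order_refl] by simp
    then have "bose 0 (grid_scale i * t) / t\<^sup>2 \<le> B * (grid_scale i * t) powr - 2 / t\<^sup>2" by (rule divide_right_mono) simp
    also have "\<dots> = B / t ^ 4 * grid_scale i powr - 2"
      using t grid_scale_pos[of i] by (simp add: powr_minus_divide powr_numeral power2_eq_square power4_eq_xxxx field_simps)
    finally show ?thesis .
  qed
  then show ?thesis using that B(1) by blast
qed

lemma log_sum1_deriv:
  assumes t: "t > 0"
  shows "(log_sum1 has_real_derivative bose_sum t / t\<^sup>2) (at t)" "summable (\<lambda>i. bose 0 (grid_scale i * t))"
proof -
  obtain B where B: "B > 0" "\<And>i t. t > 0 \<Longrightarrow> bose 0 (grid_scale i * t) / t\<^sup>2 \<le> B / t ^ 4 * grid_scale i powr - 2"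
    by (rule bose_term_bound) blast
  have bn: "norm (bose 0 (grid_scale i * x) / x\<^sup>2) \<le> B / x ^ 4 * grid_scale i powr - 2" if "x > 0" for i x
    using B(2)[OF that, of i] bose_nonneg[of "grid_scale i * x"] by (simp add: abs_of_nonneg)
  have sm: "summable (\<lambda>i. bose 0 (grid_scale i * t) / t\<^sup>2)"
    by (rule summable_comparison_test'[OF summable_mult[OF summable_grid_scale[of 2], of "B / t ^ 4"]]) (use bn t in auto)
  show s: "summable (\<lambda>i. bose 0 (grid_scale i * t))"
    using summable_mult2[OF sm, of "t\<^sup>2"] t by simp
  define S where "S = {t/2<..}"
  have tS: "t \<in> interior S" "t \<in> S" using t by (auto simp: S_def interior_open)
  have "uniformly_convergent_on S (\<lambda>n x. \<Sum>i<n. bose 0 (grid_scale i * x) / x\<^sup>2)"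
  proof (rule Weierstrass_m_test')
    show "summable (\<lambda>i. B / (t/2) ^ 4 * grid_scale i powr - 2)" by (intro summable_mult summable_grid_scale) simp
    fix i x assume "x \<in> S"
    then have x: "x > t/2" "x > 0" using t by (auto simp: S_def)
    have "norm (bose 0 (grid_scale i * x) / x\<^sup>2) \<le> B / x ^ 4 * grid_scale i powr - 2" by (rule bn[OF x(2)])
    also have "\<dots> \<le> B / (t/2) ^ 4 * grid_scale i powr - 2"
      using x t B(1) by (intro mult_right_mono divide_left_mono power_mono) auto
    finally show "norm (bose 0 (grid_scale i * x) / x\<^sup>2) \<le> B / (t/2) ^ 4 * grid_scale i powr - 2" .
  qed
  moreover have "((\<lambda>x. grid_scale i * (- 1 / (exp (grid_scale i * x) - 1))) has_real_derivative bose 0 (grid_scale i * x) / x\<^sup>2) (at x within S)" if "x \<in> S" for i x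
  proof -
    have x: "x > 0" using that t by (simp add: S_def)
    have p: "grid_scale i * x > 0" using x grid_scale_pos[of i] by simp
    have "((\<lambda>x. - 1 / (exp (grid_scale i * x) - 1)) has_real_derivative bose 0 (grid_scale i * x) / (grid_scale i * x)\<^sup>2 * grid_scale i) (at x)"
      by (rule DERIV_chain2[OF bose_deriv_eq[OF p] DERIV_cmult_Id])
    from DERIV_cmult[OF this, of "grid_scale i"]
    have "((\<lambda>x. grid_scale i * (- 1 / (exp (grid_scale i * x) - 1))) has_real_derivative grid_scale i * (bose 0 (grid_scale i * x) / (grid_scale i * x)\<^sup>2 * grid_scale i)) (at x)" .
    moreover have "grid_scale i * (bose 0 (grid_scale i * x) / (grid_scale i * x)\<^sup>2 * grid_scale i) = bose 0 (grid_scale i * x) / x\<^sup>2"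
      using grid_scale_pos[of i] x by (simp add: power2_eq_square)
    ultimately show ?thesis by (simp only: has_field_derivative_at_within)
  qed
  ultimately have "((\<lambda>x. \<Sum>i. grid_scale i * (- 1 / (exp (grid_scale i * x) - 1))) has_real_derivative (\<Sum>i. bose 0 (grid_scale i * t) / t\<^sup>2)) (at t)"
    using tS summable_log_kernel_deriv(2)[OF t]
    by (intro has_field_derivative_series'(2)[where S = S and ?x0.0 = t]) (auto simp: S_def)
  then show "(log_sum1 has_real_derivative bose_sum t / t\<^sup>2) (at t)"
    using suminf_divide[OF s, of "t\<^sup>2"] by (simp add: log_sum1_def[abs_def] bose_sum_def)
qed

text \<open>The iterated products are exponentials of iterated sums. The terms are nonnegative, so
  these equal the unordered sum over all pairs, in particular the one along
  \<open>prod_decode\<close>.\<close>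

lemma h_eq_log_sum:
  assumes t: "t > 0"
  shows "h t = log_sum t"
proof -
  define a where "a = (\<lambda>j k. log_kernel (real (grid_weight j k) / 2 * t))"
  have "grid_weight j k > 0" for j k by (simp add: grid_weight_def)
  then have gp: "real (grid_weight j k) / 2 * t > 0" for j k using t by simp
  have a0: "a j k \<ge> 0" for j k unfolding a_def by (rule log_kernel_nonneg[OF gp])
  have "(\<lambda>i. log_kernel (grid_scale i * t)) sums log_sum t"
    unfolding log_sum_def by (rule summable_sums[OF summable_log_kernel[OF t]])
  then have "((\<lambda>i. (\<lambda>n. log_kernel (real n / 2 * t)) (case prod_decode i of (j, k) \<Rightarrow> grid_weight j k)) has_sum log_sum t) UNIV"
    unfolding grid_scale_def using log_kernel_nonneg[OF gp]
    by (intro sums_nonneg_imp_has_sum) (auto split: prod.split)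
  then have P: "((\<lambda>(j, k). a j k) has_sum log_sum t) (UNIV \<times> UNIV)"
    unfolding a_def by (subst (asm) has_sum_prod_decode) simp
  have "(\<lambda>(j, k). a j k) summable_on (UNIV \<times> UNIV)" using P by (rule has_sum_imp_summable)
  then have sj: "a j summable_on UNIV" for j using summable_on_SigmaD1[of a UNIV "\<lambda>_. UNIV" j] by auto
  then have aj: "(a j has_sum infsum (a j) UNIV) UNIV" for j by (rule has_sum_infsum)
  have J: "((\<lambda>j. infsum (a j) UNIV) has_sum log_sum t) UNIV"
    by (rule has_sum_SigmaD[OF P]) (use aj in auto)
  have inner: "(\<Prod>k. inverse (1 - exp (- t) ^ (Suc j * Suc k * (Suc j + Suc k) div 2))) = exp (infsum (a j) UNIV)" for j
  proof -
    have "inverse (1 - exp (- t) ^ (Suc j * Suc k * (Suc j + Suc k) div 2)) = exp (a j k)" for k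
    proof -
      \<comment> \<open>Evenness of the weight turns \<open>div 2\<close> on natural numbers into
        the real quotient.\<close>
      have "exp (- t) ^ (grid_weight j k div 2) = exp (- (real (grid_weight j k) / 2 * t))"
        using even_grid_weight[of j k] by (simp add: real_of_nat_div mult.commute flip: exp_of_nat_mult)
      then have "1 - exp (- t) ^ (grid_weight j k div 2) > 0" using gp[of j k] by simp
      then have "inverse (1 - exp (- t) ^ (grid_weight j k div 2)) = exp (a j k)"
        unfolding a_def log_kernel_def using \<open>exp (- t) ^ _ = _\<close> by (simp add: exp_minus)
      then show ?thesis by (simp only: grid_weight_def)
    qed
    then have "(\<Prod>k. inverse (1 - exp (- t) ^ (Suc j * Suc k * (Suc j + Suc k) div 2))) = (\<Prod>k. exp (a j k))" by simp
    also have "\<dots> = exp (suminf (a j))" using has_sum_imp_sums[OF aj] by (intro prodinf_exp) (auto simp: sums_iff)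
    also have "suminf (a j) = infsum (a j) UNIV" using has_sum_imp_sums[OF aj] by (simp add: sums_iff)
    finally show ?thesis .
  qed
  have "G (exp (- t)) = (\<Prod>j. exp (infsum (a j) UNIV))" unfolding G_def inner ..
  also have "\<dots> = exp (\<Sum>j. infsum (a j) UNIV)" using has_sum_imp_sums[OF J] by (intro prodinf_exp) (auto simp: sums_iff)
  also have "(\<Sum>j. infsum (a j) UNIV) = log_sum t" using has_sum_imp_sums[OF J] by (simp add: sums_iff)
  finally show ?thesis by (simp add: h_def)
qed

lemma h_deriv:
  assumes "t > 0"
  shows "(h has_real_derivative log_sum1 t) (at t)"
proof (rule DERIV_cong_ev[OF refl _ refl, THEN iffD1, OF _ log_sum_deriv[OF assms]])
  have "\<forall>\<^sub>F x in nhds t. x \<in> {0<..}" using assms by (intro eventually_nhds_in_open) auto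
  then show "\<forall>\<^sub>F x in nhds t. log_sum x = h x" by eventually_elim (simp add: h_eq_log_sum)
qed

lemma deriv_h: "t > 0 \<Longrightarrow> deriv h t = log_sum1 t"
  using h_deriv by (rule DERIV_imp_deriv)

lemma deriv_deriv_h:
  assumes "t > 0"
  shows "deriv (deriv h) t = bose_sum t / t\<^sup>2"
proof (rule DERIV_imp_deriv, rule DERIV_cong_ev[OF refl _ refl, THEN iffD1, OF _ log_sum1_deriv(1)[OF assms]])
  have "\<forall>\<^sub>F x in nhds t. x \<in> {0<..}" using assms by (intro eventually_nhds_in_open) auto
  then show "\<forall>\<^sub>F x in nhds t. log_sum1 x = deriv h x" by eventually_elim (simp add: deriv_h)
qed

section \<open>The expansions of h and its derivatives\<close>

theorem bose_sum_asymptotic: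
  obtains C where "C > 0" "\<And>t. t > 0 \<Longrightarrow> t \<le> 1 \<Longrightarrow>
    \<bar>bose_sum t - (2 * bose.cubic_mass * beta_mass * 2 powr (2/3) * t powr - (2/3)
       + 2 * bose.cubic_moment * 2 powr (1/2) * t powr - (1/2) + 1/3)\<bar> \<le> C * t powr (1/2)"
proof -
  obtain C where C: "C > 0" "\<And>u. u > 0 \<Longrightarrow> u \<le> 1 \<Longrightarrow> \<exists>S.
    ((\<lambda>(j, k). bose 0 (u * real (Suc j * Suc k * (Suc j + Suc k)))) has_sum S) UNIV \<and>
    \<bar>S - (2 * (bose.cubic_mass * beta_mass * u powr - (2/3)) + 2 * (bose.cubic_moment * u powr - (1/2)) + bose 0 0 / 3)\<bar> \<le> C * u powr (1/2)"
    by (rule bose.grid_sum) blast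
  have "\<bar>bose_sum t - (2 * bose.cubic_mass * beta_mass * 2 powr (2/3) * t powr - (2/3)
       + 2 * bose.cubic_moment * 2 powr (1/2) * t powr - (1/2) + 1/3)\<bar> \<le> C * t powr (1/2)" if t: "t > 0" "t \<le> 1" for t
  proof -
    obtain S where S: "((\<lambda>(j, k). bose 0 (t/2 * real (grid_weight j k))) has_sum S) UNIV"
       "\<bar>S - (2 * (bose.cubic_mass * beta_mass * (t/2) powr - (2/3)) + 2 * (bose.cubic_moment * (t/2) powr - (1/2)) + bose 0 0 / 3)\<bar> \<le> C * (t/2) powr (1/2)"
      using C(2)[of "t/2"] t unfolding grid_weight_def by auto
    have "((\<lambda>i. (\<lambda>n. bose 0 (t/2 * real n)) (case prod_decode i of (j, k) \<Rightarrow> grid_weight j k)) has_sum S) UNIV"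
      by (subst has_sum_prod_decode) (rule S(1))
    then have "(\<lambda>i. bose 0 (grid_scale i * t)) sums S"
      using has_sum_imp_sums by (fastforce simp: grid_scale_def mult.commute)
    then have e: "bose_sum t = S" by (simp add: bose_sum_def sums_iff)
    have "(t/2) powr - p = 2 powr p * t powr - p" for p using t by (simp add: powr_divide powr_minus_divide)
    moreover have "C * (t/2) powr (1/2) \<le> C * t powr (1/2)" using C(1) t by (intro mult_left_mono powr_mono2) auto
    ultimately show ?thesis using S(2) unfolding e by (simp add: bose_0 mult_ac)
  qed
  then show ?thesis using that C(1) by blast
qed

text \<open>E + 2 C t^(-1/2) decreases and E - 2 C t^(-1/2) increases in t, so both are compared
  with their values at 1. The term E 1 is absorbed because t^(-1/2) \<ge> 1.\<close>

lemma integrate_remainder_infinite: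
  fixes E E' :: "real \<Rightarrow> real"
  assumes D: "\<And>t. 0 < t \<Longrightarrow> t \<le> 1 \<Longrightarrow> (E has_real_derivative E' t) (at t)"
    and B: "\<And>t. 0 < t \<Longrightarrow> t \<le> 1 \<Longrightarrow> \<bar>E' t\<bar> \<le> C * t powr - (3/2)" and C: "C \<ge> 0"
    and t: "0 < t" "t \<le> 1"
  shows "\<bar>E t\<bar> \<le> (\<bar>E 1\<bar> + 2 * C) * t powr - (1/2)"
proof -
  have dp: "((\<lambda>s. 2 * C * s powr - (1/2)) has_real_derivative - C * s powr - (3/2)) (at s)" if "s > 0" for s
    using that by (auto intro!: derivative_eq_intros)
  have "E 1 + 2 * C * 1 powr - (1/2) \<le> E t + 2 * C * t powr - (1/2)"
  proof (rule DERIV_nonpos_imp_nonincreasing[OF t(2)])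
    fix s assume s: "t \<le> s" "s \<le> 1"
    then have "((\<lambda>s. E s + 2 * C * s powr - (1/2)) has_real_derivative E' s + - C * s powr - (3/2)) (at s)"
      using t by (intro DERIV_add D dp) auto
    moreover have "E' s + - C * s powr - (3/2) \<le> 0" using B[of s] s t by simp
    ultimately show "\<exists>y. ((\<lambda>s. E s + 2 * C * s powr - (1/2)) has_real_derivative y) (at s) \<and> y \<le> 0" by blast
  qed
  moreover have "E t - 2 * C * t powr - (1/2) \<le> E 1 - 2 * C * 1 powr - (1/2)"
  proof (rule DERIV_nonneg_imp_nondecreasing[OF t(2)])
    fix s assume s: "t \<le> s" "s \<le> 1"
    then have "((\<lambda>s. E s - 2 * C * s powr - (1/2)) has_real_derivative E' s - - C * s powr - (3/2)) (at s)"
      using t by (intro DERIV_diff D dp) auto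
    moreover have "E' s - - C * s powr - (3/2) \<ge> 0" using B[of s] s t by simp
    ultimately show "\<exists>y. ((\<lambda>s. E s - 2 * C * s powr - (1/2)) has_real_derivative y) (at s) \<and> 0 \<le> y" by blast
  qed
  ultimately have "\<bar>E t\<bar> \<le> \<bar>E 1\<bar> + 2 * C * t powr - (1/2)" using C by simp
  moreover have "\<bar>E 1\<bar> * 1 \<le> \<bar>E 1\<bar> * t powr - (1/2)"
    using powr_mono'[of "-(1/2)" 0 t] t by (intro mult_left_mono) auto
  ultimately show ?thesis by (simp add: algebra_simps)
qed

text \<open>E - 2 C t^(1/2) decreases and E + 2 C t^(1/2) increases in t, and every value of the
  former lies below every value of the latter. The supremum c of the former is the limit of E at
  0.\<close>

lemma integrate_remainder_convergent:
  fixes E E' :: "real \<Rightarrow> real"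
  assumes D: "\<And>t. 0 < t \<Longrightarrow> t \<le> 1 \<Longrightarrow> (E has_real_derivative E' t) (at t)"
    and B: "\<And>t. 0 < t \<Longrightarrow> t \<le> 1 \<Longrightarrow> \<bar>E' t\<bar> \<le> C * t powr - (1/2)" and C: "C \<ge> 0"
  shows "\<exists>c. \<forall>t. 0 < t \<longrightarrow> t \<le> 1 \<longrightarrow> \<bar>E t - c\<bar> \<le> 2 * C * t powr (1/2)"
proof -
  define L where "L = (\<lambda>t. E t - 2 * C * t powr (1/2))"
  define U where "U = (\<lambda>t. E t + 2 * C * t powr (1/2))"
  have dp: "((\<lambda>s. 2 * C * s powr (1/2)) has_real_derivative C * s powr - (1/2)) (at s)" if "s > 0" for s
    using that by (auto intro!: derivative_eq_intros)
  have Umono: "U s \<le> U t" if "0 < s" "s \<le> t" "t \<le> 1" for s t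
    unfolding U_def
  proof (rule DERIV_nonneg_imp_nondecreasing[OF that(2)])
    fix r assume r: "s \<le> r" "r \<le> t"
    then have "((\<lambda>s. E s + 2 * C * s powr (1/2)) has_real_derivative E' r + C * r powr - (1/2)) (at r)"
      using that by (intro DERIV_add D dp) auto
    moreover have "E' r + C * r powr - (1/2) \<ge> 0" using B[of r] r that by simp
    ultimately show "\<exists>y. ((\<lambda>s. E s + 2 * C * s powr (1/2)) has_real_derivative y) (at r) \<and> 0 \<le> y" by blast
  qed
  have Lmono: "L t \<le> L s" if "0 < s" "s \<le> t" "t \<le> 1" for s t
    unfolding L_def
  proof (rule DERIV_nonpos_imp_nonincreasing[OF that(2)])
    fix r assume r: "s \<le> r" "r \<le> t"
    then have "((\<lambda>s. E s - 2 * C * s powr (1/2)) has_real_derivative E' r - C * r powr - (1/2)) (at r)"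
      using that by (intro DERIV_diff D dp) auto
    moreover have "E' r - C * r powr - (1/2) \<le> 0" using B[of r] r that by simp
    ultimately show "\<exists>y. ((\<lambda>s. E s - 2 * C * s powr (1/2)) has_real_derivative y) (at r) \<and> y \<le> 0" by blast
  qed
  have LU: "L s \<le> U t" if "0 < s" "s \<le> 1" "0 < t" "t \<le> 1" for s t
  proof -
    define m where "m = min s t"
    have m: "0 < m" "m \<le> s" "m \<le> t" using that by (auto simp: m_def)
    have "L s \<le> L m" "U m \<le> U t" using m that by (auto intro: Lmono Umono)
    moreover have "L m \<le> U m" using C by (simp add: L_def U_def)
    ultimately show ?thesis by linarith
  qed
  define c where "c = (SUP s\<in>{0<..1}. L s)"
  have bdd: "bdd_above (L ` {0<..1})" using LU[of _ 1] by (intro bdd_aboveI2[of _ _ "U 1"]) auto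
  have "L t \<le> c" "c \<le> U t" if "0 < t" "t \<le> 1" for t
    unfolding c_def using that bdd LU by (auto intro!: cSUP_upper cSUP_least)
  then show ?thesis by (intro exI[of _ c]) (fastforce simp: L_def U_def abs_le_iff)
qed

text \<open>The constant c is not identified yet. Replacing mu1 and mu2 by real numbers m1 and m2
  keeps the estimates and the monotonicity arguments real.\<close>

theorem h_asymptotic:
  obtains m1 m2 c C where "of_real m1 = mu1" "of_real m2 = mu2" "C > 0"
    "\<And>t. 0 < t \<Longrightarrow> t \<le> 1 \<Longrightarrow> \<bar>h t - (m1 * t powr - (2/3) + m2 * t powr - (1/2) - 1/3 * ln t + c)\<bar> \<le> C * t powr (1/2)"
    "\<And>t. 0 < t \<Longrightarrow> t \<le> 1 \<Longrightarrow> \<bar>deriv h t - (- (2/3) * m1 * t powr - (5/3) - 1/2 * m2 * t powr - (3/2) - 1/3 * t powr - 1)\<bar> \<le> C * t powr - (1/2)"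
    "\<And>t. 0 < t \<Longrightarrow> t \<le> 1 \<Longrightarrow> \<bar>deriv (deriv h) t - (10/9 * m1 * t powr - (8/3) + 3/4 * m2 * t powr - (5/2) + 1/3 * t powr - 2)\<bar> \<le> C * t powr - (3/2)"
proof -
  define A where "A = 2 * bose.cubic_mass * beta_mass * 2 powr (2/3)"
  define B where "B = 2 * bose.cubic_moment * 2 powr (1/2)"
  obtain C0 where C0: "C0 > 0" "\<And>t. t > 0 \<Longrightarrow> t \<le> 1 \<Longrightarrow>
    \<bar>bose_sum t - (A * t powr - (2/3) + B * t powr - (1/2) + 1/3)\<bar> \<le> C0 * t powr (1/2)"
    unfolding A_def B_def by (rule bose_sum_asymptotic) blast
  define m1 where "m1 = 9/10 * A"
  define m2 where "m2 = 4/3 * B"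
  have m: "of_real m1 = mu1" "of_real m2 = mu2"
    using bose_constants unfolding m1_def m2_def A_def B_def of_real_mult[of "9/10"] of_real_mult[of "4/3"] by simp_all
  have AB: "A = 10/9 * m1" "B = 3/4 * m2" by (simp_all add: m1_def m2_def)
  define P2 where "P2 = (\<lambda>t. 10/9 * m1 * t powr - (8/3) + 3/4 * m2 * t powr - (5/2) + 1/3 * t powr - 2)"
  define P1 where "P1 = (\<lambda>t. - (2/3) * m1 * t powr - (5/3) - 1/2 * m2 * t powr - (3/2) - 1/3 * t powr - 1)"
  define P0 where "P0 = (\<lambda>t. m1 * t powr - (2/3) + m2 * t powr - (1/2) - 1/3 * ln t)"
  have b2: "\<bar>bose_sum t / t\<^sup>2 - P2 t\<bar> \<le> C0 * t powr - (3/2)" if t: "0 < t" "t \<le> 1" for t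
  proof -
    have sq: "x / t\<^sup>2 = x * t powr - 2" for x using t by (simp add: powr_minus_divide powr_numeral)
    have "P2 t = (A * t powr - (2/3) + B * t powr - (1/2) + 1/3) / t\<^sup>2"
      unfolding sq P2_def AB distrib_right mult.assoc using powr_add[of t "-(2/3)" "-2"] powr_add[of t "-(1/2)" "-2"] by simp
    then have "\<bar>bose_sum t / t\<^sup>2 - P2 t\<bar> = \<bar>bose_sum t - (A * t powr - (2/3) + B * t powr - (1/2) + 1/3)\<bar> / t\<^sup>2"
      using t by (simp add: diff_divide_distrib[symmetric])
    also have "\<dots> \<le> C0 * t powr (1/2) / t\<^sup>2" using C0(2)[OF t] by (intro divide_right_mono) auto
    also have "\<dots> = C0 * t powr - (3/2)" unfolding sq mult.assoc using powr_add[of t "1/2" "-2"] by simp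
    finally show ?thesis .
  qed
  have d1: "((\<lambda>t. log_sum1 t - P1 t) has_real_derivative bose_sum t / t\<^sup>2 - P2 t) (at t)" if t: "0 < t" for t
  proof -
    have dp: "((\<lambda>s. s powr p) has_real_derivative p * t powr (p - 1)) (at t)" for p
      using t by (rule has_real_derivative_powr)
    have "(P1 has_real_derivative P2 t) (at t)"
      unfolding P1_def
      by (rule DERIV_cong[OF DERIV_diff[OF DERIV_diff[OF DERIV_cmult[OF dp] DERIV_cmult[OF dp]] DERIV_cmult[OF dp]]])
         (simp add: P2_def)
    then show ?thesis by (intro DERIV_diff log_sum1_deriv t)
  qed
  define C1 where "C1 = \<bar>log_sum1 1 - P1 1\<bar> + 2 * C0"
  have b1: "\<bar>log_sum1 t - P1 t\<bar> \<le> C1 * t powr - (1/2)" if t: "0 < t" "t \<le> 1" for t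
    unfolding C1_def using d1 b2 C0(1) t by (intro integrate_remainder_infinite[where E' = "\<lambda>t. bose_sum t / t\<^sup>2 - P2 t"]) auto
  have d0: "((\<lambda>t. h t - P0 t) has_real_derivative log_sum1 t - P1 t) (at t)" if t: "0 < t" for t
  proof -
    have dp: "((\<lambda>s. s powr p) has_real_derivative p * t powr (p - 1)) (at t)" for p
      using t by (rule has_real_derivative_powr)
    have "(P0 has_real_derivative P1 t) (at t)"
      unfolding P0_def
      by (rule DERIV_cong[OF DERIV_diff[OF DERIV_add[OF DERIV_cmult[OF dp] DERIV_cmult[OF dp]] DERIV_cmult[OF DERIV_ln_divide[OF t]]]])
         (use t in \<open>simp add: P1_def powr_neg_one\<close>)
    then show ?thesis by (intro DERIV_diff h_deriv t)
  qed
  have C1: "C1 \<ge> 0" using C0(1) by (simp add: C1_def)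
  obtain c where b0: "\<And>t. 0 < t \<Longrightarrow> t \<le> 1 \<Longrightarrow> \<bar>h t - P0 t - c\<bar> \<le> 2 * C1 * t powr (1/2)"
    using integrate_remainder_convergent[OF d0 b1 C1] by blast
  define C where "C = C0 + 2 * C1"
  have C: "C > 0" "C0 \<le> C" "C1 \<le> C" "2 * C1 \<le> C" using C0(1) C1 by (auto simp: C_def)
  show thesis
  proof (rule that[OF m C(1)])
    fix t :: real assume t: "0 < t" "t \<le> 1"
    have "2 * C1 * t powr (1/2) \<le> C * t powr (1/2)" using C by (intro mult_right_mono) auto
    then show "\<bar>h t - (m1 * t powr - (2/3) + m2 * t powr - (1/2) - 1/3 * ln t + c)\<bar> \<le> C * t powr (1/2)"
      using b0[OF t] by (simp add: P0_def algebra_simps)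
    have "C1 * t powr - (1/2) \<le> C * t powr - (1/2)" using C by (intro mult_right_mono) auto
    then show "\<bar>deriv h t - (- (2/3) * m1 * t powr - (5/3) - 1/2 * m2 * t powr - (3/2) - 1/3 * t powr - 1)\<bar> \<le> C * t powr - (1/2)"
      using b1[OF t] unfolding deriv_h[OF t(1)] P1_def by linarith
    have "C0 * t powr - (3/2) \<le> C * t powr - (3/2)" using C by (intro mult_right_mono) auto
    then show "\<bar>deriv (deriv h) t - (10/9 * m1 * t powr - (8/3) + 3/4 * m2 * t powr - (5/2) + 1/3 * t powr - 2)\<bar> \<le> C * t powr - (3/2)"
      using b2[OF t] unfolding deriv_deriv_h[OF t(1)] P2_def by linarith
  qed
qed

section \<open>Mellin transforms of h and of the logarithmic kernel\<close>

lemma mellin_near0_ln: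
  assumes "\<sigma> > 0"
  shows "mellin_integrable (near0 ln) \<sigma>" "mellin (near0 ln) (of_real \<sigma>) = - 1 / of_real \<sigma> ^ 2"
proof -
  show i: "mellin_integrable (near0 ln) \<sigma>"
  proof (rule mellin_integrable_near0_bound[where a = "- (\<sigma>/2)" and A = "2 / \<sigma>"])
    fix t :: real assume t: "0 < t" "t \<le> 1"
    \<comment> \<open>The logarithm costs t^(-\<sigma>/2), which leaves half of \<sigma> for
      convergence at 0.\<close>
    have "\<sigma>/2 * - ln t \<le> exp (\<sigma>/2 * - ln t)" using exp_ge_add_one_self[of "\<sigma>/2 * - ln t"] by linarith
    also have "\<dots> = t powr - (\<sigma>/2)" using t by (simp add: powr_def)
    finally show "\<bar>ln t\<bar> \<le> 2 / \<sigma> * t powr - (\<sigma>/2)" using t assms by (simp add: field_simps)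
  qed (use assms in auto)
  \<comment> \<open>A primitive of ln t times t^(\<sigma> - 1) that tends to 0 at 0.\<close>
  define F where "F = (\<lambda>t. t powr \<sigma> * ln t / \<sigma> - t powr \<sigma> / \<sigma>\<^sup>2)"
  have i': "set_integrable lborel {0<..<1} (\<lambda>t. ln t * t powr (\<sigma> - 1))"
  proof -
    have "set_integrable lborel {0<..<1} (\<lambda>t. near0 ln t * t powr (\<sigma> - 1))"
      by (rule set_integrable_subset[OF i[unfolded mellin_integrable_def]]) auto
    then show ?thesis by (subst set_integrable_cong[OF refl refl, of _ _ "\<lambda>t. near0 ln t * t powr (\<sigma> - 1)"]) (auto simp: near0_def)
  qed
  have "(LBINT t=ereal 0..ereal 1. ln t * t powr (\<sigma> - 1)) = F 1 - 0"
  proof (rule interval_integral_FTC_integrable[where F = F])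
    fix t :: real assume "ereal 0 < ereal t"
    then have t: "t > 0" by simp
    have "(F has_real_derivative ln t * t powr (\<sigma> - 1)) (at t)"
      unfolding F_def using t assms
      by (auto intro!: derivative_eq_intros simp: powr_diff field_simps power2_eq_square)
    then show "(F has_vector_derivative ln t * t powr (\<sigma> - 1)) (at t)"
      by (simp add: has_real_derivative_iff_has_vector_derivative)
    show "isCont (\<lambda>t. ln t * t powr (\<sigma> - 1)) t" using t by (intro continuous_intros) auto
  next
    show "set_integrable lborel (einterval (ereal 0) (ereal 1)) (\<lambda>t. ln t * t powr (\<sigma> - 1))" using i' by simp
    have "(F \<longlongrightarrow> 0) (at_right 0)" unfolding F_def using assms by real_asymp
    then show "((F \<circ> real_of_ereal) \<longlongrightarrow> 0) (at_right (ereal 0))" by (simp add: ereal_tendsto_simps1)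
    have "isCont F 1" unfolding F_def using assms by (intro continuous_intros) auto
    then have "(F \<longlongrightarrow> F 1) (at_left 1)" by (simp add: isCont_def filterlim_at_split)
    then show "((F \<circ> real_of_ereal) \<longlongrightarrow> F 1) (at_left (ereal 1))" by (simp add: ereal_tendsto_simps1)
  qed simp
  then have "(LINT t:{0<..<1}|lborel. ln t * t powr (\<sigma> - 1)) = - 1 / \<sigma>\<^sup>2"
    by (simp add: interval_lebesgue_integral_def F_def)
  moreover have "(LINT t:{0<..}|lborel. near0 ln t * t powr (\<sigma> - 1)) = (LINT t:{0<..<1}|lborel. ln t * t powr (\<sigma> - 1))"
    unfolding set_lebesgue_integral_def near0_def
    by (intro Bochner_Integration.integral_cong refl) (auto simp: indicator_def)
  ultimately show "mellin (near0 ln) (of_real \<sigma>) = - 1 / of_real \<sigma> ^ 2" by (simp add: mellin_of_real)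
qed

text \<open>From 1 - e^(-x) \<le> x and x e^(-x) \<le> 1 - e^(-x). Removing the logarithm leaves a
  function of order x, whose transform over (0, 1] extends beyond the imaginary axis.\<close>

lemma log_kernel_near_0:
  assumes "x > 0"
  shows "0 \<le> log_kernel x + ln x" "log_kernel x + ln x \<le> x"
proof -
  have e: "0 < 1 - exp (- x)" using assms by simp
  have "1 - exp (- x) \<le> x" using exp_ge_add_one_self[of "- x"] by linarith
  then have "ln (1 - exp (- x)) \<le> ln x" using e by simp
  then show "0 \<le> log_kernel x + ln x" by (simp add: log_kernel_def)
  have "x + 1 \<le> exp x" using exp_ge_add_one_self[of x] by linarith
  then have "x * exp (- x) \<le> 1 - exp (- x)" by (simp add: exp_minus field_simps)
  then have "ln (x * exp (- x)) \<le> ln (1 - exp (- x))" using e assms by (intro ln_mono) auto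
  then show "log_kernel x + ln x \<le> x" using assms by (simp add: log_kernel_def ln_mult)
qed

lemma log_kernel_mellin_integrable:
  assumes s: "\<sigma> > 0"
  shows "mellin_integrable log_kernel \<sigma>"
proof -
  have p: "\<sigma> + 1 \<ge> 0" using s by simp
  obtain B where B: "B > 0" "\<And>x. x \<ge> 0 \<Longrightarrow> x powr (\<sigma> + 1) * exp (- (1 * x)) \<le> B"
    using exp_decay_powr_bound[OF p, of 1] by auto
  show ?thesis
  proof (rule mellin_integrable_powr_bounds[where a = "- (\<sigma>/2)" and A = "2 / \<sigma> + 1" and b = "- (\<sigma> + 1)" and B = "2 * B"])
    fix t :: real assume t: "0 < t" "t \<le> 1"
    have "\<sigma>/2 * - ln t \<le> exp (\<sigma>/2 * - ln t)" using exp_ge_add_one_self[of "\<sigma>/2 * - ln t"] by linarith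
    also have "\<dots> = t powr - (\<sigma>/2)" using t by (simp add: powr_def)
    finally have 1: "- ln t \<le> 2 / \<sigma> * t powr - (\<sigma>/2)" using s by (simp add: field_simps)
    have 2: "1 \<le> t powr - (\<sigma>/2)" using powr_mono'[of "- (\<sigma>/2)" 0 t] s t by simp
    have "log_kernel t \<le> - ln t + t" using log_kernel_near_0(2)[OF t(1)] by linarith
    also have "\<dots> \<le> (2 / \<sigma> + 1) * t powr - (\<sigma>/2)" using 1 2 t by (simp add: algebra_simps)
    finally show "\<bar>log_kernel t\<bar> \<le> (2 / \<sigma> + 1) * t powr - (\<sigma>/2)" using log_kernel_nonneg[OF t(1)] by simp
  next
    fix t :: real assume t: "t \<ge> 1"
    have "exp t \<ge> 2" using exp_ge_add_one_self[of t] t by linarith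
    then have "1 / (exp t - 1) \<le> 1 / (exp t / 2)" using t by (intro divide_left_mono mult_pos_pos) auto
    also have "\<dots> = 2 * exp (- t)" by (simp add: exp_minus field_simps)
    also have "\<dots> \<le> 2 * (B * t powr - (\<sigma> + 1))"
    proof (intro mult_left_mono)
      have one: "t powr (\<sigma> + 1) * t powr - (\<sigma> + 1) = 1"
        using t powr_add[of t "\<sigma> + 1" "- (\<sigma> + 1)"] by simp
      have "exp (- t) = (t powr (\<sigma> + 1) * t powr - (\<sigma> + 1)) * exp (- (1 * t))" unfolding one by simp
      also have "\<dots> = (t powr (\<sigma> + 1) * exp (- (1 * t))) * t powr - (\<sigma> + 1)" by (simp only: mult_ac)
      also have "\<dots> \<le> B * t powr - (\<sigma> + 1)" using B(2)[of t] t by (intro mult_right_mono) auto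
      finally show "exp (- t) \<le> B * t powr - (\<sigma> + 1)" .
    qed simp
    finally show "\<bar>log_kernel t\<bar> \<le> 2 * B * t powr - (\<sigma> + 1)"
      using log_kernel_le[of t] log_kernel_nonneg[of t] t by simp
  qed (use s in auto)
qed

lemma mellin_log_sum:
  assumes "\<sigma> \<ge> 2"
  shows "mellin_integrable log_sum \<sigma>"
    "mellin log_sum (of_real \<sigma>) = of_real (\<Sum>i. grid_scale i powr - \<sigma>) * mellin log_kernel (of_real \<sigma>)"
proof -
  have i: "mellin_integrable log_kernel (Re (of_real \<sigma>))" using assms by (intro log_kernel_mellin_integrable) auto
  have s: "summable (\<lambda>n. 1 * grid_scale n powr - Re (of_real \<sigma>))" using summable_grid_scale[OF assms] by simp
  have F: "(\<lambda>n. 1 * log_kernel (grid_scale n * t)) sums log_sum t" if "t > 0" for t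
    using summable_sums[OF summable_log_kernel[OF that]] by (simp add: log_sum_def)
  note M = mellin_sum[OF log_kernel_measurable log_sum_measurable i grid_scale_pos zero_le_one s F log_kernel_nonneg]
  show "mellin_integrable log_sum \<sigma>" using M(1) by simp
  have e: "of_real 1 * of_real (grid_scale n) powr - of_real \<sigma> = complex_of_real (grid_scale n powr - \<sigma>)" for n
    using powr_of_real[of "grid_scale n" "- \<sigma>"] grid_scale_pos[of n] by simp
  show "mellin log_sum (of_real \<sigma>) = of_real (\<Sum>i. grid_scale i powr - \<sigma>) * mellin log_kernel (of_real \<sigma>)"
    using M(2) unfolding e suminf_of_real[OF summable_grid_scale[OF assms], symmetric] .
qed

text \<open>The factor 2^\<sigma> halves the products j k (j + k). Pairs counted from 1 are matched
  with the pairs counted from 0 in \<open>grid_weight\<close>.\<close>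

lemma omega_series_of_real:
  assumes "\<sigma> \<ge> 2"
  shows "omega_series (of_real \<sigma>) * 2 powr of_real \<sigma> = of_real (\<Sum>i. grid_scale i powr - \<sigma>)"
proof -
  have gw: "grid_weight (a - Suc 0) (b - Suc 0) = a * b * (a + b)" if "Suc 0 \<le> a" "Suc 0 \<le> b" for a b
    using that by (simp add: grid_weight_def)
  define Z where "Z = (\<Sum>i. grid_scale i powr - \<sigma>)"
  have "((\<lambda>i. grid_scale i powr - \<sigma>) has_sum Z) UNIV"
    unfolding Z_def by (intro sums_nonneg_imp_has_sum summable_sums summable_grid_scale assms) auto
  then have "((\<lambda>i. (\<lambda>n. (real n / 2) powr - \<sigma>) (case prod_decode i of (j, k) \<Rightarrow> grid_weight j k)) has_sum Z) UNIV"
    unfolding grid_scale_def by simp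
  then have "((\<lambda>(j, k). (real (grid_weight j k) / 2) powr - \<sigma>) has_sum Z) UNIV"
    by (subst (asm) has_sum_prod_decode)
  then have "((\<lambda>(j, k). (real (j * k * (j + k)) / 2) powr - \<sigma>) has_sum Z) ({1..} \<times> {1..})"
    by (rule has_sum_reindex_bij_witness[where i = "\<lambda>(j, k). (Suc j, Suc k)" and j = "\<lambda>(j, k). (j - 1, k - 1)", THEN iffD2, rotated -1])
       (auto simp: gw simp del: of_nat_mult of_nat_add)
  then have "((\<lambda>x. complex_of_real (2 powr - \<sigma>) * of_real (case x of (j, k) \<Rightarrow> (real (j * k * (j + k)) / 2) powr - \<sigma>)) has_sum (of_real (2 powr - \<sigma>) * of_real Z)) ({1..} \<times> {1..})"
    by (intro has_sum_cmult_right has_sum_of_real)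
  moreover have "complex_of_real (2 powr - \<sigma>) * of_real (case x of (j, k) \<Rightarrow> (real (j * k * (j + k)) / 2) powr - \<sigma>) =
      (case x of (j, k) \<Rightarrow> of_nat (j * k * (j + k)) powr - of_real \<sigma>)" for x :: "nat \<times> nat"
  proof (cases x)
    case (Pair j k)
    have "2 powr - \<sigma> * (real (j * k * (j + k)) / 2) powr - \<sigma> = real (j * k * (j + k)) powr - \<sigma>"
      by (subst powr_mult[symmetric]) auto
    moreover have "complex_of_real (real (j * k * (j + k)) powr - \<sigma>) = of_real (real (j * k * (j + k))) powr of_real (- \<sigma>)"
      by (rule powr_of_real[symmetric]) auto
    ultimately show ?thesis using Pair by (simp only: prod.case of_real_mult[symmetric] of_real_of_nat_eq of_real_minus)
  qed
  ultimately have "((\<lambda>(j, k). of_nat (j * k * (j + k)) powr - of_real \<sigma>) has_sum (of_real (2 powr - \<sigma>) * complex_of_real Z)) ({1..} \<times> {1..})"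
    by (simp only:)
  then have "omega_series (of_real \<sigma>) = of_real (2 powr - \<sigma>) * of_real Z"
    unfolding omega_series_def by (rule infsumI)
  moreover have "(2::complex) powr of_real \<sigma> = of_real (2 powr \<sigma>)" using powr_of_real[of 2 \<sigma>] by simp
  moreover have "2 powr - \<sigma> * 2 powr \<sigma> = (1::real)" by (simp flip: powr_add)
  ultimately show ?thesis unfolding Z_def[symmetric]
    by (metis (no_types, lifting) mult.commute mult.left_commute mult.right_neutral of_real_1 of_real_mult)
qed

section \<open>The constant term\<close>

lemma mellin_entire:
  assumes "\<phi> \<in> borel_measurable borel" "\<And>\<sigma>. \<sigma> > a \<Longrightarrow> mellin_integrable \<phi> \<sigma>"
  shows "mellin \<phi> holomorphic_on {s. Re s > a}"
proof (rule mellin_holomorphic[OF assms(1) open_halfspace_Re_gt])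
  fix s assume s: "s \<in> {s. Re s > a}"
  then show "\<exists>d>0. mellin_integrable \<phi> (Re s - d) \<and> mellin_integrable \<phi> (Re s + d)"
    by (intro exI[of _ "(Re s - a) / 2"]) (auto intro!: assms(2) simp: field_simps)
qed

text \<open>The singular part -ln t yields the double pole; the other two transforms are holomorphic
  around 0.\<close>

lemma mellin_log_kernel_expansion:
  assumes "\<sigma> > 0"
  shows "mellin log_kernel (of_real \<sigma>) = 1 / of_real \<sigma> ^ 2 + mellin (near0 (\<lambda>t. log_kernel t + ln t)) (of_real \<sigma>)
            + mellin (near_top log_kernel) (of_real \<sigma>)"
proof -
  have e: "near0 log_kernel t = near0 (\<lambda>t. log_kernel t + ln t) t + (- 1) * near0 ln t" for t by (simp add: near0_def)
  have i: "mellin_integrable (near0 (\<lambda>t. log_kernel t + ln t)) \<sigma>"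
    by (rule mellin_integrable_near0_bound[where a = 1 and A = 1]) (use assms log_kernel_near_0 in auto)
  have "mellin (\<lambda>t. near0 (\<lambda>t. log_kernel t + ln t) t + (- 1) * near0 ln t) (of_real \<sigma>)
      = mellin (near0 (\<lambda>t. log_kernel t + ln t)) (of_real \<sigma>) + mellin (\<lambda>t. (- 1) * near0 ln t) (of_real \<sigma>)"
  proof (rule mellin_add(2))
    show "mellin_integrable (near0 (\<lambda>t. log_kernel t + ln t)) (Re (of_real \<sigma>))" using i by simp
    show "mellin_integrable (\<lambda>t. (- 1) * near0 ln t) (Re (of_real \<sigma>))"
      using mellin_cmult(1)[OF mellin_near0_ln(1)[OF assms], of "-1"] by simp
  qed auto
  then have "mellin (near0 log_kernel) (of_real \<sigma>) = mellin (near0 (\<lambda>t. log_kernel t + ln t)) (of_real \<sigma>) + 1 / of_real \<sigma> ^ 2"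
    unfolding e[abs_def, symmetric] mellin_cmult(2) mellin_near0_ln(2)[OF assms] by simp
  then show ?thesis
    using mellin_split[OF log_kernel_measurable, of "of_real \<sigma>"] log_kernel_mellin_integrable[OF assms] by simp
qed

text \<open>Both sides of the relation between the Mellin transforms of \<open>log_sum\<close> and \<open>log_kernel\<close> have a double pole
  at 0; comparing the Laurent coefficients there expresses the constant term of \<open>h\<close> by \<open>deriv \<omega> 0\<close>.\<close>

lemma omega_at_0:
  assumes \<omega>: "is_omega \<omega>"
    and h: "\<And>t. 0 < t \<Longrightarrow> t \<le> 1 \<Longrightarrow> \<bar>h t - (m1 * t powr - (2/3) + m2 * t powr - (1/2) - 1/3 * ln t + c)\<bar> \<le> C * t powr (1/2)"
  shows "\<omega> analytic_on {0}" "deriv \<omega> 0 = of_real (c - 1/3 * ln 2)"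
proof -
  \<comment> \<open>The constant is written as a multiple of \<open>t powr 0\<close> so that the
    rule for truncated powers covers it.\<close>
  define e where "e = (\<lambda>t. log_sum t - (m1 * t powr - (2/3) + m2 * t powr - (1/2) + (- (1/3)) * ln t + c * t powr 0))"
  have [measurable]: "e \<in> borel_measurable borel" unfolding e_def by measurable
  have e_bound: "\<bar>e t\<bar> \<le> C * t powr (1/2)" if "0 < t" "t \<le> 1" for t
    using h[OF that] that by (simp add: e_def h_eq_log_sum)
  have ie: "mellin_integrable (near0 e) \<sigma>" if "\<sigma> > - (1/2)" for \<sigma>
    by (rule mellin_integrable_near0_bound[where a = "1/2" and A = C]) (use that e_bound in auto)
  \<comment> \<open>Beyond 1 a smaller exponent only helps, so convergence at one large abscissa
    gives convergence at every \<sigma>.\<close>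
  have iT: "mellin_integrable (near_top log_sum) \<sigma>" for \<sigma>
    by (rule mellin_integrable_near(2)[OF log_sum_measurable mellin_log_sum(1), of "max 2 \<sigma>"]) auto
  have ik: "mellin_integrable (near0 (\<lambda>t. log_kernel t + ln t)) \<sigma>" if "\<sigma> > - (1/2)" for \<sigma>
    by (rule mellin_integrable_near0_bound[where a = 1 and A = 1]) (use that log_kernel_near_0 in auto)
  have ikT: "mellin_integrable (near_top log_kernel) \<sigma>" for \<sigma>
    by (rule mellin_integrable_near(2)[OF log_kernel_measurable log_kernel_mellin_integrable, of "max 1 \<sigma>"]) auto
  define S where "S = {s. Re s > - (1/2)}"
  have S: "open S" "connected S" "0 \<in> S"
    unfolding S_def by (auto intro!: open_halfspace_Re_gt convex_connected convex_halfspace_Re_gt)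
  define X where "X = (\<lambda>s. mellin (near0 e) s + mellin (near_top log_sum) s)"
  define Y where "Y = (\<lambda>s. mellin (near0 (\<lambda>t. log_kernel t + ln t)) s + mellin (near_top log_kernel) s)"
  have hX: "X holomorphic_on S" and hY: "Y holomorphic_on S"
    unfolding X_def Y_def S_def by (intro holomorphic_on_add mellin_entire ie iT ik ikT; simp)+
  \<comment> \<open>N is s^2 times the continued transform of h, and D is 2^s s^2 times that of
    \<open>log_kernel\<close>; the factor s^2 clears the double poles. Terms regular at 0 are
    multiplied by s^2 and affect neither value nor slope there, so N has value 1/3 and slope c, and
    D has value 1 and slope ln 2.\<close>
  define N where "N = (\<lambda>s. s\<^sup>2 * (of_real m1 / (s - 2/3) + of_real m2 / (s - 1/2) + X s) + 1/3 + of_real c * s)"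
  define D where "D = (\<lambda>s. 2 powr s * (1 + s\<^sup>2 * Y s))"
  have main: "\<omega> (of_real \<sigma>) * D (of_real \<sigma>) = N (of_real \<sigma>)" if s: "\<sigma> > 2" for \<sigma>
  proof -
    let ?s = "complex_of_real \<sigma>"
    have near: "mellin (near0 log_sum) ?s = of_real m1 * (1 / of_real (\<sigma> + - (2/3))) + of_real m2 * (1 / of_real (\<sigma> + - (1/2)))
       + of_real (- (1/3)) * (- 1 / ?s ^ 2) + of_real c * (1 / of_real (\<sigma> + 0)) + mellin (near0 e) ?s"
    proof -
      let ?p1 = "\<lambda>t. m1 * near0 (\<lambda>t. t powr - (2/3)) t" and ?p2 = "\<lambda>t. m2 * near0 (\<lambda>t. t powr - (1/2)) t"
      let ?p3 = "\<lambda>t. - (1/3) * near0 ln t" and ?p4 = "\<lambda>t. c * near0 (\<lambda>t. t powr 0) t"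
      have i1: "mellin_integrable ?p1 (Re ?s)" and i2: "mellin_integrable ?p2 (Re ?s)"
       and i3: "mellin_integrable ?p3 (Re ?s)" and i4: "mellin_integrable ?p4 (Re ?s)"
        by (rule mellin_cmult(1); rule mellin_near0_powr(1) mellin_near0_ln(1); use s in simp)+
      have i5: "mellin_integrable (near0 e) (Re ?s)" using ie s by simp
      have [measurable]: "?p1 \<in> borel_measurable borel" "?p2 \<in> borel_measurable borel" "?p3 \<in> borel_measurable borel" "?p4 \<in> borel_measurable borel"
        by measurable
      have j2: "mellin_integrable (\<lambda>t. ?p1 t + ?p2 t) (Re ?s)" by (rule mellin_add(1)[OF _ _ i1 i2]) measurable
      have j3: "mellin_integrable (\<lambda>t. ?p1 t + ?p2 t + ?p3 t) (Re ?s)" by (rule mellin_add(1)[OF _ _ j2 i3]) measurable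
      have j4: "mellin_integrable (\<lambda>t. ?p1 t + ?p2 t + ?p3 t + ?p4 t) (Re ?s)" by (rule mellin_add(1)[OF _ _ j3 i4]) measurable
      have "near0 log_sum t = ?p1 t + ?p2 t + ?p3 t + ?p4 t + near0 e t" for t
        by (simp add: near0_def e_def)
      then have "mellin (near0 log_sum) ?s = mellin (\<lambda>t. ?p1 t + ?p2 t + ?p3 t + ?p4 t + near0 e t) ?s"
        by (intro mellin_cong)
      also have "\<dots> = mellin (\<lambda>t. ?p1 t + ?p2 t + ?p3 t + ?p4 t) ?s + mellin (near0 e) ?s"
        by (rule mellin_add(2)[OF _ _ j4 i5]) measurable
      also have "mellin (\<lambda>t. ?p1 t + ?p2 t + ?p3 t + ?p4 t) ?s = mellin (\<lambda>t. ?p1 t + ?p2 t + ?p3 t) ?s + mellin ?p4 ?s"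
        by (rule mellin_add(2)[OF _ _ j3 i4]) measurable
      also have "mellin (\<lambda>t. ?p1 t + ?p2 t + ?p3 t) ?s = mellin (\<lambda>t. ?p1 t + ?p2 t) ?s + mellin ?p3 ?s"
        by (rule mellin_add(2)[OF _ _ j2 i3]) measurable
      also have "mellin (\<lambda>t. ?p1 t + ?p2 t) ?s = mellin ?p1 ?s + mellin ?p2 ?s"
        by (rule mellin_add(2)[OF _ _ i1 i2]) measurable
      also have "mellin ?p1 ?s = of_real m1 * (1 / of_real (\<sigma> + - (2/3)))"
        using s by (simp only: mellin_cmult(2), subst mellin_near0_powr(2)) auto
      also have "mellin ?p2 ?s = of_real m2 * (1 / of_real (\<sigma> + - (1/2)))"
        using s by (simp only: mellin_cmult(2), subst mellin_near0_powr(2)) auto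
      also have "mellin ?p3 ?s = of_real (- (1/3)) * (- 1 / ?s ^ 2)"
        using s by (simp only: mellin_cmult(2), subst mellin_near0_ln(2)) auto
      also have "mellin ?p4 ?s = of_real c * (1 / of_real (\<sigma> + 0))"
        using s by (simp only: mellin_cmult(2), subst mellin_near0_powr(2)) auto
      finally show ?thesis .
    qed
    have split: "mellin log_sum ?s = mellin (near0 log_sum) ?s + mellin (near_top log_sum) ?s"
      using mellin_split[OF log_sum_measurable, of ?s] mellin_log_sum(1)[of \<sigma>] s by simp
    have nz: "?s \<noteq> 0" "?s - 2/3 \<noteq> 0" "?s - 1/2 \<noteq> 0"
    proof -
      have "Re (?s - 2/3) \<noteq> 0" "Re (?s - 1/2) \<noteq> 0" using s by simp_all
      then show "?s - 2/3 \<noteq> 0" "?s - 1/2 \<noteq> 0" by (metis zero_complex.simps(1))+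
      show "?s \<noteq> 0" using s by simp
    qed
    have Nval: "N ?s = ?s\<^sup>2 * mellin log_sum ?s"
    proof -
      have "?s\<^sup>2 * (of_real (- (1/3)) * (- 1 / ?s ^ 2)) = 1/3" using nz(1) by simp
      moreover have "?s\<^sup>2 * (of_real c * (1 / ?s)) = of_real c * ?s" using nz(1) by (simp add: power2_eq_square)
      ultimately show ?thesis unfolding split near N_def X_def by (simp add: algebra_simps)
    qed
    have Dval: "D ?s = 2 powr ?s * (?s\<^sup>2 * mellin log_kernel ?s)"
    proof -
      have "?s\<^sup>2 * (1 / ?s ^ 2) = 1" using nz(1) by simp
      then have "?s\<^sup>2 * mellin log_kernel ?s = 1 + ?s\<^sup>2 * Y ?s"
        using mellin_log_kernel_expansion[of \<sigma>] s unfolding Y_def by (simp add: algebra_simps)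
      then show ?thesis by (simp add: D_def)
    qed
    have "\<omega> ?s = omega_series ?s"
      using \<omega> s by (simp add: is_omega_def is_meromorphic_continuation_def)
    then have "\<omega> ?s * D ?s = (omega_series ?s * 2 powr ?s) * (?s\<^sup>2 * mellin log_kernel ?s)"
      unfolding Dval by (simp only: mult_ac)
    also have "\<dots> = ?s\<^sup>2 * mellin log_sum ?s"
      using omega_series_of_real[of \<sigma>] mellin_log_sum(2)[of \<sigma>] s by (simp only: mult_ac less_imp_le)
    finally show ?thesis by (simp only: Nval)
  qed
  have mX: "X meromorphic_on S" "Y meromorphic_on S"
    using hX hY S(1) by (auto intro!: analytic_on_imp_meromorphic_on simp: analytic_on_open)
  have n\<omega>: "\<omega> nicely_meromorphic_on UNIV" using \<omega> by (simp add: is_omega_def is_meromorphic_continuation_def)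
  have hD: "D holomorphic_on S" unfolding D_def by (intro holomorphic_intros hY) auto
  have ev: "\<forall>\<^sub>F s in at 0. \<omega> s * D s = N s"
  proof (rule meromorphic_eq_on_segment[of _ S _ 2 3])
    have "\<omega> meromorphic_on S" using n\<omega> unfolding nicely_meromorphic_on_def using meromorphic_on_subset by blast
    moreover have "D meromorphic_on S" using hD S(1) by (intro analytic_on_imp_meromorphic_on) (simp add: analytic_on_open)
    ultimately show "(\<lambda>s. \<omega> s * D s) meromorphic_on S" by (rule meromorphic_on_mult)
    \<comment> \<open>N may have poles at 2/3 and 1/2, which lie in S between the segment and 0;
      hence the meromorphic form of the identity theorem.\<close>
    show "N meromorphic_on S" unfolding N_def by (intro meromorphic_intros mX)
    show "complex_of_real x \<in> S \<and> \<omega> (of_real x) * D (of_real x) = N (of_real x)" if "2 < x" "x < 3" for x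
      using that main[of x] by (simp add: S_def)
  qed (use S in auto)
  obtain X' Y' where XY: "(X has_field_derivative X') (at 0)" "(Y has_field_derivative Y') (at 0)"
    using hX hY S(1,3) by (meson holomorphic_derivI)
  have dN: "(N has_field_derivative of_real c) (at 0)"
    unfolding N_def by (rule derivative_eq_intros XY refl | simp)+
  have dD: "(D has_field_derivative of_real (ln 2)) (at 0)"
  proof -
    have "Ln 2 = complex_of_real (ln 2)" using Ln_of_real[of 2] by simp
    then show ?thesis unfolding D_def by (auto intro!: derivative_eq_intros XY)
  qed
  have D0: "D 0 = 1" "N 0 = 1/3" by (simp_all add: D_def N_def)
  have cD: "isCont D 0" using dD by (rule DERIV_isCont)
  have "\<forall>\<^sub>F s in at 0. D s \<noteq> 0"
    using cD unfolding isCont_def by (rule tendsto_imp_eventually_ne) (simp add: D0)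
  with ev have ev': "\<forall>\<^sub>F s in at 0. \<omega> s = N s / D s" by eventually_elim (simp add: field_simps)
  \<comment> \<open>The quotient rule at 0, where D is 1 and N is 1/3.\<close>
  have dq: "((\<lambda>s. N s / D s) has_field_derivative of_real (c - 1/3 * ln 2)) (at 0)"
    by (rule DERIV_cong[OF DERIV_divide[OF dN dD]]) (simp_all add: D0)
  have cq: "isCont (\<lambda>s. N s / D s) 0" using dq by (rule DERIV_isCont)
  note v = nicely_meromorphic_value[OF n\<omega> ev' cq]
  show "\<omega> analytic_on {0}" by (rule v(2))
  have "(\<omega> has_field_derivative of_real (c - 1/3 * ln 2)) (at 0)"
    using DERIV_cong_ev[OF refl v(3) refl] dq by blast
  then show "deriv \<omega> 0 = of_real (c - 1/3 * ln 2)" by (rule DERIV_imp_deriv)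
qed

lemma bigo_at_right_0I:
  fixes F :: "real \<Rightarrow> complex"
  assumes "\<And>t. 0 < t \<Longrightarrow> t \<le> 1 \<Longrightarrow> norm (F t) \<le> C * t powr p"
  shows "F \<in> O[at_right 0](\<lambda>t. complex_of_real (t powr p))"
proof (rule bigoI[of _ C])
  have "\<forall>\<^sub>F t in at_right 0. t \<in> {0<..<1::real}" by (rule eventually_at_right_real) simp
  then show "\<forall>\<^sub>F t in at_right 0. norm (F t) \<le> C * norm (complex_of_real (t powr p))"
    by eventually_elim (use assms in auto)
qed

theorem theorem6p2:
  fixes \<omega> :: "complex \<Rightarrow> complex"
  assumes "is_omega \<omega>"
  shows "\<omega> analytic_on {0} \<and>
    (\<lambda>t. complex_of_real (h t) -
       (mu1 * of_real (t powr (- 2 / 3)) + mu2 * of_real (t powr (- 1 / 2))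
        - 1 / 3 * of_real (ln t) + deriv \<omega> 0 + 1 / 3 * of_real (ln 2)))
      \<in> O[at_right (0 :: real)](\<lambda>t. of_real (t powr (1 / 2))) \<and>
    (\<lambda>t. complex_of_real (deriv h t) -
       (- 2 / 3 * mu1 * of_real (t powr (- 5 / 3)) - 1 / 2 * mu2 * of_real (t powr (- 3 / 2))
        - 1 / 3 * of_real (t powr (- 1))))
      \<in> O[at_right (0 :: real)](\<lambda>t. of_real (t powr (- 1 / 2))) \<and>
    (\<lambda>t. complex_of_real (deriv (deriv h) t) -
       (10 / 9 * mu1 * of_real (t powr (- 8 / 3)) + 3 / 4 * mu2 * of_real (t powr (- 5 / 2))
        + 1 / 3 * of_real (t powr (- 2))))
      \<in> O[at_right (0 :: real)](\<lambda>t. of_real (t powr (- 3 / 2)))"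
proof -
  obtain m1 m2 c C where m: "of_real m1 = mu1" "of_real m2 = mu2" and "C > 0"
    and h0: "\<And>t. 0 < t \<Longrightarrow> t \<le> 1 \<Longrightarrow> \<bar>h t - (m1 * t powr - (2/3) + m2 * t powr - (1/2) - 1/3 * ln t + c)\<bar> \<le> C * t powr (1/2)"
    and h1: "\<And>t. 0 < t \<Longrightarrow> t \<le> 1 \<Longrightarrow> \<bar>deriv h t - (- (2/3) * m1 * t powr - (5/3) - 1/2 * m2 * t powr - (3/2) - 1/3 * t powr - 1)\<bar> \<le> C * t powr - (1/2)"
    and h2: "\<And>t. 0 < t \<Longrightarrow> t \<le> 1 \<Longrightarrow> \<bar>deriv (deriv h) t - (10/9 * m1 * t powr - (8/3) + 3/4 * m2 * t powr - (5/2) + 1/3 * t powr - 2)\<bar> \<le> C * t powr - (3/2)"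
    by (rule h_asymptotic) (rule that)
  \<comment> \<open>This identifies the constant of integration as c = deriv \<omega> 0 + (ln 2) /
    3.\<close>
  note om = omega_at_0[OF assms h0]
  show ?thesis
  proof (intro conjI bigo_at_right_0I[where C = C])
    show "\<omega> analytic_on {0}" by (rule om(1))
    fix t :: real assume t: "0 < t" "t \<le> 1"
    have "complex_of_real (h t) - (mu1 * of_real (t powr (- 2 / 3)) + mu2 * of_real (t powr (- 1 / 2))
        - 1 / 3 * of_real (ln t) + deriv \<omega> 0 + 1 / 3 * of_real (ln 2))
      = of_real (h t - (m1 * t powr - (2/3) + m2 * t powr - (1/2) - 1/3 * ln t + c))"
      by (simp add: om(2) m[symmetric])
    then show "cmod (complex_of_real (h t) - (mu1 * of_real (t powr (- 2 / 3)) + mu2 * of_real (t powr (- 1 / 2))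
        - 1 / 3 * of_real (ln t) + deriv \<omega> 0 + 1 / 3 * of_real (ln 2))) \<le> C * t powr (1/2)"
      using h0[OF t] by (simp only: norm_of_real)
    have "complex_of_real (deriv h t) - (- 2 / 3 * mu1 * of_real (t powr (- 5 / 3)) - 1 / 2 * mu2 * of_real (t powr (- 3 / 2))
        - 1 / 3 * of_real (t powr (- 1)))
      = of_real (deriv h t - (- (2/3) * m1 * t powr - (5/3) - 1/2 * m2 * t powr - (3/2) - 1/3 * t powr - 1))"
      by (simp add: m[symmetric])
    then show "cmod (complex_of_real (deriv h t) - (- 2 / 3 * mu1 * of_real (t powr (- 5 / 3)) - 1 / 2 * mu2 * of_real (t powr (- 3 / 2))
        - 1 / 3 * of_real (t powr (- 1)))) \<le> C * t powr (- 1 / 2)"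
      using h1[OF t] by (simp only: norm_of_real) simp
    have "complex_of_real (deriv (deriv h) t) - (10 / 9 * mu1 * of_real (t powr (- 8 / 3)) + 3 / 4 * mu2 * of_real (t powr (- 5 / 2))
        + 1 / 3 * of_real (t powr (- 2)))
      = of_real (deriv (deriv h) t - (10/9 * m1 * t powr - (8/3) + 3/4 * m2 * t powr - (5/2) + 1/3 * t powr - 2))"
      by (simp add: m[symmetric])
    then show "cmod (complex_of_real (deriv (deriv h) t) - (10 / 9 * mu1 * of_real (t powr (- 8 / 3)) + 3 / 4 * mu2 * of_real (t powr (- 5 / 2))
        + 1 / 3 * of_real (t powr (- 2)))) \<le> C * t powr (- 3 / 2)"
      using h2[OF t] by (simp only: norm_of_real) simp
  qed
qed

end
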